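(* Let $n\ge1$, $k\ge 0$, $0=a_0<a_1<\dots<a_k$, and let $\xi(x)$, $x\in\mathbb{R}^n$, be a real-valued, measurable, mean-square continuous, homogeneous isotropic Gaussian random field with zero mean whose isotropic spectral density has the form $$\varphi(|\lambda|)=\frac{h_0(|\lambda|)}{|\lambda|^{n-\alpha_0}}+\sum_{i=1}^k\frac{h_i(|\lambda|-a_i)}{\big||\lambda|-a_i\big|^{1-\alpha_i}},$$ where $\varphi(|\cdot|)\in L_1(\mathbb{R}^n)$, $0<\alpha_0<n$, $0<\alpha_i<1$ for $i=1,\dots,k$, and each $h_i\ge 0$ ($i=0,\dots,k$) is a bounded function defined on $[-a_i,+\infty)$, continuous in some neighborhood of $0$, with $h_i(0)\neq 0$. Fix $j\in\{0,\dots,k\}$ and let $f_{j,r}:\mathbb{R}^n\to\mathbb{R}$, $r>0$, be radial, essentially non-zero functions such that $f_{j,r}\in L_1(\mathbb{R}^n)\cap L_2(\mathbb{R}^n)$, the Fourier transform of $r^{-n}f_{j,r}$, namely $\lambda\mapsto r^{-n}\int_{\mathbb{R}^n}e^{i\langle\lambda,x\rangle}f_{j,r}(x)\,dx$, equals $g_j(r(|\lambda|-a_j))$ for a function $g_j:\mathbb{R}\to\mathbb{R}$ independent of $r$, and $g_j$ is even with $g_j^2(s)\le C s^{-n}$ for all $s\ge s_0$, for some constants $s_0\ge0$, $C>0$. Define $A_j=1$ if $j=0$ and $A_j=2a_j^{n-1}$ if $j\neq 0$, and $$X_{r,j}(t)=\frac{1}{\sqrt{A_j h_j(0)}\,r^{n-\alpha_j/2}}\int_{\mathbb{R}^n}f_{j,rt^{1/n}}(x)\,\xi(x)\,dx\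 \ (t\in(0,1]),\qquad X_{r,j}(0)=0.$$ Then, as $r\to\infty$, the finite-dimensional distributions of the process $X_{r,j}(t)$, $t\in[0,1]$, converge weakly to those of the process $$X_j(t)=t\int_{\mathbb{R}^n}\frac{g_j(|u|t^{1/n})}{|u|^{(n-\alpha_j)/2}}\,dZ(u)\ \ (t\in(0,1]),\qquad X_j(0)=0,$$ where $Z(\cdot)$ is the Wiener measure (Gaussian white noise) on $(\mathbb{R}^n,\mathfrak{B}^n)$.
   Context: The isotropic spectral density $\varphi$ of the field means: the covariance $\mathsf{B}_n(|x|)=\mathsf{E}\xi(0)\xi(x)$ has the representation $\mathsf{B}_n(r)=2^{(n-2)/2}\Gamma(n/2)\int_0^\infty \frac{J_{(n-2)/2}(ru)}{(ru)^{(n-2)/2}}\,d\Phi(u)$ with $\Phi(u)=\frac{2\pi^{n/2}}{\Gamma(n/2)}\int_0^u z^{n-1}\varphi(z)\,dz$, $u^{n-1}\varphi(u)\in L_1([0,\infty))$, where $J_\nu$ is the Bessel function of the first kind. A function $f:\mathbb{R}^n\to\mathbb{R}$ is radial if $f(x)=\tilde f(|x|)$ for some $\tilde f$, and essentially non-zero if it is non-zero on a set of positive Lebesgue measure. $\mathfrak{B}^n$ is the Borel $\sigma$-algebra of $\mathbb{R}^n$. *)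

theory Defs
  imports "HOL-Probability.Probability"
begin

text \<open>Normalised Bessel function: J_nu(z) / z^nu, written out via the power series
  J_nu(z) = sum_m (-1)^m / (m! Gamma(m+nu+1)) (z/2)^(2m+nu); the quotient by z^nu is
  continued continuously to z = 0.\<close>
definition bessel_ratio :: "real \<Rightarrow> real \<Rightarrow> real" where
  "bessel_ratio \<nu> z =
     (\<Sum>m. (-1) ^ m * z ^ (2 * m) / (fact m * Gamma (real m + \<nu> + 1) * 2 powr (2 * real m + \<nu>)))"

text \<open>Covariance B_n(r) of an isotropic field in R^n with isotropic spectral density phi:
  B_n(r) = 2^((n-2)/2) Gamma(n/2) int_0^infty J_{(n-2)/2}(ru)/(ru)^{(n-2)/2} dPhi(u),
  dPhi(u) = 2 pi^(n/2)/Gamma(n/2) u^(n-1) phi(u) du.\<close>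
definition iso_cov :: "nat \<Rightarrow> (real \<Rightarrow> real) \<Rightarrow> real \<Rightarrow> real" where
  "iso_cov n \<phi> r =
     2 powr ((real n - 2) / 2) * Gamma (real n / 2) *
     (LINT u:{0..}|lborel. bessel_ratio ((real n - 2) / 2) (r * u) *
        (2 * pi powr (real n / 2) / Gamma (real n / 2) * u ^ (n - 1) * \<phi> u))"

definition centered_gaussian_rv :: "'w measure \<Rightarrow> ('w \<Rightarrow> real) \<Rightarrow> real \<Rightarrow> bool" where
  "centered_gaussian_rv M X v \<longleftrightarrow>
     X \<in> borel_measurable M \<and>
     ((v = 0 \<and> (AE \<omega> in M. X \<omega> = 0)) \<or>
      (v > 0 \<and> distributed M lborel X (normal_density 0 (sqrt v))))"

definition centered_gaussian_field :: "'w measure \<Rightarrow> ('a \<Rightarrow> 'w \<Rightarrow> real) \<Rightarrow> bool" where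
  "centered_gaussian_field M \<xi> \<longleftrightarrow>
     (\<forall>S c. finite S \<longrightarrow> (\<exists>v. centered_gaussian_rv M (\<lambda>\<omega>. \<Sum>x\<in>S. c x * \<xi> x \<omega>) v))"

definition mean_square_continuous :: "'w measure \<Rightarrow> ('a::topological_space \<Rightarrow> 'w \<Rightarrow> real) \<Rightarrow> bool" where
  "mean_square_continuous M \<xi> \<longleftrightarrow>
     (\<forall>x. ((\<lambda>y. integral\<^sup>L M (\<lambda>\<omega>. (\<xi> y \<omega> - \<xi> x \<omega>)\<^sup>2)) \<longlongrightarrow> 0) (at x))"

definition square_integrable :: "('a::euclidean_space \<Rightarrow> real) \<Rightarrow> bool" where
  "square_integrable f \<longleftrightarrow> f \<in> borel_measurable lborel \<and> integrable lborel (\<lambda>u. (f u)\<^sup>2)"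

text \<open>Stochastic (Wiener) integral w.r.t. Gaussian white noise Z on (R^n, B^n) with
  control measure Lebesgue: I f = int f dZ.  This is an isonormal Gaussian process on
  L_2(R^n): linear, and I f is centered Gaussian with variance int f^2.\<close>
definition white_noise_integral :: "'v measure \<Rightarrow> (('a::euclidean_space \<Rightarrow> real) \<Rightarrow> 'v \<Rightarrow> real) \<Rightarrow> bool" where
  "white_noise_integral N I \<longleftrightarrow>
     prob_space N \<and>
     (\<forall>f. square_integrable f \<longrightarrow> centered_gaussian_rv N (I f) (LINT u|lborel. (f u)\<^sup>2)) \<and>
     (\<forall>f g a b. square_integrable f \<longrightarrow> square_integrable g \<longrightarrow>
        (AE \<omega> in N. I (\<lambda>u. a * f u + b * g u) \<omega> = a * I f \<omega> + b * I g \<omega>))"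

definition weak_conv_along :: "('i \<Rightarrow> 'a::metric_space measure) \<Rightarrow> 'a measure \<Rightarrow> 'i filter \<Rightarrow> bool" where
  "weak_conv_along \<mu> \<mu>0 F \<longleftrightarrow>
     (\<forall>f :: 'a \<Rightarrow> real. continuous_on UNIV f \<longrightarrow> bounded (range f) \<longrightarrow>
        ((\<lambda>i. integral\<^sup>L (\<mu> i) f) \<longlongrightarrow> integral\<^sup>L \<mu>0 f) F)"

end

theory Submission
  imports Defs
begin

text \<open>
  All finite linear combinations of the \<open>X\<^sub>r(t\<^sub>i)\<close> are integrals \<open>\<integral> F \<xi>\<close> with \<open>F\<close> integrable, hence
  centered Gaussian: they are limits in mean of finite combinations of values of \<open>\<xi>\<close>, because \<open>\<xi>\<close>
  is mean-square continuous.  Since the covariance of \<open>\<xi>\<close> is the Fourier transform of \<open>\<phi>(|\<cdot>|)\<close>, the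
  variance of \<open>\<integral> F \<xi>\<close> is the integral of \<open>|F^|\<^sup>2 \<phi>(|\<cdot>|)\<close>, where \<open>F^\<close> is the Fourier transform of \<open>F\<close>.
  For the \<open>F\<close> at hand it equals \<open>r\<^sup>\<alpha> / (A h(0)) \<integral> K(r (|l| - a)) \<phi>(|l|) dl\<close>, where \<open>K\<close> is the square of
  a linear combination of dilates of \<open>g\<close>.  As \<open>r\<close> grows the mass concentrates on the sphere
  \<open>|l| = a\<close>, where only the singularity of \<open>\<phi>\<close> at \<open>a\<close> survives the normalization: in polar
  coordinates the substitution \<open>\<rho> = a + v / r\<close> and dominated convergence give the variance of the
  same linear combination of the limit process.  The continuity theorem for characteristic functions
  then yields weak convergence.

  The Bessel series in \<open>iso_cov\<close> is identified with a Fourier transform by expanding the cosine and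
  computing the moments of an inner product over spheres from those of a Gaussian vector.
\<close>

section \<open>Gaussian integrals\<close>

text \<open>The scaling is read off in frequency space. The transform of \<open>f\<close> at scale
  \<open>r * t powr (1 / n)\<close> carries \<open>r ^ n * t\<close>, hence the factor t in the
  limit. Division by \<open>r powr (n - \<alpha> j / 2)\<close> leaves
  \<open>r powr (\<alpha> j / 2)\<close>, whose square is exactly what the substitution consumes at
  a singularity of order \<alpha> - 1. The constant A compares two polar integrals: a sphere of
  positive radius is approached from both sides and has \<open>a j ^ (n - 1)\<close> times the area
  of the unit sphere, whereas at the origin there is one side only and
  \<open>\<rho> ^ (n - 1)\<close> merges with the power. The obstacle is weak regularity. The
  \<open>h i\<close> are only bounded and continuous near 0, and \<phi> is measurable only through
  the norm. Hence one singular term near \<open>a j\<close> is isolated and everything else is a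
  difference from \<phi>, controlled by boundedness of the other terms near \<open>a j\<close> and
  by integrability of \<phi> away from it. Measurability and boundedness of \<open>g\<close> are not
  given either; both come from its being a Fourier transform of an integrable function.\<close>

lemma borel_measurable_cis [measurable (raw)]:
  "f \<in> borel_measurable M \<Longrightarrow> (\<lambda>x. cis (f x)) \<in> borel_measurable M"
  unfolding cis_conv_exp by measurable

lemma char_normal_density:
  assumes "0 < \<sigma>"
  shows "char (density lborel (normal_density 0 \<sigma>)) t = complex_of_real (exp (- (\<sigma>\<^sup>2 * t\<^sup>2) / 2))"
proof -
  interpret prob_space std_normal_distribution
    by (rule prob_space_normal_density) simp
  have "distributed std_normal_distribution lborel (\<lambda>x. x) std_normal_density"
    by (auto simp: distributed_def distr_id2 normal_density_nonneg)
  from normal_density_affine[OF this, of "\<sigma>" 0]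
  have "distributed std_normal_distribution lborel (\<lambda>x. \<sigma> * x) (normal_density 0 \<sigma>)"
    using assms by simp
  then have "distr std_normal_distribution lborel (\<lambda>x. \<sigma> * x) = density lborel (normal_density 0 \<sigma>)"
    by (simp add: distributed_def)
  then have "char (density lborel (normal_density 0 \<sigma>)) t = char (distr std_normal_distribution lborel (\<lambda>x. \<sigma> * x)) t"
    by simp
  also have "\<dots> = char std_normal_distribution (\<sigma> * t)"
    unfolding char_def by (subst integral_distr) (auto simp: ac_simps)
  finally show ?thesis
    by (simp add: char_std_normal_distribution power_mult_distrib)
qed

lemma centered_gaussian_rv_char:
  assumes "prob_space M" "centered_gaussian_rv M X v"
  shows "(LINT \<omega>|M. cis (X \<omega>)) = complex_of_real (exp (- v / 2))"
proof -
  interpret prob_space M by fact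
  have [measurable]: "X \<in> borel_measurable M"
    using assms(2) by (simp add: centered_gaussian_rv_def)
  consider "v = 0" "AE \<omega> in M. X \<omega> = 0" | "v > 0" "distributed M lborel X (normal_density 0 (sqrt v))"
    using assms(2) by (auto simp: centered_gaussian_rv_def)
  then show ?thesis
  proof cases
    case 1
    have "(LINT \<omega>|M. cis (X \<omega>)) = (LINT \<omega>|M. 1)"
      by (rule integral_cong_AE) (use 1 in auto)
    then show ?thesis using 1 by (simp add: prob_space)
  next
    case 2
    have "(LINT \<omega>|M. cis (X \<omega>)) = (LINT x|distr M lborel X. cis x)"
      by (subst integral_distr) auto
    also have "\<dots> = char (density lborel (normal_density 0 (sqrt v))) 1"
      using 2 by (simp add: distributed_def char_def cis_conv_exp)
    also have "\<dots> = complex_of_real (exp (- v / 2))"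
      using 2 by (subst char_normal_density) auto
    finally show ?thesis .
  qed
qed

lemma centered_gaussian_rv_second_moment:
  assumes "prob_space M" "centered_gaussian_rv M X v"
  shows "integrable M (\<lambda>\<omega>. (X \<omega>)\<^sup>2)" "(LINT \<omega>|M. (X \<omega>)\<^sup>2) = v"
proof -
  interpret prob_space M by fact
  have [measurable]: "X \<in> borel_measurable M"
    using assms(2) by (simp add: centered_gaussian_rv_def)
  consider "v = 0" "AE \<omega> in M. X \<omega> = 0" | "v > 0" "distributed M lborel X (normal_density 0 (sqrt v))"
    using assms(2) by (auto simp: centered_gaussian_rv_def)
  then have "has_bochner_integral M (\<lambda>\<omega>. (X \<omega>)\<^sup>2) v"
  proof cases
    case 1
    have "has_bochner_integral M (\<lambda>\<omega>. (X \<omega>)\<^sup>2) v \<longleftrightarrow> has_bochner_integral M (\<lambda>\<omega>. 0::real) v"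
      by (rule has_bochner_integral_cong_AE) (use 1 in auto)
    then show ?thesis using 1 by (simp add: has_bochner_integral_zero)
  next
    case 2
    have *: "has_bochner_integral lborel (\<lambda>x. normal_density 0 (sqrt v) x * x\<^sup>2) v"
      using normal_moment_even[of "sqrt v" 0 1] 2 by simp
    have "integrable M (\<lambda>\<omega>. (X \<omega>)\<^sup>2)"
      using distributed_integrable[OF 2(2), of "\<lambda>x. x\<^sup>2"] * 
      by (auto simp: normal_density_nonneg has_bochner_integral_iff)
    moreover have "(LINT \<omega>|M. (X \<omega>)\<^sup>2) = v"
      using distributed_integral[OF 2(2), of "\<lambda>x. x\<^sup>2"] * 
      by (auto simp: normal_density_nonneg has_bochner_integral_iff)
    ultimately show ?thesis by (simp add: has_bochner_integral_iff)
  qed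
  then show "integrable M (\<lambda>\<omega>. (X \<omega>)\<^sup>2)" "(LINT \<omega>|M. (X \<omega>)\<^sup>2) = v"
    by (auto simp: has_bochner_integral_iff)
qed

lemma fourier_gaussian_real:
  fixes u :: real
  shows "integrable lborel (\<lambda>t::real. cis (u * t) * complex_of_real (exp (- t\<^sup>2)))"
    and "(LINT t|lborel. cis (u * t) * complex_of_real (exp (- t\<^sup>2))) = complex_of_real (sqrt pi * exp (- u\<^sup>2 / 4))"
proof -
  \<comment> \<open>\<open>exp (- t\<^sup>2)\<close> is \<open>sqrt pi\<close> times the normal
    density of variance 1/2, so its transform is the characteristic function of that law.\<close>
  have dens: "normal_density 0 (1 / sqrt 2) t = exp (- t\<^sup>2) / sqrt pi" for t :: real
    by (simp add: normal_density_def power_divide)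
  have i: "integrable lborel (\<lambda>t::real. exp (- t\<^sup>2))"
    using integrable_mult_left[OF integrable_normal_moment[of "1 / sqrt 2" 0 0], of "sqrt pi"]
    by (simp add: dens)
  show "integrable lborel (\<lambda>t::real. cis (u * t) * complex_of_real (exp (- t\<^sup>2)))"
    by (rule Bochner_Integration.integrable_bound[OF i]) (auto simp: norm_mult)
  have "complex_of_real (exp (- u\<^sup>2 / 4)) = char (density lborel (normal_density 0 (1 / sqrt 2))) u"
    by (subst char_normal_density) (auto simp: power_divide)
  also have "\<dots> = (LINT t|lborel. cis (u * t) * complex_of_real (exp (- t\<^sup>2)) / sqrt pi)"
    unfolding char_def
    by (subst integral_density) (auto simp: normal_density_nonneg dens scaleR_conv_of_real cis_conv_exp ac_simps)
  also have "\<dots> = (LINT t|lborel. cis (u * t) * complex_of_real (exp (- t\<^sup>2))) / sqrt pi"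
    by simp
  finally show "(LINT t|lborel. cis (u * t) * complex_of_real (exp (- t\<^sup>2))) = complex_of_real (sqrt pi * exp (- u\<^sup>2 / 4))"
    by (simp add: field_simps)
qed

lemma cis_sum: "finite A \<Longrightarrow> cis (\<Sum>i\<in>A. f i) = (\<Prod>i\<in>A. cis (f i))"
  by (induction A rule: finite_induct) (auto simp: cis_mult[symmetric])

lemma norm_sq_eq_sum_Basis: "(norm (x::'a::euclidean_space))\<^sup>2 = (\<Sum>b\<in>Basis. (x \<bullet> b)\<^sup>2)"
  by (subst power2_norm_eq_inner, subst euclidean_inner) (simp add: power2_eq_square)

text \<open>In the coordinates of \<open>Basis\<close> the integrand is a product of one-dimensional
  ones and \<open>lborel\<close> is the image of a product measure, so the integral
  factorises.\<close>

lemma fourier_gaussian: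
  fixes u :: "'a::euclidean_space"
  shows "integrable lborel (\<lambda>x::'a. cis (u \<bullet> x) * complex_of_real (exp (- (norm x)\<^sup>2)))" (is ?I)
    and "(LINT x|lborel. cis (u \<bullet> x) * complex_of_real (exp (- (norm (x::'a))\<^sup>2)))
           = complex_of_real (sqrt pi ^ DIM('a) * exp (- (norm u)\<^sup>2 / 4))" (is ?E)
proof -
  interpret product_sigma_finite "\<lambda>b::'a. lborel :: real measure" ..
  define F where "F = (\<lambda>(b::'a) t. cis ((u \<bullet> b) * t) * complex_of_real (exp (- t\<^sup>2)))"
  have F: "cis (u \<bullet> (\<Sum>b\<in>Basis. f b *\<^sub>R b)) * complex_of_real (exp (- (norm (\<Sum>b\<in>Basis. f b *\<^sub>R b :: 'a))\<^sup>2))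
      = (\<Prod>b\<in>Basis. F b (f b))" for f
    unfolding F_def norm_sq_eq_sum_Basis inner_sum_right prod.distrib
    by (simp add: cis_sum exp_sum sum_negf[symmetric] mult.commute)
  have int: "integrable lborel (F b)" for b
    unfolding F_def by (rule fourier_gaussian_real)
  have meas[measurable]: "(\<lambda>f. \<Sum>b\<in>Basis. f b *\<^sub>R b :: 'a) \<in> (\<Pi>\<^sub>M b\<in>Basis. lborel) \<rightarrow>\<^sub>M borel"
    by measurable
  show ?I
    by (subst lborel_eq, subst integrable_distr_eq) (auto simp: F intro!: product_integrable_prod int)
  have "(LINT x|lborel. cis (u \<bullet> x) * complex_of_real (exp (- (norm (x::'a))\<^sup>2))) = (\<Prod>b\<in>Basis. LINT t|lborel. F b t)"
    by (subst lborel_eq, subst integral_distr) (auto simp: F intro!: product_integral_prod int)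
  also have "\<dots> = (\<Prod>b\<in>(Basis::'a set). complex_of_real (sqrt pi * exp (- (u \<bullet> b)\<^sup>2 / 4)))"
    unfolding F_def by (simp only: fourier_gaussian_real)
  also have "\<dots> = complex_of_real (sqrt pi ^ DIM('a) * exp (- (norm u)\<^sup>2 / 4))"
    unfolding norm_sq_eq_sum_Basis 
    by (simp add: prod.distrib exp_sum sum_negf[symmetric] sum_divide_distrib)
  finally show ?E .
qed

lemma integrable_gaussian: "integrable lborel (\<lambda>x::'a::euclidean_space. exp (- (norm x)\<^sup>2))"
  using integrable_norm[OF fourier_gaussian(1)[of "0::'a"]] by simp

lemma integral_gaussian: "(LINT x|lborel. exp (- (norm (x::'a::euclidean_space))\<^sup>2)) = sqrt pi ^ DIM('a)"
proof -
  have "complex_of_real (LINT x|lborel. exp (- (norm (x::'a))\<^sup>2)) = complex_of_real (sqrt pi ^ DIM('a))"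
    using fourier_gaussian(2)[of "0::'a"] by simp
  then show ?thesis by (simp only: of_real_eq_iff)
qed

section \<open>Affine substitutions and Gaussian moments on the half-line\<close>

lemma lborel_integral_affine:
  fixes f :: "'a::euclidean_space \<Rightarrow> 'b::{banach,second_countable_topology}"
  assumes [measurable]: "f \<in> borel_measurable borel" and "c \<noteq> 0"
  shows "(LINT x|lborel. f x) = \<bar>c\<bar> ^ DIM('a) *\<^sub>R (LINT x|lborel. f (t + c *\<^sub>R x))"
  by (subst lborel_affine[OF \<open>c \<noteq> 0\<close>, of t], subst integral_density) (auto simp: integral_distr)

lemma nn_integral_lborel_affine:
  fixes f :: "'a::euclidean_space \<Rightarrow> ennreal"
  assumes [measurable]: "f \<in> borel_measurable borel" and "c \<noteq> 0"
  shows "(\<integral>\<^sup>+x. f x \<partial>lborel) = ennreal (\<bar>c\<bar> ^ DIM('a)) * (\<integral>\<^sup>+x. f (t + c *\<^sub>R x) \<partial>lborel)"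
  by (subst lborel_affine[OF \<open>c \<noteq> 0\<close>, of t], subst nn_integral_density) (auto simp: nn_integral_distr nn_integral_cmult)

lemma Gamma_nat_plus_half: "Gamma (real k + 1 / 2) = sqrt pi * (fact (2 * k) / (2 ^ (2 * k) * fact k))"
proof (induction k)
  case 0
  show ?case by (simp add: Gamma_one_half_real)
next
  case (Suc k)
  have "Gamma (real (Suc k) + 1 / 2) = Gamma ((real k + 1/2) + 1)"
    by (simp add: algebra_simps)
  also have "\<dots> = (real k + 1/2) * Gamma (real k + 1/2)"
    by (rule Gamma_plus1) (auto elim!: nonpos_Ints_cases)
  also have "\<dots> = sqrt pi * (fact (2 * Suc k) / (2 ^ (2 * Suc k) * fact (Suc k)))"
    unfolding Suc by (simp add: divide_simps) (simp add: algebra_simps)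
  finally show ?case .
qed

text \<open>Both parities are merged into one Gamma value because the exponent used later is
  \<open>2 * m + DIM('a) - 1\<close>, whose parity depends on the dimension.\<close>

lemma gaussian_moment_pos:
  "has_bochner_integral lborel (\<lambda>x::real. indicator {0..} x * (exp (-x\<^sup>2) * x ^ N)) (Gamma ((real N + 1) / 2) / 2)"
proof (cases "even N")
  case True
  then obtain k where N: "N = 2 * k" by (auto elim: evenE)
  show ?thesis
    using gaussian_moment_even_pos[of k] unfolding N 
    by (simp add: Gamma_nat_plus_half add_divide_distrib mult.commute)
next
  case False
  then obtain k where N: "N = 2 * k + 1" by (auto elim: oddE)
  have "(real N + 1) / 2 = 1 + real k" by (simp add: N)
  then have "Gamma ((real N + 1) / 2) = fact k" by (simp only: Gamma_fact)
  then show ?thesis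
    using gaussian_moment_odd_pos[of k] unfolding N by simp
qed

section \<open>The continuity theorem of Levy in Euclidean space\<close>

text \<open>Up to constants the Gaussian is its own Fourier transform, so a Gaussian kernel can be
  traded for characters, whose integrals are the quantities known to converge.\<close>

lemma gaussian_as_fourier:
  fixes z :: "'a::euclidean_space"
  shows "(LINT w|lborel. cis ((2 *\<^sub>R z) \<bullet> w) * complex_of_real (exp (- (norm (w::'a))\<^sup>2)))
    = complex_of_real (sqrt pi ^ DIM('a) * exp (- (norm z)\<^sup>2))"
  by (subst fourier_gaussian) (simp add: power_mult_distrib)

text \<open>By Fubini the integral of the kernel is a Gaussian average of the characteristic
  function of the measure. Characteristic functions are bounded by 1, so their pointwise convergence
  passes through that average.\<close>

lemma integral_gaussian_kernel_tendsto:
  fixes \<mu> :: "nat \<Rightarrow> 'a::euclidean_space measure" and \<mu>0 :: "'a measure"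
  assumes prob: "\<And>i. prob_space (\<mu> i)" and sets[measurable_cong]: "\<And>i. sets (\<mu> i) = sets borel"
    and prob0: "prob_space \<mu>0" and sets0[measurable_cong]: "sets \<mu>0 = sets borel"
    and char: "\<And>u. (\<lambda>i. LINT x|\<mu> i. cis (u \<bullet> x)) \<longlonglongrightarrow> (LINT x|\<mu>0. cis (u \<bullet> x))"
  shows "(\<lambda>i. LINT x|\<mu> i. exp (- (norm (s *\<^sub>R (y - x)))\<^sup>2)) \<longlonglongrightarrow> (LINT x|\<mu>0. exp (- (norm (s *\<^sub>R (y - x)))\<^sup>2))"
proof -
  let ?e = "\<lambda>w::'a. complex_of_real (exp (- (norm w)\<^sup>2))"
  let ?c = "sqrt pi ^ DIM('a)"
  have eq: "complex_of_real (?c * (LINT x|\<nu>. exp (- (norm (s *\<^sub>R (y - x)))\<^sup>2))) =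
      (LINT w|lborel. cis ((2 * s) *\<^sub>R y \<bullet> w) * ?e w * (LINT x|\<nu>. cis (((- 2 * s) *\<^sub>R w) \<bullet> x)))"
    if "prob_space \<nu>" and [measurable_cong]: "sets \<nu> = sets borel" for \<nu> :: "'a measure"
  proof -
    interpret \<nu>: prob_space \<nu> by fact
    interpret pair_sigma_finite \<nu> "lborel :: 'a measure" ..
    let ?f = "\<lambda>x w. cis ((2 *\<^sub>R (s *\<^sub>R (y - x))) \<bullet> w) * ?e w"
    have int: "integrable (\<nu> \<Otimes>\<^sub>M lborel) (case_prod ?f)"
    proof (rule Fubini_integrable)
      show "integrable \<nu> (\<lambda>x. LINT w|lborel. norm (case_prod ?f (x, w)))"
        by (simp add: norm_mult)
      show "AE x in \<nu>. integrable lborel (\<lambda>w. case_prod ?f (x, w))"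
        by (auto intro!: AE_I2 fourier_gaussian(1) simp del: inner_scaleR_left scaleR_scaleR)
    qed measurable
    have "complex_of_real (?c * (LINT x|\<nu>. exp (- (norm (s *\<^sub>R (y - x)))\<^sup>2))) = (LINT x|\<nu>. LINT w|lborel. ?f x w)"
      by (simp only: gaussian_as_fourier integral_complex_of_real integral_mult_right_zero)
    also have "\<dots> = (LINT w|lborel. LINT x|\<nu>. ?f x w)"
      by (rule Fubini_integral[symmetric]) (rule int)
    also have "\<dots> = (LINT w|lborel. cis ((2 * s) *\<^sub>R y \<bullet> w) * ?e w * (LINT x|\<nu>. cis (((- 2 * s) *\<^sub>R w) \<bullet> x)))"
    proof (rule Bochner_Integration.integral_cong[OF refl])
      fix w
      have "(LINT x|\<nu>. ?f x w) = (LINT x|\<nu>. (cis ((2 * s) *\<^sub>R y \<bullet> w) * ?e w) * cis (((- 2 * s) *\<^sub>R w) \<bullet> x))"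
        by (intro Bochner_Integration.integral_cong refl)
           (simp add: cis_mult inner_diff_left inner_commute[of w] algebra_simps)
      then show "(LINT x|\<nu>. ?f x w) = cis ((2 * s) *\<^sub>R y \<bullet> w) * ?e w * (LINT x|\<nu>. cis (((- 2 * s) *\<^sub>R w) \<bullet> x))"
        by (simp only: integral_mult_right_zero)
    qed
    finally show ?thesis .
  qed
  have "(\<lambda>i. LINT w|lborel. cis ((2 * s) *\<^sub>R y \<bullet> w) * ?e w * (LINT x|\<mu> i. cis (((- 2 * s) *\<^sub>R w) \<bullet> x)))
     \<longlonglongrightarrow> (LINT w|lborel. cis ((2 * s) *\<^sub>R y \<bullet> w) * ?e w * (LINT x|\<mu>0. cis (((- 2 * s) *\<^sub>R w) \<bullet> x)))"
  proof (rule integral_dominated_convergence[where w="\<lambda>w. exp (- (norm w)\<^sup>2)"])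
    fix i
    interpret \<mu>i: prob_space "\<mu> i" by (rule prob)
    show "(\<lambda>w. cis ((2 * s) *\<^sub>R y \<bullet> w) * ?e w * (LINT x|\<mu> i. cis (((- 2 * s) *\<^sub>R w) \<bullet> x))) \<in> borel_measurable lborel"
      by measurable
    have "norm (LINT x|\<mu> i. cis (((- 2 * s) *\<^sub>R w) \<bullet> x)) \<le> 1" for w
      using integral_norm_bound[of "\<mu> i" "\<lambda>x. cis (((- 2 * s) *\<^sub>R w) \<bullet> x)"] by (simp add: \<mu>i.prob_space)
    then show "AE w in lborel. norm (cis ((2 * s) *\<^sub>R y \<bullet> w) * ?e w * (LINT x|\<mu> i. cis (((- 2 * s) *\<^sub>R w) \<bullet> x))) \<le> exp (- (norm w)\<^sup>2)"
      by (auto simp: norm_mult intro!: mult_left_le)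
  next
    interpret \<mu>0: prob_space "\<mu>0" by (rule prob0)
    show "(\<lambda>w. cis ((2 * s) *\<^sub>R y \<bullet> w) * ?e w * (LINT x|\<mu>0. cis (((- 2 * s) *\<^sub>R w) \<bullet> x))) \<in> borel_measurable lborel"
      by measurable
      show "AE w in lborel. (\<lambda>i. cis ((2 * s) *\<^sub>R y \<bullet> w) * ?e w * (LINT x|\<mu> i. cis (((- 2 * s) *\<^sub>R w) \<bullet> x)))
      \<longlonglongrightarrow> cis ((2 * s) *\<^sub>R y \<bullet> w) * ?e w * (LINT x|\<mu>0. cis (((- 2 * s) *\<^sub>R w) \<bullet> x))"
      by (intro AE_I2 tendsto_mult tendsto_const char)
  qed (rule integrable_gaussian)
  then have "(\<lambda>i. complex_of_real (?c * (LINT x|\<mu> i. exp (- (norm (s *\<^sub>R (y - x)))\<^sup>2)))) \<longlonglongrightarrow>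
     complex_of_real (?c * (LINT x|\<mu>0. exp (- (norm (s *\<^sub>R (y - x)))\<^sup>2)))"
    by (simp only: eq[OF prob sets] eq[OF prob0 sets0])
  then have "(\<lambda>i. ?c * (LINT x|\<mu> i. exp (- (norm (s *\<^sub>R (y - x)))\<^sup>2))) \<longlonglongrightarrow>
     ?c * (LINT x|\<mu>0. exp (- (norm (s *\<^sub>R (y - x)))\<^sup>2))"
    by (simp only: tendsto_of_real_iff)
  from tendsto_mult_left[OF this, of "1 / ?c"] show ?thesis by simp
qed

text \<open>Fubini turns the integral into one of \<open>f\<close> against kernel averages. These
  converge pointwise and lie in [0, 1], so \<open>norm (f y)\<close> dominates.\<close>

lemma integral_mollified_tendsto:
  fixes \<mu> :: "nat \<Rightarrow> 'a::euclidean_space measure" and \<mu>0 :: "'a measure" and f :: "'a \<Rightarrow> real"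
  assumes prob: "\<And>i. prob_space (\<mu> i)" and sets[measurable_cong]: "\<And>i. sets (\<mu> i) = sets borel"
    and prob0: "prob_space \<mu>0" and sets0[measurable_cong]: "sets \<mu>0 = sets borel"
    and char: "\<And>u. (\<lambda>i. LINT x|\<mu> i. cis (u \<bullet> x)) \<longlonglongrightarrow> (LINT x|\<mu>0. cis (u \<bullet> x))"
    and f: "integrable lborel f"
  shows "(\<lambda>i. LINT x|\<mu> i. LINT y|lborel. f y * exp (- (norm (s *\<^sub>R (y - x)))\<^sup>2))
    \<longlonglongrightarrow> (LINT x|\<mu>0. LINT y|lborel. f y * exp (- (norm (s *\<^sub>R (y - x)))\<^sup>2))"
proof -
  have f_meas[measurable]: "f \<in> borel_measurable borel" using f by auto
  have eq: "(LINT x|\<nu>. LINT y|lborel. f y * exp (- (norm (s *\<^sub>R (y - x)))\<^sup>2)) =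
      (LINT y|lborel. f y * (LINT x|\<nu>. exp (- (norm (s *\<^sub>R (y - x)))\<^sup>2)))"
    if "prob_space \<nu>" and [measurable_cong]: "sets \<nu> = sets borel" for \<nu> :: "'a measure"
  proof -
    interpret \<nu>: prob_space \<nu> by fact
    interpret pair_sigma_finite \<nu> "lborel :: 'a measure" ..
    let ?f = "\<lambda>x y. f y * exp (- (norm (s *\<^sub>R (y - x)))\<^sup>2)"
    have b: "norm (?f x y) \<le> norm (f y)" for x y
      by (auto simp: abs_mult intro!: mult_left_le)
    have int1: "integrable lborel (?f x)" for x
      by (rule Bochner_Integration.integrable_bound[OF f]) (use b in auto)
    have int: "integrable (\<nu> \<Otimes>\<^sub>M lborel) (case_prod ?f)"
    proof (rule Fubini_integrable)
      show "integrable \<nu> (\<lambda>x. LINT y|lborel. norm (case_prod ?f (x, y)))"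
      proof (rule \<nu>.integrable_const_bound[where B="LINT y|lborel. norm (f y)"])
        have "(LINT y|lborel. norm (?f x y)) \<le> (LINT y|lborel. norm (f y))" for x
          by (intro integral_mono integrable_norm int1 f b)
        then show "AE x in \<nu>. norm (LINT y|lborel. norm (case_prod ?f (x, y))) \<le> (LINT y|lborel. norm (f y))"
          by auto
      qed measurable
      show "AE x in \<nu>. integrable lborel (\<lambda>y. case_prod ?f (x, y))"
        using int1 by auto
    qed measurable
    then show ?thesis
      using Fubini_integral[of ?f] by simp
  qed
  have "(\<lambda>i. LINT y|lborel. f y * (LINT x|\<mu> i. exp (- (norm (s *\<^sub>R (y - x)))\<^sup>2))) \<longlonglongrightarrow>
     (LINT y|lborel. f y * (LINT x|\<mu>0. exp (- (norm (s *\<^sub>R (y - x)))\<^sup>2)))"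
  proof (rule integral_dominated_convergence[where w="\<lambda>y. norm (f y)"])
    fix i
    interpret \<mu>i: prob_space "\<mu> i" by (rule prob)
    show "(\<lambda>y. f y * (LINT x|\<mu> i. exp (- (norm (s *\<^sub>R (y - x)))\<^sup>2))) \<in> borel_measurable lborel"
      by measurable
    have "(LINT x|\<mu> i. exp (- (norm (s *\<^sub>R (y - x)))\<^sup>2)) \<le> (LINT x|\<mu> i. 1)" for y
      by (intro integral_mono \<mu>i.integrable_const_bound[where B=1]) auto
    then have "\<bar>LINT x|\<mu> i. exp (- (norm (s *\<^sub>R (y - x)))\<^sup>2)\<bar> \<le> 1" for y
      by (subst abs_of_nonneg) (auto simp: \<mu>i.prob_space)
    then show "AE y in lborel. norm (f y * (LINT x|\<mu> i. exp (- (norm (s *\<^sub>R (y - x)))\<^sup>2))) \<le> norm (f y)"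
      by (intro AE_I2) (simp only: real_norm_def abs_mult mult_left_le abs_ge_zero)
  next
    interpret \<mu>0: prob_space "\<mu>0" by (rule prob0)
    show "(\<lambda>y. f y * (LINT x|\<mu>0. exp (- (norm (s *\<^sub>R (y - x)))\<^sup>2))) \<in> borel_measurable lborel"
      by measurable
  qed (use f in \<open>auto intro!: AE_I2 tendsto_mult tendsto_const integral_gaussian_kernel_tendsto[OF assms(1-5)] simp del: norm_scaleR\<close>)
  then show ?thesis
    by (simp only: eq[OF prob sets] eq[OF prob0 sets0])
qed

text \<open>Substituting y = x + w / s makes the mollified value a Gaussian average of
  \<open>f\<close> around x. Uniform continuity handles small w / s, and \<open>2 * B\<close> times
  a Gaussian tail handles the rest.\<close>

lemma gaussian_mollifier_uniform:
  fixes f :: "'a::euclidean_space \<Rightarrow> real"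
  assumes uc: "uniformly_continuous_on UNIV f" and B: "\<And>x. \<bar>f x\<bar> \<le> B" and "0 < e"
  obtains s where "0 < s"
    "\<And>x. \<bar>(s ^ DIM('a) / sqrt pi ^ DIM('a)) * (LINT y|lborel. f y * exp (- (norm (s *\<^sub>R (y - x)))\<^sup>2)) - f x\<bar> < e"
proof -
  let ?c = "sqrt pi ^ DIM('a)"
  have [measurable]: "f \<in> borel_measurable borel"
    using uc by (intro borel_measurable_continuous_onI uniformly_continuous_imp_continuous)
  from uc[unfolded uniformly_continuous_on_def] \<open>0 < e\<close> obtain d where d: "0 < d"
    "\<And>x x'. dist x' x < d \<Longrightarrow> dist (f x') (f x) < e / 2"
    by (metis UNIV_I half_gt_zero)
  have B0: "0 \<le> B" using B[of 0] by linarith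
  \<comment> \<open>\<open>T k\<close> is the Gaussian mass outside radius \<open>d * k\<close>.
    With s = k the remaining w satisfy norm (w / s) < d, the range of uniform continuity.\<close>
  define T where "T = (\<lambda>k::nat. LINT w|lborel. indicator {w::'a. norm w \<ge> d * k} w * exp (- (norm w)\<^sup>2))"
  have "T \<longlonglongrightarrow> (LINT w|(lborel::'a measure). (0::real))"
    unfolding T_def
  proof (rule integral_dominated_convergence[where w="\<lambda>w::'a. exp (- (norm w)\<^sup>2)"])
    show "AE w in lborel. (\<lambda>k. indicator {w::'a. norm w \<ge> d * real k} w * exp (- (norm w)\<^sup>2)) \<longlonglongrightarrow> 0"
    proof (rule AE_I2, rule tendsto_eventually)
      fix w :: 'a
      show "\<forall>\<^sub>F k in sequentially. indicator {w::'a. norm w \<ge> d * real k} w * exp (- (norm w)\<^sup>2) = 0"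
        using eventually_gt_at_top[of "nat \<lceil>norm w / d\<rceil>"]
      proof eventually_elim
        case (elim k)
        then have "norm w / d < real k" by linarith
        then have "norm w < d * real k" using d(1) by (simp add: field_simps)
        then show ?case by simp
      qed
    qed
  qed (auto intro: integrable_gaussian split: split_indicator)
  then have "(\<lambda>k. 2 * B * T k) \<longlonglongrightarrow> 0" by (simp add: tendsto_mult_right_zero)
  moreover have "0 < e / 2 * ?c" using \<open>0 < e\<close> by simp
  ultimately have "\<forall>\<^sub>F k in sequentially. 2 * B * T k < e / 2 * ?c"
    by (rule order_tendstoD(2))
  with eventually_gt_at_top[of 0] obtain k :: nat where k: "0 < k" "2 * B * T k < e / 2 * ?c"
    by (metis (mono_tags, lifting) eventually_conj eventually_sequentially order_refl)
  define s where "s = real k"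
  have s: "0 < s" using k by (simp add: s_def)
  show thesis
  proof (rule that[OF s])
    fix x
    have sub: "(LINT y|lborel. f y * exp (- (norm (s *\<^sub>R (y - x)))\<^sup>2)) = (1/s) ^ DIM('a) * (LINT w|lborel. f (x + (1/s) *\<^sub>R w) * exp (- (norm w)\<^sup>2))"
      by (subst lborel_integral_affine[of _ "1/s" x]) (use s in auto)
    have int1: "integrable lborel (\<lambda>w. f (x + (1/s) *\<^sub>R w) * exp (- (norm w)\<^sup>2))"
      by (rule Bochner_Integration.integrable_bound[OF integrable_mult_right[OF integrable_gaussian, of B]])
         (use B B0 in \<open>auto simp: abs_mult intro!: mult_right_mono\<close>)
    have int2: "integrable lborel (\<lambda>w::'a. f x * exp (- (norm w)\<^sup>2))"
      by (intro integrable_mult_right integrable_gaussian)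
    have int3: "integrable lborel (\<lambda>w::'a. indicator {w. norm w \<ge> d * k} w * exp (- (norm w)\<^sup>2))"
      by (rule Bochner_Integration.integrable_bound[OF integrable_gaussian]) (auto split: split_indicator)
    have "s ^ DIM('a) / ?c * (LINT y|lborel. f y * exp (- (norm (s *\<^sub>R (y - x)))\<^sup>2)) - f x =
       1 / ?c * ((LINT w|lborel. f (x + (1/s) *\<^sub>R w) * exp (- (norm w)\<^sup>2)) - (LINT w|lborel. f x * exp (- (norm (w::'a))\<^sup>2)))"
      unfolding sub using s by (simp add: integral_gaussian field_simps)
    also have "\<dots> = 1 / ?c * (LINT w|lborel. (f (x + (1/s) *\<^sub>R w) - f x) * exp (- (norm w)\<^sup>2))"
      using int1 int2 by (simp add: Bochner_Integration.integral_diff[symmetric] algebra_simps)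
    finally have eq: "s ^ DIM('a) / ?c * (LINT y|lborel. f y * exp (- (norm (s *\<^sub>R (y - x)))\<^sup>2)) - f x =
       1 / ?c * (LINT w|lborel. (f (x + (1/s) *\<^sub>R w) - f x) * exp (- (norm w)\<^sup>2))" .
    have "\<bar>LINT w|lborel. (f (x + (1/s) *\<^sub>R w) - f x) * exp (- (norm w)\<^sup>2)\<bar> \<le>
       (LINT w|lborel. \<bar>(f (x + (1/s) *\<^sub>R w) - f x) * exp (- (norm w)\<^sup>2)\<bar>)"
      by (rule integral_abs_bound)
    also have "\<dots> \<le> (LINT w|lborel. e / 2 * exp (- (norm (w::'a))\<^sup>2) + 2 * B * (indicator {w. norm w \<ge> d * k} w * exp (- (norm w)\<^sup>2)))"
    proof (rule integral_mono)
      show "integrable lborel (\<lambda>w. \<bar>(f (x + (1/s) *\<^sub>R w) - f x) * exp (- (norm w)\<^sup>2)\<bar>)"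
        using Bochner_Integration.integrable_diff[OF int1 int2] by (auto simp: algebra_simps)
      show "integrable lborel (\<lambda>w::'a. e / 2 * exp (- (norm w)\<^sup>2) + 2 * B * (indicator {w. norm w \<ge> d * k} w * exp (- (norm w)\<^sup>2)))"
        by (intro Bochner_Integration.integrable_add integrable_mult_right integrable_gaussian int3)
      fix w :: 'a
      have "\<bar>f (x + (1/s) *\<^sub>R w) - f x\<bar> \<le> e / 2 + 2 * B * indicator {w. norm w \<ge> d * k} w"
      proof (cases "norm w \<ge> d * k")
        case True
        then show ?thesis using B[of "x + (1/s) *\<^sub>R w"] B[of x] \<open>0 < e\<close> by auto
      next
        case False
        then have "dist (x + (1/s) *\<^sub>R w) x < d"
          using s by (simp add: dist_norm s_def field_simps)
        from d(2)[OF this] False show ?thesis by (auto simp: dist_real_def)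
      qed
      then have "\<bar>f (x + (1/s) *\<^sub>R w) - f x\<bar> * exp (- (norm w)\<^sup>2) \<le> (e / 2 + 2 * B * indicator {w. norm w \<ge> d * k} w) * exp (- (norm w)\<^sup>2)"
        by (rule mult_right_mono) simp
      then show "\<bar>(f (x + (1/s) *\<^sub>R w) - f x) * exp (- (norm w)\<^sup>2)\<bar> \<le> e / 2 * exp (- (norm w)\<^sup>2) + 2 * B * (indicator {w. norm w \<ge> d * k} w * exp (- (norm w)\<^sup>2))"
        unfolding abs_mult abs_exp_cancel by (simp only: distrib_right mult.assoc)
    qed
    also have "\<dots> = e / 2 * ?c + 2 * B * T k"
      unfolding T_def using integrable_gaussian[where 'a='a] int3
      by (subst Bochner_Integration.integral_add) (auto simp: integral_gaussian)
    also have "\<dots> < e * ?c" using k by (simp add: field_simps)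
    finally show "\<bar>s ^ DIM('a) / ?c * (LINT y|lborel. f y * exp (- (norm (s *\<^sub>R (y - x)))\<^sup>2)) - f x\<bar> < e"
      unfolding eq by (simp add: abs_mult field_simps)
  qed
qed

text \<open>Compact support makes \<open>f\<close> uniformly continuous, bounded and Lebesgue
  integrable. It is then uniformly close to a mollification, for which convergence is known; as all
  measures have mass 1, the replacement costs at most e / 3 on each side.\<close>

lemma integral_compact_support_tendsto:
  fixes \<mu> :: "nat \<Rightarrow> 'a::euclidean_space measure" and \<mu>0 :: "'a measure" and f :: "'a \<Rightarrow> real"
  assumes prob: "\<And>i. prob_space (\<mu> i)" and sets[measurable_cong]: "\<And>i. sets (\<mu> i) = sets borel"
    and prob0: "prob_space \<mu>0" and sets0[measurable_cong]: "sets \<mu>0 = sets borel"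
    and char: "\<And>u. (\<lambda>i. LINT x|\<mu> i. cis (u \<bullet> x)) \<longlonglongrightarrow> (LINT x|\<mu>0. cis (u \<bullet> x))"
    and f: "continuous_on UNIV f" and supp: "\<And>x. norm x \<ge> R \<Longrightarrow> f x = 0"
  shows "(\<lambda>i. LINT x|\<mu> i. f x) \<longlonglongrightarrow> (LINT x|\<mu>0. f x)"
proof -
  have [measurable]: "f \<in> borel_measurable borel" using f by (rule borel_measurable_continuous_onI)
  have cpt: "compact (f ` cball 0 R)"
    by (intro compact_continuous_image continuous_on_subset[OF f]) auto
  then obtain B' where "\<And>x. x \<in> cball 0 R \<Longrightarrow> \<bar>f x\<bar> \<le> B'"
    by (metis compact_imp_bounded bounded_iff image_eqI real_norm_def)
  then have B: "\<bar>f x\<bar> \<le> \<bar>B'\<bar>" for x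
    using supp[of x] by (cases "norm x \<le> R") (force simp: mem_cball)+
  define B where "B = \<bar>B'\<bar>"
  have B: "\<bar>f x\<bar> \<le> B" for x using B by (simp add: B_def)
  have uc: "uniformly_continuous_on UNIV f"
  proof (rule uniformly_continuous_on_def[THEN iffD2], intro allI impI)
    fix e :: real assume "e > 0"
    have "uniformly_continuous_on (cball 0 (R + 1)) f"
      by (intro compact_uniformly_continuous continuous_on_subset[OF f]) auto
    from this[unfolded uniformly_continuous_on_def] \<open>e > 0\<close> obtain d where d: "d > 0"
      "\<And>x x'. x \<in> cball 0 (R+1) \<Longrightarrow> x' \<in> cball 0 (R+1) \<Longrightarrow> dist x' x < d \<Longrightarrow> dist (f x') (f x) < e"
      by metis
    show "\<exists>d>0. \<forall>x\<in>UNIV. \<forall>x'\<in>UNIV. dist x' x < d \<longrightarrow> dist (f x') (f x) < e"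
    \<comment> \<open>A step shorter than 1 from a point outside \<open>cball 0 (R + 1)\<close> ends
      outside the ball of radius R, where \<open>f\<close> vanishes as well.\<close>
    proof (intro exI[of _ "min d 1"] conjI ballI impI)
      fix x x' :: 'a assume *: "dist x' x < min d 1"
      have **: "norm x \<le> norm x' + 1" "norm x' \<le> norm x + 1"
        using * norm_triangle_ineq2[of x x'] norm_triangle_ineq2[of x' x] by (auto simp: dist_norm norm_minus_commute)
      show "dist (f x') (f x) < e"
      proof (cases "norm x \<le> R + 1 \<and> norm x' \<le> R + 1")
        case True
        then show ?thesis using d(2)[of x x'] * by (auto simp: mem_cball)
      next
        case False
        then have "norm x \<ge> R" "norm x' \<ge> R" using ** by auto
        then show ?thesis using supp \<open>e > 0\<close> by simp
      qed
    qed (use d in auto)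
  qed
  have "integrable lborel (\<lambda>x. indicator (cball 0 R) x * B :: real)"
    by (intro integrable_mult_left integrable_real_indicator emeasure_lborel_cball_finite) auto
  then have fint: "integrable lborel f"
    by (rule Bochner_Integration.integrable_bound) (use B supp in \<open>auto simp: B_def indicator_def\<close>)
  have fint': "integrable \<nu> f" if "prob_space \<nu>" and [measurable_cong]: "sets \<nu> = sets borel" for \<nu> :: "'a measure"
  proof -
    interpret \<nu>: prob_space \<nu> by fact
    show ?thesis by (rule \<nu>.integrable_const_bound[of _ B]) (use B in auto)
  qed
  show ?thesis
  proof (rule LIMSEQ_I)
    fix e :: real assume "0 < e"
    then have "0 < e / 3" by simp
    from gaussian_mollifier_uniform[OF uc B this] obtain s where s: "0 < s" 
      "\<And>x. \<bar>(s ^ DIM('a) / sqrt pi ^ DIM('a)) * (LINT y|lborel. f y * exp (- (norm (s *\<^sub>R (y - x)))\<^sup>2)) - f x\<bar> < e / 3"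
      by blast
    define c where "c = s ^ DIM('a) / sqrt pi ^ DIM('a)"
    define g where "g = (\<lambda>x. c * (LINT y|lborel. f y * exp (- (norm (s *\<^sub>R (y - x)))\<^sup>2)))"
    have [measurable]: "g \<in> borel_measurable borel" unfolding g_def by measurable
    have gf: "\<bar>g x - f x\<bar> < e / 3" for x using s(2) by (simp add: g_def c_def)
    have close: "\<bar>(LINT x|\<nu>. g x) - (LINT x|\<nu>. f x)\<bar> \<le> e / 3"
      if "prob_space \<nu>" and [measurable_cong]: "sets \<nu> = sets borel" for \<nu> :: "'a measure"
    proof -
      interpret \<nu>: prob_space \<nu> by fact
      have "\<bar>g x\<bar> \<le> B + e / 3" for x using gf[of x] B[of x] by linarith
      then have "integrable \<nu> g"
        by (intro \<nu>.integrable_const_bound[of _ "B + e/3"]) auto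
      then have "\<bar>(LINT x|\<nu>. g x) - (LINT x|\<nu>. f x)\<bar> = \<bar>LINT x|\<nu>. g x - f x\<bar>"
        using fint'[OF that] by simp
      also have "\<dots> \<le> (LINT x|\<nu>. \<bar>g x - f x\<bar>)" by (rule integral_abs_bound)
      also have "\<dots> \<le> (LINT x|\<nu>. e / 3)"
        by (intro integral_mono) (use gf less_imp_le \<open>integrable \<nu> g\<close> fint'[OF that] in auto)
      finally show ?thesis by (simp add: \<nu>.prob_space)
    qed
    have "(\<lambda>i. LINT x|\<mu> i. g x) \<longlonglongrightarrow> (LINT x|\<mu>0. g x)"
      unfolding g_def integral_mult_right_zero
      by (intro tendsto_mult tendsto_const integral_mollified_tendsto assms fint)
    from LIMSEQ_D[OF this \<open>0 < e / 3\<close>] obtain no where no: "\<And>i. i \<ge> no \<Longrightarrow> \<bar>(LINT x|\<mu> i. g x) - (LINT x|\<mu>0. g x)\<bar> < e / 3"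
      by auto
    show "\<exists>no. \<forall>i\<ge>no. norm ((LINT x|\<mu> i. f x) - (LINT x|\<mu>0. f x)) < e"
    proof (intro exI allI impI)
      fix i assume "i \<ge> no"
      show "norm ((LINT x|\<mu> i. f x) - (LINT x|\<mu>0. f x)) < e"
        using no[OF \<open>i \<ge> no\<close>] close[OF prob sets, of i] close[OF prob0 sets0] by (simp add: abs_real_def split: if_splits)
    qed
  qed
qed

text \<open>Tightness is inherited from the limit: a cutoff that carries almost all mass of \<mu>0
  has compact support, so its integrals converge and it carries almost all mass of \<mu> i for large
  i. Multiplying \<open>f\<close> by it then costs little.\<close>

theorem levy_continuity_euclidean:
  fixes \<mu> :: "nat \<Rightarrow> 'a::euclidean_space measure" and \<mu>0 :: "'a measure" and f :: "'a \<Rightarrow> real"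
  assumes prob: "\<And>i. prob_space (\<mu> i)" and sets[measurable_cong]: "\<And>i. sets (\<mu> i) = sets borel"
    and prob0: "prob_space \<mu>0" and sets0[measurable_cong]: "sets \<mu>0 = sets borel"
    and char: "\<And>u. (\<lambda>i. LINT x|\<mu> i. cis (u \<bullet> x)) \<longlonglongrightarrow> (LINT x|\<mu>0. cis (u \<bullet> x))"
    and f: "continuous_on UNIV f" and "bounded (range f)"
  shows "(\<lambda>i. LINT x|\<mu> i. f x) \<longlonglongrightarrow> (LINT x|\<mu>0. f x)"
proof -
  have [measurable]: "f \<in> borel_measurable borel" using f by (rule borel_measurable_continuous_onI)
  interpret \<mu>0: prob_space \<mu>0 by fact
  obtain B where "B > 0" and B: "\<And>x. \<bar>f x\<bar> \<le> B"
    using \<open>bounded (range f)\<close> by (auto simp: bounded_pos)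
  define \<theta> where "\<theta> = (\<lambda>(k::nat) (x::'a). max 0 (min 1 (real k + 1 - norm x)))"
  have \<theta>_cont: "continuous_on UNIV (\<theta> k)" for k
    unfolding \<theta>_def by (intro continuous_intros)
  have [measurable]: "\<theta> k \<in> borel_measurable borel" for k by (rule borel_measurable_continuous_onI[OF \<theta>_cont])
  have \<theta>01: "0 \<le> \<theta> k x" "\<theta> k x \<le> 1" for k x by (auto simp: \<theta>_def)
  have \<theta>0: "\<theta> k x = 0" if "norm x \<ge> real k + 1" for k x using that by (auto simp: \<theta>_def)
  have "(\<lambda>k. LINT x|\<mu>0. \<theta> k x) \<longlonglongrightarrow> (LINT x|\<mu>0. 1)"
  proof (rule integral_dominated_convergence[where w="\<lambda>_. 1"])
    show "AE x in \<mu>0. (\<lambda>k. \<theta> k x) \<longlonglongrightarrow> 1"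
    proof (rule AE_I2, rule tendsto_eventually)
      fix x :: 'a
      show "\<forall>\<^sub>F k in sequentially. \<theta> k x = 1"
        using eventually_gt_at_top[of "nat \<lceil>norm x\<rceil>"]
      proof eventually_elim
        case (elim k)
        then have "norm x \<le> real k" by linarith
        then show ?case by (auto simp: \<theta>_def)
      qed
    qed
  qed (use \<theta>01 in auto)
  then have lim1: "(\<lambda>k. LINT x|\<mu>0. \<theta> k x) \<longlonglongrightarrow> 1" by (simp add: \<mu>0.prob_space)
  show ?thesis
  proof (rule LIMSEQ_I)
    fix e :: real assume "0 < e"
    \<comment> \<open>Each of the two tails costs at most \<open>B * \<epsilon>\<close>, a quarter
      of e; the cut-off function takes the remaining half.\<close>
    define \<epsilon> where "\<epsilon> = e / (4 * B)"
    have \<epsilon>: "0 < \<epsilon>" "B * \<epsilon> = e / 4" using \<open>0 < e\<close> \<open>B > 0\<close> by (auto simp: \<epsilon>_def)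
    from LIMSEQ_D[OF lim1 \<epsilon>(1)] obtain k where "norm ((LINT x|\<mu>0. \<theta> k x) - 1) < \<epsilon>" by blast
    then have k: "(LINT x|\<mu>0. \<theta> k x) > 1 - \<epsilon>" by (auto simp: abs_real_def split: if_splits)
    have "(\<lambda>i. LINT x|\<mu> i. \<theta> k x) \<longlonglongrightarrow> (LINT x|\<mu>0. \<theta> k x)"
      by (rule integral_compact_support_tendsto[OF prob sets prob0 sets0 char \<theta>_cont \<theta>0])
    from order_tendstoD(1)[OF this k]
    have ev1: "\<forall>\<^sub>F i in sequentially. (LINT x|\<mu> i. \<theta> k x) > 1 - \<epsilon>" .
    have "(\<lambda>i. LINT x|\<mu> i. f x * \<theta> k x) \<longlonglongrightarrow> (LINT x|\<mu>0. f x * \<theta> k x)"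
      by (rule integral_compact_support_tendsto[OF prob sets prob0 sets0 char, where R="real k + 1"])
         (auto intro!: continuous_intros f \<theta>_cont simp: \<theta>0)
    from tendstoD[OF this, of "e/2"] \<open>0 < e\<close>
    have ev2: "\<forall>\<^sub>F i in sequentially. \<bar>(LINT x|\<mu> i. f x * \<theta> k x) - (LINT x|\<mu>0. f x * \<theta> k x)\<bar> < e / 2"
      by (simp add: dist_real_def)
    have tail: "\<bar>(LINT x|\<nu>. f x) - (LINT x|\<nu>. f x * \<theta> k x)\<bar> \<le> B * (1 - (LINT x|\<nu>. \<theta> k x))"
      if "prob_space \<nu>" and [measurable_cong]: "sets \<nu> = sets borel" for \<nu> :: "'a measure"
    proof -
      interpret \<nu>: prob_space \<nu> by fact
      have i1: "integrable \<nu> f" by (rule \<nu>.integrable_const_bound[of _ B]) (use B in auto)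
      have i2: "integrable \<nu> (\<lambda>x. f x * \<theta> k x)"
        by (rule \<nu>.integrable_const_bound[of _ B]) (use B \<theta>01 in \<open>auto simp: abs_mult intro!: mult_le_one order_trans[OF mult_left_le B]\<close>)
      have i3: "integrable \<nu> (\<theta> k)" by (rule \<nu>.integrable_const_bound[of _ 1]) (use \<theta>01 in auto)
      have "\<bar>(LINT x|\<nu>. f x) - (LINT x|\<nu>. f x * \<theta> k x)\<bar> = \<bar>LINT x|\<nu>. f x - f x * \<theta> k x\<bar>"
        using i1 i2 by simp
      also have "\<dots> \<le> (LINT x|\<nu>. \<bar>f x - f x * \<theta> k x\<bar>)" by (rule integral_abs_bound)
      also have "\<dots> \<le> (LINT x|\<nu>. B * (1 - \<theta> k x))"
      proof (intro integral_mono)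
        fix x
        have "f x - f x * \<theta> k x = f x * (1 - \<theta> k x)" by (simp add: right_diff_distrib)
        then have "\<bar>f x - f x * \<theta> k x\<bar> = \<bar>f x\<bar> * (1 - \<theta> k x)"
          using \<theta>01[of k x] by (simp only: abs_mult)
        also have "\<dots> \<le> B * (1 - \<theta> k x)" using B \<theta>01 by (intro mult_right_mono) auto
        finally show "\<bar>f x - f x * \<theta> k x\<bar> \<le> B * (1 - \<theta> k x)" .
      qed (use i1 i2 i3 in auto)
      also have "\<dots> = B * (1 - (LINT x|\<nu>. \<theta> k x))" using i3 by (simp add: \<nu>.prob_space)
      finally show ?thesis .
    qed
    have "\<forall>\<^sub>F i in sequentially. norm ((LINT x|\<mu> i. f x) - (LINT x|\<mu>0. f x)) < e"
      using ev1 ev2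
    proof eventually_elim
      case (elim i)
      have "B * (1 - (LINT x|\<mu> i. \<theta> k x)) < B * \<epsilon>" "B * (1 - (LINT x|\<mu>0. \<theta> k x)) < B * \<epsilon>"
        using elim k \<open>B > 0\<close> by (auto intro!: mult_strict_left_mono)
      then show ?case
        using tail[OF prob sets, of i] tail[OF prob0 sets0] elim(2) unfolding \<epsilon>(2) real_norm_def by linarith
    qed
    then show "\<exists>no. \<forall>i\<ge>no. norm ((LINT x|\<mu> i. f x) - (LINT x|\<mu>0. f x)) < e"
      by (simp add: eventually_sequentially)
  qed
qed

section \<open>Radial integrals\<close>

text \<open>Homogeneity determines the mass of every ball, \<open>W * r ^ (d + DIM('a))\<close>,
  from that of the unit ball. Differentiating in r gives the radial density, and half-lines
  determine the image measure.\<close>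

lemma distr_norm_homogeneous:
  fixes w :: "'a::euclidean_space \<Rightarrow> real" and d :: nat and W :: real
  assumes [measurable]: "w \<in> borel_measurable borel"
    and nonneg: "\<And>x. 0 \<le> w x"
    and hom: "\<And>c x. 0 < c \<Longrightarrow> w (c *\<^sub>R x) = c ^ d * w x"
    and bound: "\<And>x. norm x \<le> 1 \<Longrightarrow> w x \<le> B"
  defines "W \<equiv> LINT x|lborel. indicator (cball 0 1) x * w x"
  shows "distr (density lborel w) borel norm =
    density lborel (\<lambda>\<rho>. ennreal (indicator {0..} \<rho> * ((d + DIM('a)) * W * \<rho> ^ (d + DIM('a) - 1))))"
proof -
  let ?n = "DIM('a)"
  let ?L = "distr (density lborel w) borel norm"
  let ?R = "density lborel (\<lambda>\<rho>. ennreal (indicator {0..} \<rho> * ((d + ?n) * W * \<rho> ^ (d + ?n - 1))))"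
  have [measurable]: "cball (0::'a) r \<in> sets borel" for r by simp
  have W_nonneg: "0 \<le> W"
    unfolding W_def by (rule integral_nonneg_AE) (auto simp: nonneg)
  have "integrable lborel (\<lambda>x. indicator (cball 0 1) x * B)"
    by (intro integrable_mult_left) (auto simp: emeasure_cball)
  then have "integrable lborel (\<lambda>x. indicator (cball 0 1) x * w x)"
    by (rule Bochner_Integration.integrable_bound)
       (auto simp: nonneg split: split_indicator intro!: order_trans[OF bound abs_ge_self])
  then have W: "(\<integral>\<^sup>+x. ennreal (indicator (cball 0 1) x * w x) \<partial>lborel) = ennreal W"
    unfolding W_def by (rule nn_integral_eq_integral) (auto simp: nonneg)
  have L: "emeasure ?L {..r} = (\<integral>\<^sup>+x. ennreal (indicator (cball 0 r) x * w x) \<partial>lborel)" for r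
  proof -
    have "norm -` {..r} = cball (0::'a) r" by (auto simp: mem_cball)
    then show ?thesis
      by (subst emeasure_distr) (auto simp: emeasure_density nonneg intro!: nn_integral_cong split: split_indicator)
  qed
  have eq: "emeasure ?L {..r} = emeasure ?R {..r}" and fin: "emeasure ?L {..r} \<noteq> \<infinity>" for r
  proof -
    have R: "emeasure ?R {..r} = (\<integral>\<^sup>+\<rho>. ennreal ((d + ?n) * W * \<rho> ^ (d + ?n - 1)) * indicator {0..r} \<rho> \<partial>lborel)"
      by (subst emeasure_density) (auto intro!: nn_integral_cong split: split_indicator)
    consider "r < 0" | "r = 0" | "r > 0" by linarith
    then have "emeasure ?L {..r} = emeasure ?R {..r} \<and> emeasure ?L {..r} \<noteq> \<infinity>"
    proof cases
      case 1
      then show ?thesis unfolding L R by simp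
    next
      case 2
      have "(\<integral>\<^sup>+x. ennreal (indicator (cball 0 r) x * w x) \<partial>lborel) = (\<integral>\<^sup>+x. 0 \<partial>(lborel::'a measure))"
        by (rule nn_integral_cong_AE) (use AE_lborel_singleton[of "0::'a"] 2 in \<open>auto elim!: eventually_mono\<close>)
      moreover have "emeasure ?R {..r} = (\<integral>\<^sup>+x. 0 \<partial>(lborel::real measure))"
        unfolding R
        by (rule nn_integral_cong_AE) (use AE_lborel_singleton[of "0::real"] 2 in \<open>auto elim!: eventually_mono\<close>)
      ultimately show ?thesis by (simp add: L)
    next
      case 3
      have "emeasure ?L {..r} = ennreal (r ^ ?n) * (\<integral>\<^sup>+x. ennreal (indicator (cball 0 r) (r *\<^sub>R x) * w (r *\<^sub>R x)) \<partial>(lborel::'a measure))"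
        unfolding L by (subst nn_integral_lborel_affine[of _ r 0]) (use 3 in auto)
      also have "(\<integral>\<^sup>+x. ennreal (indicator (cball 0 r) (r *\<^sub>R x) * w (r *\<^sub>R x)) \<partial>(lborel::'a measure)) = 
        (\<integral>\<^sup>+x. ennreal (r ^ d) * ennreal (indicator (cball 0 1) x * w x) \<partial>(lborel::'a measure))"
        by (intro nn_integral_cong)
          (use 3 in \<open>auto simp: hom ennreal_mult[symmetric] nonneg split: split_indicator\<close>)
      also have "\<dots> = ennreal (r ^ d) * ennreal W"
        by (subst nn_integral_cmult) (auto simp: W)
      finally have "emeasure ?L {..r} = ennreal (W * r ^ (d + ?n))"
        using 3 W_nonneg by (simp add: ennreal_mult[symmetric] power_add ac_simps)
      moreover have "emeasure ?R {..r} = ennreal (W * r ^ (d + ?n) - W * 0 ^ (d + ?n))"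
        unfolding R
      proof (rule nn_integral_FTC_Icc)
        show "((\<lambda>\<rho>. W * \<rho> ^ (d + ?n)) has_real_derivative (d + ?n) * W * x ^ (d + ?n - 1)) (at x)" for x
          by (auto intro!: derivative_eq_intros)
      qed (use 3 W_nonneg in auto)
      moreover have "(0::real) ^ (d + ?n) = 0" by (rule zero_power) (simp add: add_nonneg_pos)
      ultimately show ?thesis by simp
    qed
    then show "emeasure ?L {..r} = emeasure ?R {..r}" "emeasure ?L {..r} \<noteq> \<infinity>" by auto
  qed
  show "?L = ?R"
  proof (rule measure_eqI_generator_eq[where E="range atMost" and \<Omega>=UNIV and A="\<lambda>i. {..real i}"])
    show "Int_stable (range atMost :: real set set)"
      by (auto simp: Int_stable_def)
    show "(\<Union>i. {..real i}) = UNIV"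
      using real_arch_simple by auto
    have "sets (borel :: real measure) = sigma_sets UNIV (range atMost)"
      by (simp add: borel_eq_atMost)
    then show "sets ?L = sigma_sets UNIV (range atMost)" "sets ?R = sigma_sets UNIV (range atMost)"
      by auto
  qed (use eq fin in auto)
qed

text \<open>Only the existence of c is claimed here. Its value is found later by inserting a \<phi>
  for which both sides can be computed.\<close>

lemma homogeneous_radial_integral:
  fixes w :: "'a::euclidean_space \<Rightarrow> real" and d :: nat
  assumes w[measurable]: "w \<in> borel_measurable borel"
    and nonneg: "\<And>x. 0 \<le> w x"
    and hom: "\<And>c x. 0 < c \<Longrightarrow> w (c *\<^sub>R x) = c ^ d * w x"
    and bound: "\<And>x. norm x \<le> 1 \<Longrightarrow> w x \<le> B"
  obtains c where "0 \<le> c"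
    "\<And>\<phi>::real \<Rightarrow> real. \<phi> \<in> borel_measurable borel \<Longrightarrow> integrable lborel (\<lambda>x. w x * \<phi> (norm x)) \<longleftrightarrow>
        integrable lborel (\<lambda>\<rho>. indicator {0..} \<rho> * (c * \<rho> ^ (d + DIM('a) - 1)) * \<phi> \<rho>)"
    "\<And>\<phi>::real \<Rightarrow> real. \<phi> \<in> borel_measurable borel \<Longrightarrow> (LINT x|lborel. w x * \<phi> (norm x)) =
        (LINT \<rho>|lborel. indicator {0..} \<rho> * (c * \<rho> ^ (d + DIM('a) - 1)) * \<phi> \<rho>)"
proof -
  define W where "W = (LINT x|lborel. indicator (cball 0 1) x * w x)"
  define c :: real where "c = real (d + DIM('a)) * W"
  have W_nonneg: "0 \<le> W"
    unfolding W_def by (rule integral_nonneg_AE) (auto simp: nonneg)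
  have eq: "distr (density lborel w) borel norm =
    density lborel (\<lambda>\<rho>. ennreal (indicator {0..} \<rho> * (c * \<rho> ^ (d + DIM('a) - 1))))"
    unfolding c_def W_def by (rule distr_norm_homogeneous[OF assms])
  show thesis
  proof (rule that)
    show "0 \<le> c" using W_nonneg by (simp add: c_def)
    fix \<phi> :: "real \<Rightarrow> real" assume [measurable]: "\<phi> \<in> borel_measurable borel"
    have "integrable lborel (\<lambda>x. w x * \<phi> (norm x)) \<longleftrightarrow> integrable (distr (density lborel w) borel norm) \<phi>"
      by (simp add: integrable_distr_eq integrable_density nonneg)
    also have "\<dots> \<longleftrightarrow> integrable lborel (\<lambda>\<rho>. indicator {0..} \<rho> * (c * \<rho> ^ (d + DIM('a) - 1)) * \<phi> \<rho>)"
      unfolding eq by (subst integrable_density) (use \<open>0 \<le> c\<close> in \<open>auto simp: indicator_def\<close>)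
    finally show "integrable lborel (\<lambda>x. w x * \<phi> (norm x)) \<longleftrightarrow>
        integrable lborel (\<lambda>\<rho>. indicator {0..} \<rho> * (c * \<rho> ^ (d + DIM('a) - 1)) * \<phi> \<rho>)" .
    have "(LINT x|lborel. w x * \<phi> (norm x)) = integral\<^sup>L (distr (density lborel w) borel norm) \<phi>"
      by (simp add: integral_distr integral_density nonneg)
    also have "\<dots> = (LINT \<rho>|lborel. indicator {0..} \<rho> * (c * \<rho> ^ (d + DIM('a) - 1)) * \<phi> \<rho>)"
      unfolding eq by (subst integral_density) (use \<open>0 \<le> c\<close> in \<open>auto simp: indicator_def\<close>)
    finally show "(LINT x|lborel. w x * \<phi> (norm x)) =
        (LINT \<rho>|lborel. indicator {0..} \<rho> * (c * \<rho> ^ (d + DIM('a) - 1)) * \<phi> \<rho>)" .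
  qed
qed

text \<open>Under the normalised Gaussian measure \<open>l \<bullet> x\<close> is normal with mean 0
  and variance \<open>(norm x)\<^sup>2 / 2\<close>, so its even moments are one-dimensional. The
  case x = 0 is separate because this law degenerates.\<close>

lemma gaussian_inner_moment:
  fixes x :: "'a::euclidean_space"
  shows "has_bochner_integral lborel (\<lambda>l::'a. (l \<bullet> x) ^ (2 * m) * exp (- (norm l)\<^sup>2))
     (sqrt pi ^ DIM('a) * norm x ^ (2 * m) * fact (2 * m) / (4 ^ m * fact m))"
proof (cases "x = 0")
  case True
  show ?thesis
    using integrable_gaussian[where 'a='a] integral_gaussian[where 'a='a] True
    by (cases "m = 0") (auto simp: has_bochner_integral_iff zero_power)
next
  case False
  define \<gamma> where "\<gamma> = density lborel (\<lambda>l::'a. ennreal (exp (- (norm l)\<^sup>2) / sqrt pi ^ DIM('a)))"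
  have "emeasure \<gamma> (space \<gamma>) = (\<integral>\<^sup>+l. ennreal (exp (- (norm l)\<^sup>2) / sqrt pi ^ DIM('a)) \<partial>(lborel::'a measure))"
    unfolding \<gamma>_def by (subst emeasure_density) auto
  also have "\<dots> = ennreal (LINT l|lborel. exp (- (norm (l::'a))\<^sup>2) / sqrt pi ^ DIM('a))"
    by (rule nn_integral_eq_integral) (auto intro!: integrable_divide integrable_gaussian)
  also have "\<dots> = 1"
    by (simp add: integral_gaussian)
  finally interpret \<gamma>: prob_space \<gamma> by (rule prob_spaceI)
  let ?\<sigma> = "norm x / sqrt 2"
  let ?N = "density lborel (normal_density 0 ?\<sigma>)"
  have \<sigma>: "0 < ?\<sigma>" using False by simp
  interpret N: prob_space ?N using \<sigma> by (rule prob_space_normal_density)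
  have [measurable]: "(\<lambda>l. l \<bullet> x) \<in> \<gamma> \<rightarrow>\<^sub>M borel" by (simp add: \<gamma>_def)
  \<comment> \<open>The law is identified by its characteristic function, which
    \<open>fourier_gaussian\<close> supplies at the frequency \<open>u *\<^sub>R x\<close>.\<close>
  have "distr \<gamma> borel (\<lambda>l. l \<bullet> x) = ?N"
  proof (rule Levy_uniqueness)
    show "real_distribution (distr \<gamma> borel (\<lambda>l. l \<bullet> x))"
      by (rule \<gamma>.real_distribution_distr) simp
    show "real_distribution ?N" by unfold_locales auto
    show "char (distr \<gamma> borel (\<lambda>l. l \<bullet> x)) = char ?N"
    proof
      fix u
      have "char (distr \<gamma> borel (\<lambda>l. l \<bullet> x)) u = (LINT l|\<gamma>. cis (u * (l \<bullet> x)))"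
        unfolding char_def by (subst integral_distr) (auto simp: cis_conv_exp)
      also have "\<dots> = (LINT l|lborel. cis ((u *\<^sub>R x) \<bullet> l) * complex_of_real (exp (- (norm l)\<^sup>2)) / sqrt pi ^ DIM('a))"
        unfolding \<gamma>_def by (subst integral_density) (auto simp: scaleR_conv_of_real inner_commute ac_simps)
      also have "\<dots> = complex_of_real (sqrt pi ^ DIM('a) * exp (- (norm (u *\<^sub>R x))\<^sup>2 / 4)) / sqrt pi ^ DIM('a)"
        by (simp only: fourier_gaussian integral_divide_zero)
      also have "\<dots> = char ?N u"
        using \<sigma> by (subst char_normal_density) (auto simp: power_mult_distrib power_divide field_simps)
      finally show "char (distr \<gamma> borel (\<lambda>l. l \<bullet> x)) u = char ?N u" .
    qed
  qed
  note eq = this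
  have "(2 / ?\<sigma>\<^sup>2) ^ m = 4 ^ m / norm x ^ (2 * m)"
    by (simp add: power_divide power_mult)
  then have N: "has_bochner_integral lborel (\<lambda>t. normal_density 0 ?\<sigma> t * t ^ (2 * m)) (norm x ^ (2 * m) * fact (2 * m) / (4 ^ m * fact m))"
    using normal_moment_even[OF \<sigma>, of 0 m] by (simp add: mult.commute)
  have i: "integrable ?N (\<lambda>t. t ^ (2 * m))" and I: "(LINT t|?N. t ^ (2 * m)) = norm x ^ (2 * m) * fact (2 * m) / (4 ^ m * fact m)"
    using N by (auto simp: integrable_density integral_density normal_density_nonneg has_bochner_integral_iff)
  have "integrable lborel (\<lambda>l. sqrt pi ^ DIM('a) * (exp (- (norm l)\<^sup>2) / sqrt pi ^ DIM('a) * (l \<bullet> x) ^ (2 * m)))"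
    using i unfolding eq[symmetric] by (intro integrable_mult_right) (simp add: integrable_distr_eq, simp add: \<gamma>_def integrable_density)
  moreover have "(LINT l|lborel. exp (- (norm l)\<^sup>2) / sqrt pi ^ DIM('a) * (l \<bullet> x) ^ (2 * m)) = norm x ^ (2 * m) * fact (2 * m) / (4 ^ m * fact m)"
    using I unfolding eq[symmetric] by (simp add: integral_distr, simp add: \<gamma>_def integral_density)
  then have "(LINT l|lborel. sqrt pi ^ DIM('a) * (exp (- (norm l)\<^sup>2) / sqrt pi ^ DIM('a) * (l \<bullet> x) ^ (2 * m))) = sqrt pi ^ DIM('a) * (norm x ^ (2 * m) * fact (2 * m) / (4 ^ m * fact m))"
    by (simp only: integral_mult_right_zero)
  ultimately show ?thesis
    by (simp add: has_bochner_integral_iff ac_simps)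
qed

section \<open>The Fourier transform of a radial function\<close>

text \<open>The weight is homogeneous of degree \<open>2 * m\<close>, so its radial form is known up
  to a constant. Testing with \<open>exp (- \<rho>\<^sup>2)\<close> identifies that constant as D: a
  Gaussian moment in space is compared with one on the half-line.\<close>

lemma inner_power_radial_integral:
  fixes x :: "'a::euclidean_space" and \<phi> :: "real \<Rightarrow> real" and D :: real and m :: nat
  defines "D \<equiv> 2 * sqrt pi ^ DIM('a) * norm x ^ (2 * m) * fact (2 * m) / (4 ^ m * fact m * Gamma (real m + DIM('a) / 2))"
  assumes \<phi>: "\<phi> \<in> borel_measurable borel"
  shows "integrable lborel (\<lambda>l. (l \<bullet> x) ^ (2 * m) * \<phi> (norm l)) \<longleftrightarrow>
      integrable lborel (\<lambda>\<rho>. indicator {0..} \<rho> * (D * \<rho> ^ (2 * m + DIM('a) - 1)) * \<phi> \<rho>)"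
    and "(LINT l|lborel. (l \<bullet> x) ^ (2 * m) * \<phi> (norm l)) =
      (LINT \<rho>|lborel. indicator {0..} \<rho> * (D * \<rho> ^ (2 * m + DIM('a) - 1)) * \<phi> \<rho>)"
proof -
  have *: "(l \<bullet> x) ^ (2 * m) \<le> norm x ^ (2 * m)" if "norm l \<le> 1" for l
  proof -
    have "(l \<bullet> x) ^ (2 * m) = \<bar>l \<bullet> x\<bar> ^ (2 * m)" by (simp add: power_even_abs)
    also have "\<dots> \<le> norm x ^ (2 * m)"
      using that by (intro power_mono order_trans[OF Cauchy_Schwarz_ineq2]) (auto intro: mult_left_le_one_le)
    finally show ?thesis .
  qed
  obtain c where c: "0 \<le> c"
    "\<And>\<phi>::real \<Rightarrow> real. \<phi> \<in> borel_measurable borel \<Longrightarrow> integrable lborel (\<lambda>l. (l \<bullet> x) ^ (2 * m) * \<phi> (norm l)) \<longleftrightarrow>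
        integrable lborel (\<lambda>\<rho>. indicator {0..} \<rho> * (c * \<rho> ^ (2 * m + DIM('a) - 1)) * \<phi> \<rho>)"
    "\<And>\<phi>::real \<Rightarrow> real. \<phi> \<in> borel_measurable borel \<Longrightarrow> (LINT l|lborel. (l \<bullet> x) ^ (2 * m) * \<phi> (norm l)) =
        (LINT \<rho>|lborel. indicator {0..} \<rho> * (c * \<rho> ^ (2 * m + DIM('a) - 1)) * \<phi> \<rho>)"
    by (rule homogeneous_radial_integral[of "\<lambda>l. (l \<bullet> x) ^ (2 * m)" "2 * m" "norm x ^ (2 * m)"])
       (auto simp: power_mult_distrib *)
  define G where "G = Gamma (real m + DIM('a) / 2)"
  have G: "G > 0" unfolding G_def by (rule Gamma_real_pos) (simp add: add_nonneg_pos)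
  have G': "Gamma ((real (2 * m + DIM('a) - 1) + 1) / 2) = G"
    unfolding G_def by (rule arg_cong[where f=Gamma]) (simp add: of_nat_diff add_divide_distrib Suc_leI)
  have "sqrt pi ^ DIM('a) * norm x ^ (2 * m) * fact (2 * m) / (4 ^ m * fact m) =
     (LINT l|lborel. (l \<bullet> x) ^ (2 * m) * exp (- (norm l)\<^sup>2))"
    using gaussian_inner_moment[of x m] by (simp add: has_bochner_integral_iff)
  also have "\<dots> = (LINT \<rho>|lborel. indicator {0..} \<rho> * (c * \<rho> ^ (2 * m + DIM('a) - 1)) * exp (- \<rho>\<^sup>2))"
    by (rule c(3)) simp
  also have "\<dots> = c * (LINT \<rho>|lborel. indicator {0..} \<rho> * (exp (- \<rho>\<^sup>2) * \<rho> ^ (2 * m + DIM('a) - 1)))"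
    by (subst integral_mult_right_zero[symmetric]) (simp add: ac_simps)
  also have "\<dots> = c * G / 2"
    using gaussian_moment_pos[of "2 * m + DIM('a) - 1"] unfolding G' by (simp add: has_bochner_integral_iff)
  finally have "c = D"
    using G unfolding D_def G_def[symmetric] by (simp add: field_simps)
  then show "integrable lborel (\<lambda>l. (l \<bullet> x) ^ (2 * m) * \<phi> (norm l)) \<longleftrightarrow>
      integrable lborel (\<lambda>\<rho>. indicator {0..} \<rho> * (D * \<rho> ^ (2 * m + DIM('a) - 1)) * \<phi> \<rho>)"
    "(LINT l|lborel. (l \<bullet> x) ^ (2 * m) * \<phi> (norm l)) =
      (LINT \<rho>|lborel. indicator {0..} \<rho> * (D * \<rho> ^ (2 * m + DIM('a) - 1)) * \<phi> \<rho>)"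
    using c(2,3)[OF \<phi>] by auto
qed

text \<open>Polar coordinates are the case m = 0, where the weight is \<open>0 ^ 0 = 1\<close> and D
  becomes S, the area of the unit sphere.\<close>

lemma radial_integral:
  fixes \<phi> :: "real \<Rightarrow> real" and S :: real
  defines "S \<equiv> 2 * sqrt pi ^ DIM('a::euclidean_space) / Gamma (DIM('a) / 2)"
  assumes \<phi>: "\<phi> \<in> borel_measurable borel"
  shows "integrable lborel (\<lambda>l::'a. \<phi> (norm l)) \<longleftrightarrow>
      integrable lborel (\<lambda>\<rho>. indicator {0..} \<rho> * (S * \<rho> ^ (DIM('a) - 1)) * \<phi> \<rho>)"
    and "(LINT l|lborel. \<phi> (norm (l::'a))) =
      (LINT \<rho>|lborel. indicator {0..} \<rho> * (S * \<rho> ^ (DIM('a) - 1)) * \<phi> \<rho>)"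
  using inner_power_radial_integral[where x="0::'a" and m=0, OF \<phi>] by (auto simp: S_def)

text \<open>Every factor m + z in the recursion is at least 1/2. This crude bound suffices for the
  Bessel series in every dimension n \<ge> 1, where z = n / 2.\<close>

lemma Gamma_add_nat_lower_bound:
  fixes z :: real
  assumes "1 / 2 \<le> z"
  shows "Gamma (real m + z) \<ge> Gamma z / 2 ^ m"
proof (induction m)
  case (Suc m)
  have "Gamma (real (Suc m) + z) = Gamma ((real m + z) + 1)" by (simp add: algebra_simps)
  also have "\<dots> = (real m + z) * Gamma (real m + z)"
    using assms by (intro Gamma_plus1) (auto dest: nonpos_Ints_nonpos)
  also have "\<dots> \<ge> (1 / 2) * (Gamma z / 2 ^ m)"
    using assms Gamma_real_pos[of z] by (intro mult_mono Suc.IH) auto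
  finally show ?case by (simp add: field_simps)
qed simp

text \<open>The function \<open>bess n\<close> is the Fourier transform of the surface measure of the unit sphere of
  \<open>n\<close>-space, as a function of the norm.\<close>

definition bess :: "nat \<Rightarrow> real \<Rightarrow> real" where
  "bess n z = (\<Sum>m. 2 * sqrt pi ^ n * (-1) ^ m * z ^ (2 * m) / (4 ^ m * fact m * Gamma (real m + n / 2)))"

section \<open>The Bessel series as a radial Fourier kernel\<close>

lemma summable_exp_real: "summable (\<lambda>m. y ^ m / fact m)" for y :: real
  using summable_exp[of y] by (subst (asm) mult.commute) (simp only: divide_inverse)

text \<open>The factor \<open>4 ^ m\<close> outweighs the loss \<open>2 ^ m\<close> in the lower
  bound for Gamma, which leaves a multiple of the series of
  \<open>exp (z\<^sup>2 / 2)\<close>.\<close>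

lemma bess_summable:
  assumes "0 < n"
  shows "summable (\<lambda>m. norm (2 * sqrt pi ^ n * (-1) ^ m * z ^ (2 * m) / (4 ^ m * fact m * Gamma (real m + n / 2))))"
proof (rule summable_comparison_test')
  let ?G = "Gamma (real n / 2)"
  have G: "?G > 0" using assms by (intro Gamma_real_pos) simp
  show "summable (\<lambda>m. (2 * sqrt pi ^ n / ?G) * ((z\<^sup>2 / 2) ^ m / fact m))"
    by (intro summable_mult summable_exp_real)
  fix m :: nat
  have Gm: "Gamma (real m + n / 2) \<ge> ?G / 2 ^ m"
    using assms by (intro Gamma_add_nat_lower_bound) simp
  have Gm0: "Gamma (real m + n / 2) > 0" using assms by (intro Gamma_real_pos) (simp add: add_nonneg_pos)
  have "norm (2 * sqrt pi ^ n * (-1) ^ m * z ^ (2 * m) / (4 ^ m * fact m * Gamma (real m + n / 2)))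
     = 2 * sqrt pi ^ n * (z\<^sup>2) ^ m / (4 ^ m * fact m * Gamma (real m + n / 2))"
    using Gm0 by (simp add: abs_mult power_abs power_mult)
  also have "\<dots> \<le> 2 * sqrt pi ^ n * (z\<^sup>2) ^ m / (4 ^ m * fact m * (?G / 2 ^ m))"
    using Gm Gm0 G by (intro divide_left_mono mult_left_mono) auto
  also have "\<dots> = (2 * sqrt pi ^ n / ?G) * ((z\<^sup>2 / 2) ^ m / fact m)"
  proof -
    have "(4::real) ^ m = 2 ^ m * 2 ^ m" by (simp add: power_mult_distrib[symmetric])
    then show ?thesis using G by (simp add: power_divide field_simps)
  qed
  finally show "norm (norm (2 * sqrt pi ^ n * (-1) ^ m * z ^ (2 * m) / (4 ^ m * fact m * Gamma (real m + n / 2))))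
    \<le> (2 * sqrt pi ^ n / ?G) * ((z\<^sup>2 / 2) ^ m / fact m)" by simp
qed

lemma bess_measurable [measurable]: "bess n \<in> borel_measurable borel"
  unfolding bess_def by measurable

text \<open>Expanding the cosine reduces the claim to the weights
  \<open>(l \<bullet> x) ^ (2 * m)\<close>, whose radial integrals are known. Truncation at R makes
  the L1 norms of the terms summable, dominated by the series of cosh at \<open>R * norm x\<close>,
  so sum and integral commute on both sides.\<close>

lemma fourier_radial_truncated:
  fixes x :: "'a::euclidean_space" and \<phi> :: "real \<Rightarrow> real"
  assumes \<phi>[measurable]: "\<phi> \<in> borel_measurable borel"
    and int: "integrable lborel (\<lambda>l::'a. \<phi> (norm l))"
    and supp: "\<And>\<rho>. \<rho> > R \<Longrightarrow> \<phi> \<rho> = 0" and "0 \<le> R"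
  shows "integrable lborel (\<lambda>\<rho>. indicator {0..} \<rho> * (bess DIM('a) (norm x * \<rho>) * \<rho> ^ (DIM('a) - 1) * \<phi> \<rho>))"
    and "(LINT l|lborel. cos (l \<bullet> x) * \<phi> (norm l)) =
      (LINT \<rho>|lborel. indicator {0..} \<rho> * (bess DIM('a) (norm x * \<rho>) * \<rho> ^ (DIM('a) - 1) * \<phi> \<rho>))"
proof -
  let ?n = "DIM('a)"
  define D where "D = (\<lambda>m. 2 * sqrt pi ^ ?n * norm x ^ (2 * m) * fact (2 * m) / (4 ^ m * fact m * Gamma (real m + ?n / 2)))"
  have D_nonneg: "0 \<le> D m" for m
    unfolding D_def by (intro divide_nonneg_nonneg mult_nonneg_nonneg less_imp_le[OF Gamma_real_pos]) (auto simp: add_nonneg_pos)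
  define T where "T = (\<lambda>m (l::'a). (-1) ^ m / fact (2 * m) * ((l \<bullet> x) ^ (2 * m) * \<phi> (norm l)))"
  define U where "U = (\<lambda>m \<rho>. (-1) ^ m / fact (2 * m) * (indicator {0..} \<rho> * (D m * \<rho> ^ (2 * m + ?n - 1)) * \<phi> \<rho>))"
  have bnd: "norm ((l \<bullet> x) ^ (2 * m) * \<phi> (norm l)) \<le> (R * norm x) ^ (2 * m) * \<bar>\<phi> (norm l)\<bar>" for l :: 'a and m
  proof (cases "norm l \<le> R")
    case True
    have "\<bar>l \<bullet> x\<bar> \<le> R * norm x"
      using True \<open>0 \<le> R\<close> by (intro order_trans[OF Cauchy_Schwarz_ineq2] mult_right_mono) auto
    then have "\<bar>l \<bullet> x\<bar> ^ (2 * m) \<le> (R * norm x) ^ (2 * m)" by (intro power_mono) auto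
    then show ?thesis by (simp add: abs_mult power_abs mult_right_mono)
  next
    case False
    then show ?thesis using supp by simp
  qed
  have int_abs: "integrable lborel (\<lambda>l::'a. \<bar>\<phi> (norm l)\<bar>)" using int by auto
  have i1: "integrable lborel (\<lambda>l. (l \<bullet> x) ^ (2 * m) * \<phi> (norm l))" for m
    by (rule Bochner_Integration.integrable_bound[OF integrable_mult_right[OF int_abs, of "(R * norm x) ^ (2 * m)"]])
       (use bnd \<open>0 \<le> R\<close> in \<open>auto simp: abs_mult\<close>)
  have iT: "integrable lborel (T m)" for m
    unfolding T_def by (intro integrable_mult_right i1)
  have iU: "integrable lborel (U m)" for m
    unfolding U_def D_def by (intro integrable_mult_right inner_power_radial_integral(1)[OF \<phi>, THEN iffD1] i1)
  have TU: "integral\<^sup>L lborel (T m) = integral\<^sup>L lborel (U m)" for m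
    unfolding T_def U_def D_def using inner_power_radial_integral(2)[OF \<phi>, of x m] by (simp only: integral_mult_right_zero)
  have nT: "norm (T m l) = (1 / fact (2 * m)) * ((l \<bullet> x) ^ (2 * m) * \<bar>\<phi> (norm l)\<bar>)" for m l
    by (simp add: T_def abs_mult power_abs power_even_abs)
  have nU: "norm (U m \<rho>) = (1 / fact (2 * m)) * (indicator {0..} \<rho> * (D m * \<rho> ^ (2 * m + ?n - 1)) * \<bar>\<phi> \<rho>\<bar>)" for m \<rho>
    using D_nonneg[of m] by (auto simp: U_def abs_mult power_abs split: split_indicator)
  \<comment> \<open>Apart from \<phi> each term has a constant sign, so the radial formula applied
    to \<open>\<bar>\<phi>\<bar>\<close> equates the L1 norms and carries summability over to the
    radial side.\<close>
  have nTU: "(LINT l|lborel. norm (T m l)) = (LINT \<rho>|lborel. norm (U m \<rho>))" for m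
  proof -
    have "(LINT l|lborel. (l \<bullet> x) ^ (2 * m) * \<bar>\<phi> (norm l)\<bar>) =
      (LINT \<rho>|lborel. indicator {0..} \<rho> * (D m * \<rho> ^ (2 * m + ?n - 1)) * \<bar>\<phi> \<rho>\<bar>)"
      unfolding D_def by (rule inner_power_radial_integral(2)) simp
    then show ?thesis unfolding nT nU by (simp only: integral_mult_right_zero)
  qed
  have exp2: "summable (\<lambda>m. y ^ (2 * m) / fact (2 * m))" for y :: real
  proof (rule summable_comparison_test')
    show "summable (\<lambda>m. (y\<^sup>2) ^ m / fact m)"
      by (rule summable_exp_real)
    show "norm (y ^ (2 * m) / fact (2 * m)) \<le> (y\<^sup>2) ^ m / fact m" for m
      by (auto simp: power_mult power_abs intro!: divide_left_mono fact_mono)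
  qed
  have sumT: "summable (\<lambda>m. LINT l|lborel. norm (T m l))"
  proof (rule summable_comparison_test')
    let ?I = "LINT l|lborel. \<bar>\<phi> (norm (l::'a))\<bar>"
    show "summable (\<lambda>m. ?I * ((R * norm x) ^ (2 * m) / fact (2 * m)))"
      by (intro summable_mult exp2)
    fix m
    have "(LINT l|lborel. norm (T m l)) \<le> (LINT l|lborel. ((R * norm x) ^ (2 * m) / fact (2 * m)) * \<bar>\<phi> (norm (l::'a))\<bar>)"
    proof (rule integral_mono)
      show "norm (T m l) \<le> ((R * norm x) ^ (2 * m) / fact (2 * m)) * \<bar>\<phi> (norm l)\<bar>" for l
        using divide_right_mono[OF bnd[of l m], of "fact (2 * m)"]
        unfolding nT by (simp add: abs_mult power_abs power_even_abs)
    qed (use iT int_abs in auto)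
    then show "norm (LINT l|lborel. norm (T m l)) \<le> ?I * ((R * norm x) ^ (2 * m) / fact (2 * m))"
      by (simp add: integral_nonneg_AE mult.commute)
  qed
  then have sumU: "summable (\<lambda>m. LINT \<rho>|lborel. norm (U m \<rho>))" by (simp only: nTU)
  have ptT: "summable (\<lambda>m. norm (T m l))" for l
  proof -
    have "summable (\<lambda>m. ((l \<bullet> x) ^ (2 * m) / fact (2 * m)) * \<bar>\<phi> (norm l)\<bar>)"
      by (intro summable_mult2 exp2)
    then show ?thesis unfolding nT by simp
  qed
  have sT: "(\<Sum>m. T m l) = cos (l \<bullet> x) * \<phi> (norm l)" for l
  proof -
    have "(\<lambda>m. (- 1) ^ m / fact (2 * m) * (l \<bullet> x) ^ (2 * m) * \<phi> (norm l)) sums (cos (l \<bullet> x) * \<phi> (norm l))"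
      by (intro sums_mult2 cos_paired)
    then show ?thesis by (simp add: T_def sums_iff mult.assoc)
  qed
  define b where "b = (\<lambda>m z. 2 * sqrt pi ^ ?n * (-1) ^ m * z ^ (2 * m) / (4 ^ m * fact m * Gamma (real m + ?n / 2)))"
  \<comment> \<open>The factor \<open>fact (2 * m)\<close> in \<open>D m\<close> cancels that of the
    cosine series; what remains is the m-th term of \<open>bess\<close>.\<close>
  have Ub: "U m \<rho> = b m (norm x * \<rho>) * (indicator {0..} \<rho> * (\<rho> ^ (?n - 1) * \<phi> \<rho>))" for m \<rho>
  proof -
    have "\<rho> ^ (2 * m + ?n - 1) = \<rho> ^ (2 * m) * \<rho> ^ (?n - 1)"
      by (subst power_add[symmetric]) (simp add: Suc_leI)
    then show ?thesis by (simp add: U_def b_def D_def power_mult_distrib)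
  qed
  have bsum: "summable (\<lambda>m. norm (b m z))" for z
    unfolding b_def by (rule bess_summable) simp
  have ptU: "summable (\<lambda>m. norm (U m \<rho>))" for \<rho>
    unfolding Ub norm_mult by (intro summable_mult2 bsum[unfolded norm_mult])
  have sU: "(\<Sum>m. U m \<rho>) = indicator {0..} \<rho> * (bess ?n (norm x * \<rho>) * \<rho> ^ (?n - 1) * \<phi> \<rho>)" for \<rho>
  proof -
    have "bess ?n (norm x * \<rho>) = (\<Sum>m. b m (norm x * \<rho>))" by (simp add: bess_def b_def)
    then show ?thesis
      unfolding Ub by (subst suminf_mult2[symmetric]) (auto intro!: summable_norm_cancel[OF bsum])
  qed
  show "integrable lborel (\<lambda>\<rho>. indicator {0..} \<rho> * (bess ?n (norm x * \<rho>) * \<rho> ^ (?n - 1) * \<phi> \<rho>))"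
    using integrable_suminf[OF iU _ sumU] ptU by (simp add: sU)
  have "(LINT l|lborel. (\<Sum>m. T m l)) = (LINT \<rho>|lborel. (\<Sum>m. U m \<rho>))"
    using ptT ptU by (simp add: integral_suminf[OF iU _ sumU] integral_suminf[OF iT _ sumT] TU)
  then show "(LINT l|lborel. cos (l \<bullet> x) * \<phi> (norm l)) =
      (LINT \<rho>|lborel. indicator {0..} \<rho> * (bess ?n (norm x * \<rho>) * \<rho> ^ (?n - 1) * \<phi> \<rho>))"
    by (simp add: sT sU)
qed

text \<open>Testing the truncated formula against the sign of \<open>bess\<close> on the set where the bound fails shows
  that this set is null.  The bound makes the radial integral converge for an arbitrary \<open>\<phi>\<close>.\<close>

lemma bess_bounded_AE:
  fixes x :: "'a::euclidean_space" and S :: real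
  defines "S \<equiv> 2 * sqrt pi ^ DIM('a) / Gamma (DIM('a) / 2)"
  shows "AE \<rho> in lborel. \<rho> \<ge> 0 \<longrightarrow> \<bar>bess DIM('a) (norm x * \<rho>)\<bar> \<le> S"
proof -
  let ?n = "DIM('a)"
  let ?b = "\<lambda>\<rho>. bess ?n (norm x * \<rho>)"
  have "AE \<rho> in lborel. \<rho> \<in> {0<..real R} \<longrightarrow> \<bar>?b \<rho>\<bar> \<le> S" for R :: nat
  proof -
    define E where "E = {\<rho>::real. 0 \<le> \<rho> \<and> \<rho> \<le> real R \<and> \<bar>?b \<rho>\<bar> > S}"
    have E[measurable]: "E \<in> sets borel" unfolding E_def by measurable
    define s where "s = (\<lambda>\<rho>. indicator E \<rho> * sgn (?b \<rho>))"
    have s[measurable]: "s \<in> borel_measurable borel" unfolding s_def by measurable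
    have [measurable]: "cball (0::'a) (real R) \<in> sets borel" by simp
    have intb: "integrable lborel (\<lambda>l::'a. indicator (cball 0 (real R)) l :: real)"
      by (intro integrable_real_indicator emeasure_lborel_cball_finite) auto
    have int1: "integrable lborel (\<lambda>l::'a. s (norm l))"
      by (rule Bochner_Integration.integrable_bound[OF intb]) (auto simp: s_def E_def indicator_def sgn_if)
    have int2: "integrable lborel (\<lambda>l::'a. indicator E (norm l) :: real)"
      by (rule Bochner_Integration.integrable_bound[OF intb]) (auto simp: E_def indicator_def)
    note tr = fourier_radial_truncated[OF s int1, of "real R" x]
    have r: "s \<rho> = 0" if "\<rho> > real R" for \<rho> using that by (simp add: s_def E_def)
    have "(LINT \<rho>|lborel. indicator {0..} \<rho> * (?b \<rho> * \<rho> ^ (?n - 1) * s \<rho>)) = (LINT l|lborel. cos (l \<bullet> x) * s (norm l))"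
      using tr(2) r by simp
    also have "\<dots> \<le> (LINT l|lborel. indicator E (norm (l::'a)))"
    proof (rule integral_mono)
      have *: "\<bar>cos (l \<bullet> x) * s (norm l)\<bar> \<le> \<bar>s (norm l)\<bar>" for l
        by (simp add: abs_mult mult_left_le_one_le)
      show "integrable lborel (\<lambda>l. cos (l \<bullet> x) * s (norm l))"
        by (rule Bochner_Integration.integrable_bound[OF int1]) (use * in auto)
      show "cos (l \<bullet> x) * s (norm l) \<le> indicator E (norm l)" for l
        by (rule order_trans[OF abs_ge_self], rule order_trans[OF *]) (auto simp: s_def indicator_def sgn_if)
    qed fact
    also have "\<dots> = (LINT \<rho>|lborel. indicator {0..} \<rho> * (S * \<rho> ^ (?n - 1)) * indicator E \<rho>)"
      unfolding S_def by (rule radial_integral(2)) simp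
    finally have le: "(LINT \<rho>|lborel. indicator {0..} \<rho> * (?b \<rho> * \<rho> ^ (?n - 1) * s \<rho>)) \<le>
      (LINT \<rho>|lborel. indicator {0..} \<rho> * (S * \<rho> ^ (?n - 1)) * indicator E \<rho>)" .
    have i1: "integrable lborel (\<lambda>\<rho>. indicator {0..} \<rho> * (?b \<rho> * \<rho> ^ (?n - 1) * s \<rho>))"
      using tr(1) r by simp
    have i2: "integrable lborel (\<lambda>\<rho>. indicator {0..} \<rho> * (S * \<rho> ^ (?n - 1)) * indicator E \<rho>)"
      using int2 unfolding S_def by (subst radial_integral(1)[symmetric]) auto
    \<comment> \<open>By the choice of \<open>s\<close> this difference is nonnegative. Its integral
      is at most 0, because on the cosine side the integrand is bounded by the indicator of
      \<open>E\<close>. Hence \<open>d\<close> vanishes almost everywhere, and \<open>E\<close> is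
      null away from the origin.\<close>
    define d where "d = (\<lambda>\<rho>. indicator {0..} \<rho> * (?b \<rho> * \<rho> ^ (?n - 1) * s \<rho>) - indicator {0..} \<rho> * (S * \<rho> ^ (?n - 1)) * indicator E \<rho>)"
    have d: "d \<rho> = indicator E \<rho> * ((\<bar>?b \<rho>\<bar> - S) * \<rho> ^ (?n - 1))" for \<rho>
      by (auto simp: d_def s_def E_def indicator_def sgn_if abs_if algebra_simps)
    have id: "integrable lborel d" unfolding d_def by (intro Bochner_Integration.integrable_diff i1 i2)
    have d0: "0 \<le> d \<rho>" for \<rho> unfolding d by (auto simp: indicator_def E_def)
    have "integral\<^sup>L lborel d \<le> 0"
      unfolding d_def using le i1 i2 by simp
    moreover have "integral\<^sup>L lborel d \<ge> 0" by (intro integral_nonneg_AE AE_I2 d0)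
    ultimately have "integral\<^sup>L lborel d = 0" by simp
    then have "AE \<rho> in lborel. d \<rho> = 0"
      using integral_nonneg_eq_0_iff_AE[OF id] d0 by simp
    then show ?thesis
      by eventually_elim (auto simp: d E_def indicator_def split: if_splits)
  qed
  then have "AE \<rho> in lborel. \<forall>R::nat. \<rho> \<in> {0<..real R} \<longrightarrow> \<bar>?b \<rho>\<bar> \<le> S"
    by (subst AE_all_countable) simp
  \<comment> \<open>For n > 1 the weight \<open>\<rho> ^ (n - 1)\<close> gives no information at 0,
    so the origin is discarded as a null set.\<close>
  moreover have "AE \<rho> in lborel. \<rho> \<noteq> (0::real)" by (rule AE_lborel_singleton)
  ultimately show ?thesis
  proof eventually_elim
    case (elim \<rho>)
    obtain R :: nat where "\<rho> \<le> real R" using real_arch_simple by blast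
    with elim show ?case by force
  qed
qed

text \<open>Both sides converge when \<phi> is truncated at radius k. On the radial side
  \<open>bess_bounded_AE\<close> provides the dominating function, S times the radial density of
  \<phi>.\<close>

lemma fourier_radial:
  fixes x :: "'a::euclidean_space" and \<phi> :: "real \<Rightarrow> real"
  assumes \<phi>[measurable]: "\<phi> \<in> borel_measurable borel"
    and int: "integrable lborel (\<lambda>l::'a. \<phi> (norm l))"
  shows "(LINT l|lborel. cos (l \<bullet> x) * \<phi> (norm l)) =
      (LINT \<rho>|lborel. indicator {0..} \<rho> * (bess DIM('a) (norm x * \<rho>) * \<rho> ^ (DIM('a) - 1) * \<phi> \<rho>))"
proof (rule LIMSEQ_unique)
  let ?n = "DIM('a)"
  let ?\<phi> = "\<lambda>(k::nat) \<rho>. indicator {..real k} \<rho> * \<phi> \<rho>"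
  define S where "S = 2 * sqrt pi ^ ?n / Gamma (?n / 2)"
  have int': "integrable lborel (\<lambda>\<rho>. \<bar>indicator {0..} \<rho> * (S * \<rho> ^ (?n - 1)) * \<phi> \<rho>\<bar>)"
    using int unfolding S_def by (intro integrable_abs) (subst (asm) radial_integral(1), auto)
  have lim: "(\<lambda>k. ?\<phi> k \<rho>) \<longlonglongrightarrow> \<phi> \<rho>" for \<rho>
  proof (rule tendsto_eventually)
    obtain K :: nat where "\<rho> \<le> real K" using real_arch_simple by blast
    then show "\<forall>\<^sub>F k in sequentially. ?\<phi> k \<rho> = \<phi> \<rho>"
      by (intro eventually_sequentiallyI[of K]) auto
  qed
  show "(\<lambda>k. LINT l|lborel. cos (l \<bullet> x) * ?\<phi> k (norm l)) \<longlonglongrightarrow> (LINT l|lborel. cos (l \<bullet> x) * \<phi> (norm l))"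
    by (rule integral_dominated_convergence[where w="\<lambda>l. \<bar>\<phi> (norm l)\<bar>"])
       (use int in \<open>auto intro!: AE_I2 tendsto_mult lim mult_le_one simp: abs_mult split: split_indicator intro: mult_left_le_one_le\<close>)
  have "(LINT l|lborel. cos (l \<bullet> x) * ?\<phi> k (norm l)) = (LINT \<rho>|lborel. indicator {0..} \<rho> * (bess ?n (norm x * \<rho>) * \<rho> ^ (?n - 1) * ?\<phi> k \<rho>))" for k
  proof (rule fourier_radial_truncated(2)[of _ "real k"])
    show "integrable lborel (\<lambda>l::'a. ?\<phi> k (norm l))"
      by (rule Bochner_Integration.integrable_bound[OF int]) (auto simp: indicator_def)
  qed auto
  moreover have "(\<lambda>k. LINT \<rho>|lborel. indicator {0..} \<rho> * (bess ?n (norm x * \<rho>) * \<rho> ^ (?n - 1) * ?\<phi> k \<rho>))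
    \<longlonglongrightarrow> (LINT \<rho>|lborel. indicator {0..} \<rho> * (bess ?n (norm x * \<rho>) * \<rho> ^ (?n - 1) * \<phi> \<rho>))"
  proof (rule integral_dominated_convergence[OF _ _ int'])
    fix k
    show "AE \<rho> in lborel. norm (indicator {0..} \<rho> * (bess ?n (norm x * \<rho>) * \<rho> ^ (?n - 1) * ?\<phi> k \<rho>)) \<le> \<bar>indicator {0..} \<rho> * (S * \<rho> ^ (?n - 1)) * \<phi> \<rho>\<bar>"
      using bess_bounded_AE[of x]
    proof eventually_elim
      case (elim \<rho>)
      show ?case
      proof (cases "0 \<le> \<rho> \<and> \<rho> \<le> real k")
        case True
        then have "\<bar>bess ?n (norm x * \<rho>)\<bar> \<le> \<bar>S\<bar>" using elim by (simp add: S_def)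
        with True show ?thesis by (simp add: abs_mult mult_right_mono)
      qed (auto simp: indicator_def)
    qed
  qed (auto intro!: AE_I2 tendsto_mult lim)
  ultimately show "(\<lambda>k. LINT l|lborel. cos (l \<bullet> x) * ?\<phi> k (norm l))
    \<longlonglongrightarrow> (LINT \<rho>|lborel. indicator {0..} \<rho> * (bess ?n (norm x * \<rho>) * \<rho> ^ (?n - 1) * \<phi> \<rho>))"
    by simp
qed

text \<open>The series agree term by term up to one factor, because
  \<open>2 powr (2 * m + \<nu>)\<close> is \<open>4 ^ m * 2 powr \<nu>\<close> and \<nu> + 1 = n /
  2.\<close>

lemma bess_eq_bessel_ratio:
  assumes "0 < n"
  shows "bess n z = 2 * pi powr (real n / 2) * (2 powr ((real n - 2) / 2) * bessel_ratio ((real n - 2) / 2) z)"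
proof -
  let ?\<nu> = "(real n - 2) / 2"
  let ?t = "\<lambda>m. (-1) ^ m * z ^ (2 * m) / (fact m * Gamma (real m + ?\<nu> + 1) * 2 powr (2 * real m + ?\<nu>))"
  let ?c = "2 * pi powr (real n / 2) * 2 powr ?\<nu>"
  have c: "?c > 0" by simp
  have sp: "sqrt pi ^ n = pi powr (real n / 2)"
    by (simp add: powr_half_sqrt[symmetric] powr_realpow[symmetric] powr_powr)
  have g: "real m + ?\<nu> + 1 = real m + n / 2" for m by (simp add: field_simps)
  have p: "(2::real) powr (2 * real m + ?\<nu>) = 4 ^ m * 2 powr ?\<nu>" for m
  proof -
    have "(2::real) powr (2 * real m) = 4 ^ m"
      using powr_realpow[of 2 "2 * m"] by (simp add: power_mult)
    then show ?thesis by (simp add: powr_add)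
  qed
  have eq: "2 * sqrt pi ^ n * (-1) ^ m * z ^ (2 * m) / (4 ^ m * fact m * Gamma (real m + n / 2)) = ?c * ?t m" for m
    unfolding p g sp by (simp add: ac_simps)
  have "summable (\<lambda>m. ?c * ?t m)"
    using summable_norm_cancel[OF bess_summable[OF assms, of z]] unfolding eq .
  then have "summable ?t" using c by (subst (asm) summable_cmult_iff) auto
  then have "(\<Sum>m. ?c * ?t m) = ?c * (\<Sum>m. ?t m)" by (rule suminf_mult)
  then show ?thesis unfolding bess_def eq bessel_ratio_def by simp
qed

lemma iso_cov_eq_fourier:
  fixes x :: "'a::euclidean_space" and \<phi> :: "real \<Rightarrow> real"
  assumes \<phi>: "\<phi> \<in> borel_measurable borel"
    and int: "integrable lborel (\<lambda>l::'a. \<phi> (norm l))"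
  shows "iso_cov DIM('a) \<phi> (norm x) = (LINT l|lborel. cos (l \<bullet> x) * \<phi> (norm l))"
proof -
  let ?n = "DIM('a)" and ?\<nu> = "(real DIM('a) - 2) / 2"
  have G: "Gamma (real ?n / 2) \<noteq> 0" using Gamma_real_pos[of "real ?n / 2"] by (metis DIM_positive divide_pos_pos less_irrefl of_nat_0_less_iff zero_less_numeral)
  have "iso_cov ?n \<phi> (norm x) = (LINT u|lborel. 2 powr ?\<nu> * Gamma (real ?n / 2) * (indicator {0..} u * (bessel_ratio ?\<nu> (norm x * u) *
        (2 * pi powr (real ?n / 2) / Gamma (real ?n / 2) * u ^ (?n - 1) * \<phi> u))))"
    unfolding iso_cov_def set_lebesgue_integral_def real_scaleR_def by (simp only: integral_mult_right_zero)
  also have "\<dots> = (LINT \<rho>|lborel. indicator {0..} \<rho> * (bess ?n (norm x * \<rho>) * \<rho> ^ (?n - 1) * \<phi> \<rho>))"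
    by (intro Bochner_Integration.integral_cong refl) (use G in \<open>simp add: bess_eq_bessel_ratio field_simps\<close>)
  finally show ?thesis by (simp add: fourier_radial[OF assms])
qed

section \<open>Linear functionals of a Gaussian field\<close>

text \<open>\<open>G\<close> is vector-valued because it stands once for the values of the field at
  a fixed sample point and once for complex exponentials.\<close>

lemma simple_function_integral_sum:
  fixes F :: "'a::euclidean_space \<Rightarrow> real" and s :: "'a \<Rightarrow> 'a" and G :: "'a \<Rightarrow> 'b::{banach, second_countable_topology}"
  assumes s: "simple_function lborel s" and F: "integrable lborel F"
  shows "integrable lborel (\<lambda>x. F x *\<^sub>R G (s x))"
    and "(\<Sum>y\<in>range s. (LINT x|lborel. F x * indicator (s -` {y}) x) *\<^sub>R G y) = (LINT x|lborel. F x *\<^sub>R G (s x))"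
proof -
  have fin: "finite (range s)" and [measurable]: "\<And>y. s -` {y} \<in> sets borel"
    using simple_functionD[OF s] by auto
  have eq: "F x *\<^sub>R G (s x) = (\<Sum>y\<in>range s. (F x * indicator (s -` {y}) x) *\<^sub>R G y)" for x
  proof -
    have "(\<Sum>y\<in>range s. (F x * indicator (s -` {y}) x) *\<^sub>R G y) = (\<Sum>y\<in>range s. if y = s x then F x *\<^sub>R G y else 0)"
      by (intro sum.cong) (auto simp: indicator_def)
    also have "\<dots> = F x *\<^sub>R G (s x)" using fin by (subst sum.delta) auto
    finally show ?thesis by simp
  qed
  have int: "integrable lborel (\<lambda>x. F x * indicator (s -` {y}) x)" for y
    by (rule Bochner_Integration.integrable_bound[OF F]) (use F in \<open>auto split: split_indicator\<close>)
  show "integrable lborel (\<lambda>x. F x *\<^sub>R G (s x))"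
    unfolding eq by (intro Bochner_Integration.integrable_sum integrable_scaleR_left int)
  show "(\<Sum>y\<in>range s. (LINT x|lborel. F x * indicator (s -` {y}) x) *\<^sub>R G y) = (LINT x|lborel. F x *\<^sub>R G (s x))"
    unfolding eq by (subst Bochner_Integration.integral_sum) (simp_all add: int integral_scaleR_left)
qed

text \<open>This turns a quadratic form in the covariances into a squared Fourier sum, since the
  covariance is a mixture of the kernels \<open>cos (l \<bullet> (y - z))\<close>.\<close>

lemma norm_sum_cis_sq:
  "(cmod (\<Sum>y\<in>A. complex_of_real (c y) * cis (\<theta> y)))\<^sup>2 = (\<Sum>y\<in>A. \<Sum>z\<in>A. c y * c z * cos (\<theta> y - \<theta> z))"
proof -
  have "(cmod (\<Sum>y\<in>A. complex_of_real (c y) * cis (\<theta> y)))\<^sup>2 = (\<Sum>y\<in>A. c y * cos (\<theta> y))\<^sup>2 + (\<Sum>y\<in>A. c y * sin (\<theta> y))\<^sup>2"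
    by (simp add: cmod_power2)
  also have "\<dots> = (\<Sum>y\<in>A. \<Sum>z\<in>A. c y * c z * cos (\<theta> y - \<theta> z))"
    unfolding power2_eq_square sum_product sum.distrib[symmetric]
    by (intro sum.cong refl) (simp add: cos_diff algebra_simps)
  finally show ?thesis .
qed

lemma norm_cis_diff_le: "cmod (cis a - cis b) \<le> \<bar>a - b\<bar>"
proof -
  have "cis a - cis b = cis b * (cis (a - b) - 1)"
    by (simp add: algebra_simps cis_mult)
  then have "cmod (cis a - cis b) = cmod (cis (a - b) - 1)"
    by (simp add: norm_mult)
  also have "\<dots> \<le> \<bar>a - b\<bar>"
    using iexp_approx1[of "a - b" 0] by (simp add: cis_conv_exp)
  finally show ?thesis .
qed

text \<open>Convergence in L1 is enough here: \<open>cis\<close> is 1-Lipschitz, so L1 convergence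
  of the finite combinations carries over to characteristic functions, and their variances only have
  to converge on the spectral side.\<close>

lemma gaussian_field_integral:
  fixes \<xi> :: "'n::euclidean_space \<Rightarrow> 'w \<Rightarrow> real" and F :: "'n \<Rightarrow> real" and \<phi> :: "real \<Rightarrow> real"
  assumes M: "prob_space M"
    and xi_meas: "(\<lambda>(x, \<omega>). \<xi> x \<omega>) \<in> borel_measurable (lborel \<Otimes>\<^sub>M M)"
    and xi_gauss: "centered_gaussian_field M \<xi>"
    and xi_msc: "mean_square_continuous M \<xi>"
    and xi_cov: "\<And>x y. (LINT \<omega>|M. \<xi> x \<omega> * \<xi> y \<omega>) = iso_cov DIM('n) \<phi> (dist x y)"
    and phi[measurable]: "\<phi> \<in> borel_measurable borel"
    and phi_L1: "integrable lborel (\<lambda>l::'n. \<phi> (norm l))"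
    and F: "integrable lborel F"
  shows "AE \<omega> in M. integrable lborel (\<lambda>x. F x * \<xi> x \<omega>)"
    and "(\<lambda>\<omega>. LINT x|lborel. F x * \<xi> x \<omega>) \<in> borel_measurable M"
    and "(LINT \<omega>|M. cis (LINT x|lborel. F x * \<xi> x \<omega>)) = 
      complex_of_real (exp (- (LINT l|lborel. (cmod (LINT x|lborel. cis (l \<bullet> x) * complex_of_real (F x)))\<^sup>2 * \<phi> (norm l)) / 2))"
proof -
  interpret prob_space M by fact
  interpret pair_sigma_finite "lborel :: 'n measure" M ..
  note xi_meas[measurable]
  have F_meas[measurable]: "F \<in> borel_measurable borel" using F by auto
  define K where "K = iso_cov DIM('n) \<phi> 0"
  have gauss: "\<exists>v. centered_gaussian_rv M (\<lambda>\<omega>. \<Sum>x\<in>S. c x * \<xi> x \<omega>) v" if "finite S" for S c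
    using xi_gauss that by (auto simp: centered_gaussian_field_def)
  have gauss1: "\<exists>v. centered_gaussian_rv M (\<xi> x) v" for x
    using gauss[of "{x}" "\<lambda>_. 1"] by simp
  have xm[measurable]: "\<xi> x \<in> borel_measurable M" for x
    using gauss1[of x] by (auto simp: centered_gaussian_rv_def)
  have sq: "integrable M (\<lambda>\<omega>. (\<xi> x \<omega>)\<^sup>2)" for x
    using gauss1[of x] centered_gaussian_rv_second_moment(1)[OF M] by blast
  have Esq: "(LINT \<omega>|M. (\<xi> x \<omega>)\<^sup>2) = K" for x
    using xi_cov[of x x] by (simp add: K_def power2_eq_square)
  \<comment> \<open>With the constant second moment \<open>K\<close> this bounds all first absolute
    moments by one number \<open>B\<close>, as Fubini requires.\<close>
  have abs_le: "\<bar>t\<bar> \<le> (1 + t\<^sup>2) / 2" for t :: real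
    using zero_le_power2[of "\<bar>t\<bar> - 1"] by (simp add: power2_diff)
  have i1: "integrable M (\<xi> x)" for x
    by (rule Bochner_Integration.integrable_bound[of _ "\<lambda>\<omega>. (1 + (\<xi> x \<omega>)\<^sup>2) / 2"])
       (use sq abs_le in \<open>auto intro!: AE_I2\<close>)
  have prod_le: "\<bar>s * t\<bar> \<le> s\<^sup>2 + t\<^sup>2" for s t :: real
  proof -
    have "2 * \<bar>s * t\<bar> \<le> s\<^sup>2 + t\<^sup>2"
      using zero_le_power2[of "\<bar>s\<bar> - \<bar>t\<bar>"] by (simp add: power2_diff abs_mult)
    then show ?thesis by linarith
  qed
  have i2: "integrable M (\<lambda>\<omega>. \<xi> x \<omega> * \<xi> y \<omega>)" for x y
    by (rule Bochner_Integration.integrable_bound[of _ "\<lambda>\<omega>. (\<xi> x \<omega>)\<^sup>2 + (\<xi> y \<omega>)\<^sup>2"])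
       (use sq prod_le in \<open>auto intro!: AE_I2\<close>)
  define B where "B = (1 + K) / 2"
  have Eabs: "(LINT \<omega>|M. \<bar>\<xi> x \<omega>\<bar>) \<le> B" for x
  proof -
    have "(LINT \<omega>|M. \<bar>\<xi> x \<omega>\<bar>) \<le> (LINT \<omega>|M. (1 + (\<xi> x \<omega>)\<^sup>2) / 2)"
      using i1 sq abs_le by (intro integral_mono) auto
    also have "\<dots> = B" using sq by (simp add: Esq B_def prob_space)
    finally show ?thesis .
  qed

  \<comment> \<open>Stated for a general family since it serves both the field and its approximation
    error.\<close>
  have fub: "integrable (lborel \<Otimes>\<^sub>M M) (\<lambda>(x, \<omega>). F x * h x \<omega>)"
    if [measurable]: "(\<lambda>(x, \<omega>). h x \<omega>) \<in> borel_measurable (lborel \<Otimes>\<^sub>M M)"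
      and h: "\<And>x. integrable M (h x)" "\<And>x. (LINT \<omega>|M. \<bar>h x \<omega>\<bar>) \<le> C" for h :: "'n \<Rightarrow> 'w \<Rightarrow> real" and C
  proof (rule Fubini_integrable)
    show "integrable lborel (\<lambda>x. LINT \<omega>|M. norm (case (x, \<omega>) of (x, \<omega>) \<Rightarrow> F x * h x \<omega>))"
    proof (rule Bochner_Integration.integrable_bound[OF integrable_mult_left[OF F, of C]])
      have "\<bar>F x\<bar> * (LINT \<omega>|M. \<bar>h x \<omega>\<bar>) \<le> \<bar>F x * C\<bar>" for x
        using h(2)[of x] by (simp add: abs_mult mult_left_mono)
      then show "AE x in lborel. norm (LINT \<omega>|M. norm (case (x, \<omega>) of (x, \<omega>) \<Rightarrow> F x * h x \<omega>)) \<le> norm (F x * C)"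
        by (intro AE_I2) (simp add: abs_mult[of "F _"] integral_nonneg_AE)
    qed measurable
  qed (use h in auto)
  have int_xi: "integrable (lborel \<Otimes>\<^sub>M M) (\<lambda>(x, \<omega>). F x * \<xi> x \<omega>)"
    by (rule fub[OF xi_meas i1 Eabs])
  show ae: "AE \<omega> in M. integrable lborel (\<lambda>x. F x * \<xi> x \<omega>)"
    by (rule AE_integrable_snd[OF int_xi])
  define Y where "Y = (\<lambda>\<omega>. LINT x|lborel. F x * \<xi> x \<omega>)"
  show "(\<lambda>\<omega>. LINT x|lborel. F x * \<xi> x \<omega>) \<in> borel_measurable M" by measurable
  then have Ym[measurable]: "Y \<in> borel_measurable M" by (simp add: Y_def)

  \<comment> \<open>Simple functions approximate the identity map pointwise. Then
    \<open>\<xi> (s m x)\<close> involves finitely many values of the field, weighted by the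
    integrals of \<open>F\<close> over the level sets of \<open>s m\<close>.\<close>
  obtain s where s: "\<And>m::nat. simple_function lborel (s m)" and s_lim: "\<And>x::'n. (\<lambda>m. s m x) \<longlonglongrightarrow> x"
    using borel_measurable_implies_sequence_metric[of "\<lambda>x::'n. x" lborel 0] by auto
  have fin: "finite (range (s m))" for m using simple_functionD(1)[OF s, of m] by simp
  have sm[measurable]: "s m -` {y} \<in> sets borel" for m y using simple_functionD(2)[OF s, of m "{y}"] by simp
  define c where "c = (\<lambda>m y. LINT x|lborel. F x * indicator (s m -` {y}) x)"
  define Ys where "Ys = (\<lambda>m \<omega>. \<Sum>y\<in>range (s m). c m y * \<xi> y \<omega>)"
  have Ys_eq: "Ys m \<omega> = (LINT x|lborel. F x * \<xi> (s m x) \<omega>)" and Ys_int: "integrable lborel (\<lambda>x. F x * \<xi> (s m x) \<omega>)" for m \<omega>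
    using simple_function_integral_sum[OF s[of m] F, of "\<lambda>y. \<xi> y \<omega>"] by (auto simp: Ys_def c_def)
  have [measurable]: "Ys m \<in> borel_measurable M" for m unfolding Ys_def by measurable

  have xi_s: "(\<lambda>(x, \<omega>). \<xi> (s m x) \<omega>) \<in> borel_measurable (lborel \<Otimes>\<^sub>M M)" for m
  proof -
    have "(\<lambda>(x, \<omega>). \<Sum>y\<in>range (s m). indicator (s m -` {y}) x * \<xi> y \<omega>) \<in> borel_measurable (lborel \<Otimes>\<^sub>M M)"
      by measurable
    also have "(\<lambda>(x, \<omega>). \<Sum>y\<in>range (s m). indicator (s m -` {y}) x * \<xi> y \<omega>) = (\<lambda>(x, \<omega>). \<xi> (s m x) \<omega>)"
    proof (intro ext, clarify)
      fix x \<omega>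
      have "(\<Sum>y\<in>range (s m). indicator (s m -` {y}) x * \<xi> y \<omega>) = (\<Sum>y\<in>range (s m). if y = s m x then \<xi> y \<omega> else 0)"
        by (intro sum.cong) (auto simp: indicator_def)
      then show "(\<Sum>y\<in>range (s m). indicator (s m -` {y}) x * \<xi> y \<omega>) = \<xi> (s m x) \<omega>"
        using fin by (simp add: sum.delta)
    qed
    finally show ?thesis .
  qed
  define \<delta> where "\<delta> = (\<lambda>m. LINT x|lborel. \<bar>F x\<bar> * (LINT \<omega>|M. \<bar>\<xi> x \<omega> - \<xi> (s m x) \<omega>\<bar>))"
  have diff_meas[measurable]: "(\<lambda>(x, \<omega>). \<xi> x \<omega> - \<xi> (s m x) \<omega>) \<in> borel_measurable (lborel \<Otimes>\<^sub>M M)" for m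
    using borel_measurable_diff[OF xi_meas xi_s[of m]] by (simp add: case_prod_unfold)
  have diff_bnd: "(LINT \<omega>|M. \<bar>\<xi> x \<omega> - \<xi> (s m x) \<omega>\<bar>) \<le> 2 * B" for x m
  proof -
    have "(LINT \<omega>|M. \<bar>\<xi> x \<omega> - \<xi> (s m x) \<omega>\<bar>) \<le> (LINT \<omega>|M. \<bar>\<xi> x \<omega>\<bar> + \<bar>\<xi> (s m x) \<omega>\<bar>)"
      using i1 by (intro integral_mono) auto
    also have "\<dots> \<le> 2 * B"
      using i1 Eabs[of x] Eabs[of "s m x"] by simp
    finally show ?thesis .
  qed
  have int_diff: "integrable (lborel \<Otimes>\<^sub>M M) (\<lambda>(x, \<omega>). F x * (\<xi> x \<omega> - \<xi> (s m x) \<omega>))" for m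
    by (rule fub[OF diff_meas _ diff_bnd]) (use i1 in auto)
  have EY: "(LINT \<omega>|M. \<bar>Y \<omega> - Ys m \<omega>\<bar>) \<le> \<delta> m" and EYi: "integrable M (\<lambda>\<omega>. Y \<omega> - Ys m \<omega>)" for m
  proof -
    have int_abs: "integrable (lborel \<Otimes>\<^sub>M M) (\<lambda>(x, \<omega>). \<bar>F x * (\<xi> x \<omega> - \<xi> (s m x) \<omega>)\<bar>)"
      using integrable_abs[OF int_diff[of m]] by (simp add: case_prod_unfold)
    have eq: "AE \<omega> in M. Y \<omega> - Ys m \<omega> = (LINT x|lborel. F x * (\<xi> x \<omega> - \<xi> (s m x) \<omega>))"
      using ae
    proof eventually_elim
      case (elim \<omega>)
      then show ?case
        unfolding Ys_eq Y_def by (simp add: right_diff_distrib Bochner_Integration.integral_diff[OF _ Ys_int])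
    qed
    have [measurable]: "(\<lambda>\<omega>. LINT x|lborel. F x * (\<xi> x \<omega> - \<xi> (s m x) \<omega>)) \<in> borel_measurable M"
      using integrable_snd[OF int_diff[of m]] by auto
    show "integrable M (\<lambda>\<omega>. Y \<omega> - Ys m \<omega>)"
      using integrable_snd[OF int_diff[of m]] by (subst integrable_cong_AE[OF _ _ eq]) auto
    have "(LINT \<omega>|M. \<bar>Y \<omega> - Ys m \<omega>\<bar>) \<le> (LINT \<omega>|M. LINT x|lborel. \<bar>F x * (\<xi> x \<omega> - \<xi> (s m x) \<omega>)\<bar>)"
    proof (rule integral_mono_AE)
      show "integrable M (\<lambda>\<omega>. LINT x|lborel. \<bar>F x * (\<xi> x \<omega> - \<xi> (s m x) \<omega>)\<bar>)"
        by (rule integrable_snd[OF int_abs])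
      show "AE \<omega> in M. \<bar>Y \<omega> - Ys m \<omega>\<bar> \<le> (LINT x|lborel. \<bar>F x * (\<xi> x \<omega> - \<xi> (s m x) \<omega>)\<bar>)"
        using eq by eventually_elim (simp only: integral_abs_bound)
    qed (use \<open>integrable M (\<lambda>\<omega>. Y \<omega> - Ys m \<omega>)\<close> in auto)
    also have "\<dots> = (LINT x|lborel. LINT \<omega>|M. \<bar>F x * (\<xi> x \<omega> - \<xi> (s m x) \<omega>)\<bar>)"
      by (rule Fubini_integral[OF int_abs])
    also have "\<dots> = \<delta> m" unfolding \<delta>_def by (simp add: abs_mult)
    finally show "(LINT \<omega>|M. \<bar>Y \<omega> - Ys m \<omega>\<bar>) \<le> \<delta> m" .
  qed
  have L1_lim: "(\<lambda>m. LINT \<omega>|M. \<bar>\<xi> x \<omega> - \<xi> (s m x) \<omega>\<bar>) \<longlonglongrightarrow> 0" for x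
  proof -
    let ?q = "\<lambda>y. LINT \<omega>|M. (\<xi> y \<omega> - \<xi> x \<omega>)\<^sup>2"
    \<comment> \<open>The limit in \<open>mean_square_continuous\<close> is punctured. As
      \<open>?q\<close> vanishes at x this is continuity there, which allows \<open>s m x\<close> to
      equal x.\<close>
    have "isCont ?q x"
      using xi_msc unfolding mean_square_continuous_def isCont_def by simp
    then have "(\<lambda>m. ?q (s m x)) \<longlonglongrightarrow> ?q x"
      by (rule isCont_tendsto_compose) (rule s_lim)
    then have "(\<lambda>m. sqrt (?q (s m x))) \<longlonglongrightarrow> sqrt 0"
      by (intro tendsto_real_sqrt) simp
    then have lim: "(\<lambda>m. sqrt (?q (s m x))) \<longlonglongrightarrow> 0" by simp
    show ?thesis
    proof (rule tendsto_sandwich[OF _ _ tendsto_const lim])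
      show "\<forall>\<^sub>F m in sequentially. (LINT \<omega>|M. \<bar>\<xi> x \<omega> - \<xi> (s m x) \<omega>\<bar>) \<le> sqrt (?q (s m x))"
      proof (intro always_eventually allI)
        fix m
        have i: "integrable M (\<lambda>\<omega>. \<bar>\<xi> x \<omega> - \<xi> (s m x) \<omega>\<bar>)" using i1 by auto
        have "(\<lambda>\<omega>. \<bar>\<xi> x \<omega> - \<xi> (s m x) \<omega>\<bar>\<^sup>2) = (\<lambda>\<omega>. (\<xi> x \<omega>)\<^sup>2 + (\<xi> (s m x) \<omega>)\<^sup>2 - 2 * (\<xi> x \<omega> * \<xi> (s m x) \<omega>))"
          by (simp add: power2_diff algebra_simps)
        then have i': "integrable M (\<lambda>\<omega>. \<bar>\<xi> x \<omega> - \<xi> (s m x) \<omega>\<bar>\<^sup>2)"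
          using sq i2 by auto
        \<comment> \<open>Jensen's inequality for the square, in the form that a variance is
          nonnegative.\<close>
        have "(LINT \<omega>|M. \<bar>\<xi> x \<omega> - \<xi> (s m x) \<omega>\<bar>)\<^sup>2 \<le> (LINT \<omega>|M. \<bar>\<xi> x \<omega> - \<xi> (s m x) \<omega>\<bar>\<^sup>2)"
          using variance_positive[of "\<lambda>\<omega>. \<bar>\<xi> x \<omega> - \<xi> (s m x) \<omega>\<bar>"] variance_eq[OF i i'] by simp
        then show "(LINT \<omega>|M. \<bar>\<xi> x \<omega> - \<xi> (s m x) \<omega>\<bar>) \<le> sqrt (?q (s m x))"
          by (intro real_le_rsqrt) (simp add: power2_commute)
      qed
    qed (auto intro!: always_eventually integral_nonneg_AE)
  qed
  have "\<delta> \<longlonglongrightarrow> (LINT x|(lborel::'n measure). 0)"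
    unfolding \<delta>_def
  proof (rule integral_dominated_convergence[where w="\<lambda>x. \<bar>F x\<bar> * (2 * B)"])
    show "AE x in lborel. (\<lambda>m. \<bar>F x\<bar> * (LINT \<omega>|M. \<bar>\<xi> x \<omega> - \<xi> (s m x) \<omega>\<bar>)) \<longlonglongrightarrow> 0"
      by (intro AE_I2 tendsto_mult_right_zero L1_lim)
    show "AE x in lborel. norm (\<bar>F x\<bar> * (LINT \<omega>|M. \<bar>\<xi> x \<omega> - \<xi> (s m x) \<omega>\<bar>)) \<le> \<bar>F x\<bar> * (2 * B)" for m
      using diff_bnd by (intro AE_I2) (simp add: abs_mult integral_nonneg_AE mult_left_mono)
  qed (use F in auto)
  then have \<delta>0: "\<delta> \<longlonglongrightarrow> 0" by simp

  have "(\<lambda>m. (LINT \<omega>|M. cis (Ys m \<omega>)) - (LINT \<omega>|M. cis (Y \<omega>))) \<longlonglongrightarrow> 0"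
  proof (rule Lim_null_comparison[OF _ \<delta>0], intro always_eventually allI)
    fix m
    have c1: "integrable M (\<lambda>\<omega>. cis (Ys m \<omega>))" "integrable M (\<lambda>\<omega>. cis (Y \<omega>))"
      by (auto intro!: integrable_const_bound[where B=1])
    have "norm ((LINT \<omega>|M. cis (Ys m \<omega>)) - (LINT \<omega>|M. cis (Y \<omega>))) = norm (LINT \<omega>|M. cis (Ys m \<omega>) - cis (Y \<omega>))"
      using c1 by simp
    also have "\<dots> \<le> (LINT \<omega>|M. norm (cis (Ys m \<omega>) - cis (Y \<omega>)))" by (rule integral_norm_bound)
    also have "\<dots> \<le> (LINT \<omega>|M. \<bar>Y \<omega> - Ys m \<omega>\<bar>)"
    proof (rule integral_mono)
      show "norm (cis (Ys m \<omega>) - cis (Y \<omega>)) \<le> \<bar>Y \<omega> - Ys m \<omega>\<bar>" for \<omega>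
        by (subst abs_minus_commute) (rule norm_cis_diff_le)
    qed (use c1 EYi in auto)
    also have "\<dots> \<le> \<delta> m" by (rule EY)
    finally show "norm ((LINT \<omega>|M. cis (Ys m \<omega>)) - (LINT \<omega>|M. cis (Y \<omega>))) \<le> \<delta> m" .
  qed
  then have lim1: "(\<lambda>m. LINT \<omega>|M. cis (Ys m \<omega>)) \<longlonglongrightarrow> (LINT \<omega>|M. cis (Y \<omega>))"
    by (simp add: LIM_zero_iff)

  \<comment> \<open>\<open>V m\<close> is the variance of \<open>Ys m\<close>. Written with
    \<open>s m\<close> inside the character it tends to the integral with the squared Fourier
    transform of \<open>F\<close>, by dominated convergence in x and then in l.\<close>
  define V where "V = (\<lambda>m. LINT l|lborel. (cmod (LINT x|lborel. F x *\<^sub>R cis (l \<bullet> s m x)))\<^sup>2 * \<phi> (norm l))"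
  have chY: "(LINT \<omega>|M. cis (Ys m \<omega>)) = complex_of_real (exp (- V m / 2))" for m
  proof -
    obtain v where v: "centered_gaussian_rv M (Ys m) v"
      using gauss[OF fin[of m], of "c m"] unfolding Ys_def by blast
    have ci: "integrable lborel (\<lambda>l. cos (l \<bullet> z) * \<phi> (norm l))" for z :: 'n
      by (rule Bochner_Integration.integrable_bound[OF phi_L1]) (auto simp: abs_mult mult_left_le_one_le)
    have "v = (LINT \<omega>|M. (Ys m \<omega>)\<^sup>2)"
      using centered_gaussian_rv_second_moment(2)[OF M v] by simp
    also have "\<dots> = (LINT \<omega>|M. (\<Sum>y\<in>range (s m). \<Sum>z\<in>range (s m). c m y * c m z * (\<xi> y \<omega> * \<xi> z \<omega>)))"
      unfolding Ys_def power2_eq_square sum_product by (simp add: ac_simps)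
    also have "\<dots> = (\<Sum>y\<in>range (s m). \<Sum>z\<in>range (s m). c m y * c m z * (LINT \<omega>|M. \<xi> y \<omega> * \<xi> z \<omega>))"
      using i2 by (simp add: Bochner_Integration.integral_sum)
    also have "\<dots> = (\<Sum>y\<in>range (s m). \<Sum>z\<in>range (s m). c m y * c m z * (LINT l|lborel. cos (l \<bullet> (y - z)) * \<phi> (norm l)))"
      unfolding xi_cov dist_norm iso_cov_eq_fourier[OF phi phi_L1] ..
    also have "\<dots> = (LINT l|lborel. (\<Sum>y\<in>range (s m). \<Sum>z\<in>range (s m). c m y * c m z * (cos (l \<bullet> (y - z)) * \<phi> (norm l))))"
      using ci by (simp add: Bochner_Integration.integral_sum)
    also have "\<dots> = (LINT l|lborel. (cmod (\<Sum>y\<in>range (s m). complex_of_real (c m y) * cis (l \<bullet> y)))\<^sup>2 * \<phi> (norm l))"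
      unfolding norm_sum_cis_sq by (simp add: sum_distrib_right inner_diff_right mult.assoc)
    also have "\<dots> = V m"
      unfolding V_def c_def
      by (subst simple_function_integral_sum(2)[OF s F, symmetric]) (simp add: scaleR_conv_of_real)
    finally show ?thesis using centered_gaussian_rv_char[OF M v] by simp
  qed
  have "V \<longlonglongrightarrow> (LINT l|lborel. (cmod (LINT x|lborel. F x *\<^sub>R cis (l \<bullet> x)))\<^sup>2 * \<phi> (norm l))"
    unfolding V_def
  proof (rule integral_dominated_convergence[where w="\<lambda>l. (LINT x|lborel. \<bar>F x\<bar>)\<^sup>2 * \<bar>\<phi> (norm l)\<bar>"])
    have sb[measurable]: "s m \<in> borel_measurable borel" for m
      using borel_measurable_simple_function[OF s[of m]] by simp
    show "(\<lambda>l. (cmod (LINT x|lborel. F x *\<^sub>R cis (l \<bullet> s m x)))\<^sup>2 * \<phi> (norm l)) \<in> borel_measurable lborel" for m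
      by measurable
    show "(\<lambda>l. (cmod (LINT x|lborel. F x *\<^sub>R cis (l \<bullet> x)))\<^sup>2 * \<phi> (norm l)) \<in> borel_measurable lborel"
      by measurable
    have "(\<lambda>m. LINT x|lborel. F x *\<^sub>R cis (l \<bullet> s m x)) \<longlonglongrightarrow> (LINT x|lborel. F x *\<^sub>R cis (l \<bullet> x))" for l
    proof (rule integral_dominated_convergence[where w="\<lambda>x. \<bar>F x\<bar>"])
      show "AE x in lborel. (\<lambda>m. F x *\<^sub>R cis (l \<bullet> s m x)) \<longlonglongrightarrow> F x *\<^sub>R cis (l \<bullet> x)"
        unfolding cis_conv_exp by (intro AE_I2 tendsto_intros s_lim)
    qed (use F in auto)
    then show "AE l in lborel. (\<lambda>m. (cmod (LINT x|lborel. F x *\<^sub>R cis (l \<bullet> s m x)))\<^sup>2 * \<phi> (norm l))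
      \<longlonglongrightarrow> (cmod (LINT x|lborel. F x *\<^sub>R cis (l \<bullet> x)))\<^sup>2 * \<phi> (norm l)"
      by (intro AE_I2 tendsto_intros)
    have "cmod (LINT x|lborel. F x *\<^sub>R cis (l \<bullet> s m x)) \<le> (LINT x|lborel. \<bar>F x\<bar>)" for l m
      using integral_norm_bound[of lborel "\<lambda>x. F x *\<^sub>R cis (l \<bullet> s m x)"] by simp
    then show "AE l in lborel. norm ((cmod (LINT x|lborel. F x *\<^sub>R cis (l \<bullet> s m x)))\<^sup>2 * \<phi> (norm l)) \<le> (LINT x|lborel. \<bar>F x\<bar>)\<^sup>2 * \<bar>\<phi> (norm l)\<bar>" for m
      by (intro AE_I2) (simp add: abs_mult mult_right_mono power_mono)
  qed (use phi_L1 in auto)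
  then have "(\<lambda>m. complex_of_real (exp (- V m / 2))) \<longlonglongrightarrow>
     complex_of_real (exp (- (LINT l|lborel. (cmod (LINT x|lborel. F x *\<^sub>R cis (l \<bullet> x)))\<^sup>2 * \<phi> (norm l)) / 2))"
    by (intro tendsto_intros) auto
  with lim1 have "(LINT \<omega>|M. cis (Y \<omega>)) = complex_of_real (exp (- (LINT l|lborel. (cmod (LINT x|lborel. F x *\<^sub>R cis (l \<bullet> x)))\<^sup>2 * \<phi> (norm l)) / 2))"
    unfolding chY by (rule LIMSEQ_unique)
  then show "(LINT \<omega>|M. cis (LINT x|lborel. F x * \<xi> x \<omega>)) = 
      complex_of_real (exp (- (LINT l|lborel. (cmod (LINT x|lborel. cis (l \<bullet> x) * complex_of_real (F x)))\<^sup>2 * \<phi> (norm l)) / 2))"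
    by (simp add: Y_def scaleR_conv_of_real mult.commute)
qed

section \<open>Concentration of scaled kernels\<close>

lemma integrable_powr_near_0:
  assumes "0 < \<alpha>"
  shows "integrable lborel (\<lambda>v::real. indicator {0..1} v * v powr (\<alpha> - 1))"
proof -
  have "(\<lambda>v::real. v powr (\<alpha> - 1)) integrable_on {0..1}"
    using assms by (intro integrable_on_powr_from_0) auto
  then have "(\<lambda>v::real. v powr (\<alpha> - 1)) absolutely_integrable_on {0..1}"
    by (rule nonnegative_absolutely_integrable_1) auto
  then show ?thesis
    unfolding set_integrable_def by (subst (asm) integrable_completion) auto
qed

lemma integrable_powr_near_infinity:
  assumes "\<gamma> < 0"
  shows "integrable lborel (\<lambda>v::real. indicator {1..} v * v powr (\<gamma> - 1))"
proof -
  have "(\<lambda>v::real. v powr (\<gamma> - 1)) integrable_on {1..}"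
    using has_integral_powr_to_inf[of "\<gamma> - 1" 1] assms by auto
  then have "(\<lambda>v::real. v powr (\<gamma> - 1)) absolutely_integrable_on {1..}"
    by (rule nonnegative_absolutely_integrable_1) auto
  then show ?thesis
    unfolding set_integrable_def by (subst (asm) integrable_completion) auto
qed

lemma integrable_lborel_reflect:
  fixes f :: "real \<Rightarrow> real"
  assumes "integrable lborel f"
  shows "integrable lborel (\<lambda>v. f (- v))"
  using lborel_integrable_real_affine[OF assms, of "-1" 0] by simp

lemma integrable_abs_powr_near_0:
  assumes "0 < \<alpha>"
  shows "integrable lborel (\<lambda>v::real. indicator {-1..1} v * \<bar>v\<bar> powr (\<alpha> - 1))"
proof -
  note i = integrable_powr_near_0[OF assms]
  show ?thesis
    by (rule Bochner_Integration.integrable_bound[OF Bochner_Integration.integrable_add[OF i integrable_lborel_reflect[OF i]]])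
       (auto simp: indicator_def abs_if)
qed

text \<open>The bound \<open>B\<close> is used on [-1, 1], where \<alpha> > 0 gives integrability,
  and the decay outside, where \<alpha> < \<beta> does.\<close>

lemma integrable_abs_powr_decay:
  fixes K :: "real \<Rightarrow> real"
  assumes [measurable]: "K \<in> borel_measurable borel"
    and B: "\<And>s. \<bar>K s\<bar> \<le> B" and C: "\<And>s. s \<noteq> 0 \<Longrightarrow> \<bar>K s\<bar> \<le> C * \<bar>s\<bar> powr (- \<beta>)"
    and "0 < \<alpha>" "\<alpha> < \<beta>"
  shows "integrable lborel (\<lambda>v. K v * \<bar>v\<bar> powr (\<alpha> - 1))"
proof -
  have neg: "\<alpha> - \<beta> < 0" using assms by simp
  note i1 = integrable_abs_powr_near_0[OF \<open>0 < \<alpha>\<close>]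
  note i2 = integrable_powr_near_infinity[OF neg]
  note i = Bochner_Integration.integrable_add[OF integrable_mult_right[OF i1, of B]
     integrable_mult_right[OF Bochner_Integration.integrable_add[OF i2 integrable_lborel_reflect[OF i2]], of C]]
  show ?thesis
  proof (rule Bochner_Integration.integrable_bound[OF i])
    have B0: "0 \<le> B" using B[of 0] by linarith
    have C0: "0 \<le> C" using C[of 1] by simp
    have "\<bar>K v\<bar> * \<bar>v\<bar> powr (\<alpha> - 1) \<le> \<bar>B * (indicator {- 1..1} v * \<bar>v\<bar> powr (\<alpha> - 1)) +
       C * (indicator {1..} v * v powr (\<alpha> - \<beta> - 1) + indicator {1..} (- v) * (- v) powr (\<alpha> - \<beta> - 1))\<bar>" (is "_ \<le> \<bar>?r\<bar>") for v
    proof -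
      have "\<bar>K v\<bar> * \<bar>v\<bar> powr (\<alpha> - 1) \<le> ?r"
      proof (cases "\<bar>v\<bar> \<le> 1")
        case True
        have "\<bar>K v\<bar> * \<bar>v\<bar> powr (\<alpha> - 1) \<le> B * (indicator {- 1..1} v * \<bar>v\<bar> powr (\<alpha> - 1))"
          using True B by (auto intro!: mult_right_mono simp: indicator_def)
        also have "\<dots> \<le> ?r" using C0 by (auto simp: indicator_def)
        finally show ?thesis .
      next
        case False
        then have "\<bar>K v\<bar> * \<bar>v\<bar> powr (\<alpha> - 1) \<le> C * \<bar>v\<bar> powr (- \<beta>) * \<bar>v\<bar> powr (\<alpha> - 1)"
          using C[of v] by (intro mult_right_mono) auto
        also have "\<dots> = C * \<bar>v\<bar> powr (\<alpha> - \<beta> - 1)"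
          by (simp add: powr_add[symmetric] algebra_simps)
        also have "\<dots> \<le> ?r" using False by (auto simp: indicator_def abs_if)
        finally show ?thesis .
      qed
      then show ?thesis by linarith
    qed
    then show "AE v in lborel. norm (K v * \<bar>v\<bar> powr (\<alpha> - 1)) \<le> norm (B * (indicator {- 1..1} v * \<bar>v\<bar> powr (\<alpha> - 1)) +
       C * (indicator {1..} v * v powr (\<alpha> - \<beta> - 1) + indicator {1..} (- v) * (- v) powr (\<alpha> - \<beta> - 1)))"
      by (auto simp: abs_mult)
  qed measurable
qed

text \<open>The decay of \<open>K\<close> turns the remainder \<open>R\<close> into a term of order \<open>r powr (\<alpha> - \<beta>)\<close>; taking \<open>\<beta>\<close>
  strictly between \<open>\<alpha>\<close> and the true decay exponent avoids logarithms.\<close>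

lemma concentration_limit:
  fixes K H R L :: "real \<Rightarrow> real" and a \<alpha> \<beta> B C D :: real
  assumes K[measurable]: "K \<in> borel_measurable borel"
    and B: "\<And>s. \<bar>K s\<bar> \<le> B" and C: "\<And>s. s \<noteq> 0 \<Longrightarrow> \<bar>K s\<bar> \<le> C * \<bar>s\<bar> powr (- \<beta>)"
    and \<alpha>: "0 < \<alpha>" "\<alpha> < \<beta>"
    and H[measurable]: "H \<in> borel_measurable borel" and D: "\<And>\<rho>. \<bar>H \<rho>\<bar> \<le> D"
    and R[measurable]: "R \<in> borel_measurable borel"
    and R_int: "integrable lborel (\<lambda>\<rho>. \<bar>\<rho> - a\<bar> powr (- \<beta>) * R \<rho>)"
    and L[measurable]: "L \<in> borel_measurable borel"
    and lim: "\<And>v. v \<noteq> 0 \<Longrightarrow> ((\<lambda>r. H (a + v / r)) \<longlongrightarrow> L v) at_top"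
  shows "((\<lambda>r. r powr \<alpha> * (LINT \<rho>|lborel. K (r * (\<rho> - a)) * (\<bar>\<rho> - a\<bar> powr (\<alpha> - 1) * H \<rho> + R \<rho>)))
     \<longlongrightarrow> (LINT v|lborel. K v * \<bar>v\<bar> powr (\<alpha> - 1) * L v)) at_top"
proof -
  have C0: "0 \<le> C" using C[of 1] by simp
  have D0: "0 \<le> D" using D[of 0] by linarith
  note iK = integrable_abs_powr_decay[OF K B C \<alpha>]
  have iKH: "integrable lborel (\<lambda>v. K v * \<bar>v\<bar> powr (\<alpha> - 1) * H (a + v / r))" for r
    by (rule Bochner_Integration.integrable_bound[OF integrable_mult_left[OF iK, of D]])
       (use D D0 in \<open>auto simp: abs_mult intro!: mult_left_mono\<close>)
  define J where "J = (LINT \<rho>|lborel. \<bar>\<bar>\<rho> - a\<bar> powr (- \<beta>) * R \<rho>\<bar>)"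
  have main: "r powr \<alpha> * (LINT \<rho>|lborel. K (r * (\<rho> - a)) * (\<bar>\<rho> - a\<bar> powr (\<alpha> - 1) * H \<rho> + R \<rho>)) =
     (LINT v|lborel. K v * \<bar>v\<bar> powr (\<alpha> - 1) * H (a + v / r)) + r powr \<alpha> * (LINT \<rho>|lborel. K (r * (\<rho> - a)) * R \<rho>)"
    and rest: "\<bar>r powr \<alpha> * (LINT \<rho>|lborel. K (r * (\<rho> - a)) * R \<rho>)\<bar> \<le> r powr (\<alpha> - \<beta>) * (C * J)"
    if r: "0 < r" for r
  proof -
    have bnd: "\<bar>K (r * (\<rho> - a)) * R \<rho>\<bar> \<le> C * r powr (- \<beta>) * \<bar>\<bar>\<rho> - a\<bar> powr (- \<beta>) * R \<rho>\<bar>" if "\<rho> \<noteq> a" for \<rho>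
    proof -
      have "\<bar>K (r * (\<rho> - a))\<bar> \<le> C * (r powr (- \<beta>) * \<bar>\<rho> - a\<bar> powr (- \<beta>))"
        using C[of "r * (\<rho> - a)"] r that by (simp add: abs_mult powr_mult)
      then have "\<bar>K (r * (\<rho> - a))\<bar> * \<bar>R \<rho>\<bar> \<le> C * (r powr (- \<beta>) * \<bar>\<rho> - a\<bar> powr (- \<beta>)) * \<bar>R \<rho>\<bar>"
        by (rule mult_right_mono) simp
      then show ?thesis by (simp add: abs_mult mult.assoc)
    qed
    \<comment> \<open>At \<rho> = a the bound may fail, since \<open>0 powr (- \<beta>)\<close> is
      0; one point is null.\<close>
    have bnd': "AE \<rho> in lborel. \<bar>K (r * (\<rho> - a)) * R \<rho>\<bar> \<le> C * r powr (- \<beta>) * \<bar>\<bar>\<rho> - a\<bar> powr (- \<beta>) * R \<rho>\<bar>"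
      using AE_lborel_singleton[of a] by eventually_elim (rule bnd)
    have iR: "integrable lborel (\<lambda>\<rho>. K (r * (\<rho> - a)) * R \<rho>)"
    proof (rule Bochner_Integration.integrable_bound[OF integrable_mult_right[OF integrable_abs[OF R_int], of "C * r powr (- \<beta>)"]])
      show "AE \<rho> in lborel. norm (K (r * (\<rho> - a)) * R \<rho>) \<le> norm (C * r powr (- \<beta>) * \<bar>\<bar>\<rho> - a\<bar> powr (- \<beta>) * R \<rho>\<bar>)"
        using bnd' by eventually_elim auto
    qed measurable
    have "\<bar>LINT \<rho>|lborel. K (r * (\<rho> - a)) * R \<rho>\<bar> \<le> (LINT \<rho>|lborel. \<bar>K (r * (\<rho> - a)) * R \<rho>\<bar>)"
      by (rule integral_abs_bound)
    also have "\<dots> \<le> (LINT \<rho>|lborel. C * r powr (- \<beta>) * \<bar>\<bar>\<rho> - a\<bar> powr (- \<beta>) * R \<rho>\<bar>)"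
      using iR R_int bnd' by (intro integral_mono_AE) auto
    also have "\<dots> = C * r powr (- \<beta>) * J" by (simp add: J_def)
    finally have "\<bar>r powr \<alpha> * (LINT \<rho>|lborel. K (r * (\<rho> - a)) * R \<rho>)\<bar> \<le> r powr \<alpha> * (C * r powr (- \<beta>) * J)"
      by (simp add: abs_mult mult_left_mono)
    also have "\<dots> = r powr (\<alpha> - \<beta>) * (C * J)"
      by (simp add: powr_diff powr_minus field_simps)
    finally show "\<bar>r powr \<alpha> * (LINT \<rho>|lborel. K (r * (\<rho> - a)) * R \<rho>)\<bar> \<le> r powr (\<alpha> - \<beta>) * (C * J)" .
    \<comment> \<open>Substitution \<rho> = a + v / r. The Jacobian \<open>1 / r\<close> and the
      factor \<open>r powr (1 - \<alpha>)\<close> from the singular power cancel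
      \<open>r powr \<alpha>\<close> exactly.\<close>
    let ?f = "\<lambda>\<rho>. K (r * (\<rho> - a)) * (\<bar>\<rho> - a\<bar> powr (\<alpha> - 1) * H \<rho>)"
    have fv: "?f (a + (1 / r) * v) = r powr (1 - \<alpha>) * (K v * \<bar>v\<bar> powr (\<alpha> - 1) * H (a + v / r))" for v
    proof -
      have "\<bar>v / r\<bar> powr (\<alpha> - 1) = \<bar>v\<bar> powr (\<alpha> - 1) * r powr (1 - \<alpha>)"
        using r by (simp add: abs_divide powr_divide powr_diff field_simps)
      then show ?thesis using r by simp
    qed
    have "integrable lborel (\<lambda>v. ?f (a + (1 / r) * v))"
      unfolding fv by (intro integrable_mult_right iKH)
    then have if_: "integrable lborel ?f"
      using r by (subst (asm) lborel_integrable_real_affine_iff) auto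
    have "(LINT \<rho>|lborel. ?f \<rho>) = (1 / r) * (LINT v|lborel. ?f (a + (1 / r) * v))"
      using r by (subst lborel_integral_real_affine[of "1 / r" _ a]) auto
    also have "\<dots> = (1 / r) * (r powr (1 - \<alpha>) * (LINT v|lborel. K v * \<bar>v\<bar> powr (\<alpha> - 1) * H (a + v / r)))"
      unfolding fv by (simp only: integral_mult_right_zero)
    finally have "r powr \<alpha> * (LINT \<rho>|lborel. ?f \<rho>) = (r powr \<alpha> * (1 / r) * r powr (1 - \<alpha>)) * (LINT v|lborel. K v * \<bar>v\<bar> powr (\<alpha> - 1) * H (a + v / r))"
      by simp
    also have "r powr \<alpha> * (1 / r) * r powr (1 - \<alpha>) = 1"
      using r by (simp add: powr_diff)
    finally have "r powr \<alpha> * (LINT \<rho>|lborel. ?f \<rho>) = (LINT v|lborel. K v * \<bar>v\<bar> powr (\<alpha> - 1) * H (a + v / r))"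
      by simp
    then show "r powr \<alpha> * (LINT \<rho>|lborel. K (r * (\<rho> - a)) * (\<bar>\<rho> - a\<bar> powr (\<alpha> - 1) * H \<rho> + R \<rho>)) =
     (LINT v|lborel. K v * \<bar>v\<bar> powr (\<alpha> - 1) * H (a + v / r)) + r powr \<alpha> * (LINT \<rho>|lborel. K (r * (\<rho> - a)) * R \<rho>)"
      by (simp add: distrib_left Bochner_Integration.integral_add[OF if_ iR])
  qed
  have lim1: "((\<lambda>r. LINT v|lborel. K v * \<bar>v\<bar> powr (\<alpha> - 1) * H (a + v / r)) \<longlongrightarrow> (LINT v|lborel. K v * \<bar>v\<bar> powr (\<alpha> - 1) * L v)) at_top"
  proof (rule integral_dominated_convergence_at_top[where w="\<lambda>v. \<bar>K v * \<bar>v\<bar> powr (\<alpha> - 1)\<bar> * D"])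
    show "AE v in lborel. ((\<lambda>r. K v * \<bar>v\<bar> powr (\<alpha> - 1) * H (a + v / r)) \<longlongrightarrow> K v * \<bar>v\<bar> powr (\<alpha> - 1) * L v) at_top"
      using AE_lborel_singleton[of "0::real"] by eventually_elim (intro tendsto_mult tendsto_const lim)
    show "\<forall>\<^sub>F r in at_top. AE v in lborel. norm (K v * \<bar>v\<bar> powr (\<alpha> - 1) * H (a + v / r)) \<le> \<bar>K v * \<bar>v\<bar> powr (\<alpha> - 1)\<bar> * D"
      using D by (intro always_eventually allI AE_I2) (simp add: abs_mult mult_left_mono)
  qed (use iK in auto)
  have lim2: "((\<lambda>r. r powr \<alpha> * (LINT \<rho>|lborel. K (r * (\<rho> - a)) * R \<rho>)) \<longlongrightarrow> 0) at_top"
  proof (rule Lim_null_comparison)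
    show "\<forall>\<^sub>F r in at_top. norm (r powr \<alpha> * (LINT \<rho>|lborel. K (r * (\<rho> - a)) * R \<rho>)) \<le> r powr (\<alpha> - \<beta>) * (C * J)"
      using eventually_gt_at_top[of 0] by eventually_elim (use rest in simp)
    have "((\<lambda>r. r powr (\<alpha> - \<beta>)) \<longlongrightarrow> 0) at_top"
      using \<alpha> by (intro tendsto_neg_powr filterlim_ident) auto
    then show "((\<lambda>r. r powr (\<alpha> - \<beta>) * (C * J)) \<longlongrightarrow> 0) at_top"
      by (rule tendsto_mult_left_zero)
  qed
  have "((\<lambda>r. (LINT v|lborel. K v * \<bar>v\<bar> powr (\<alpha> - 1) * H (a + v / r)) + r powr \<alpha> * (LINT \<rho>|lborel. K (r * (\<rho> - a)) * R \<rho>))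
     \<longlongrightarrow> (LINT v|lborel. K v * \<bar>v\<bar> powr (\<alpha> - 1) * L v) + 0) at_top"
    by (intro tendsto_add lim1 lim2)
  then show ?thesis
    unfolding add_0_right
    by (rule Lim_transform_eventually, intro eventually_mono[OF eventually_gt_at_top[of 0]]) (rule main[symmetric])
qed

text \<open>In polar coordinates the spectral mass near \<open>a j\<close> is a singular power times
  \<open>H\<close>, plus a remainder \<open>R\<close> that contains only the terms bounded there.
  The limit of \<open>H\<close> is one-sided for j = 0, since radii are positive, and two-sided
  otherwise.\<close>

lemma spectral_scaling_limit:
  fixes a \<alpha> :: "nat \<Rightarrow> real" and h :: "nat \<Rightarrow> real \<Rightarrow> real" and \<phi> K :: "real \<Rightarrow> real" and k j n :: nat
  defines "n \<equiv> DIM('n::euclidean_space)"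
  assumes a0: "a 0 = 0" and a_mono: "\<And>i. i < k \<Longrightarrow> a i < a (Suc i)"
    and alpha0: "0 < \<alpha> 0" "\<alpha> 0 < real n"
    and alphai: "\<And>i. 1 \<le> i \<Longrightarrow> i \<le> k \<Longrightarrow> 0 < \<alpha> i \<and> \<alpha> i < 1"
    and h_bdd: "\<And>i. i \<le> k \<Longrightarrow> bounded (h i ` {- a i..})"
    and h_cont: "\<And>i. i \<le> k \<Longrightarrow> \<exists>\<epsilon>>0. continuous_on ({-\<epsilon><..<\<epsilon>} \<inter> {- a i..}) (h i)"
    and phi_form: "\<And>\<rho>. \<rho> > 0 \<Longrightarrow> (\<forall>i\<in>{1..k}. \<rho> \<noteq> a i) \<Longrightarrow>
        \<phi> \<rho> = h 0 \<rho> / \<rho> powr (real n - \<alpha> 0)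
               + (\<Sum>i=1..k. h i (\<rho> - a i) / \<bar>\<rho> - a i\<bar> powr (1 - \<alpha> i))"
    and phi[measurable]: "\<phi> \<in> borel_measurable borel"
    and phi_L1: "integrable lborel (\<lambda>l::'n. \<phi> (norm l))"
    and j: "j \<le> k"
    and K[measurable]: "K \<in> borel_measurable borel"
    and K_even: "\<And>s. K (- s) = K s" and K_bdd: "\<And>s. \<bar>K s\<bar> \<le> B"
    and K_decay: "\<And>s. s > 0 \<Longrightarrow> \<bar>K s\<bar> \<le> C * s powr (- real n)"
  shows "((\<lambda>r. r powr \<alpha> j * (LINT l|lborel. K (r * (norm (l::'n) - a j)) * \<phi> (norm l))) \<longlongrightarrow>
     (if j = 0 then 1 else 2 * a j ^ (n - 1)) * h j 0 * (LINT u|lborel. K (norm (u::'n)) * norm u powr (\<alpha> j - real n))) at_top"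
proof -
  have n: "n \<ge> 1" unfolding n_def by (simp add: Suc_leI)
  define S where "S = 2 * sqrt pi ^ n / Gamma (n / 2)"
  have S: "S > 0" unfolding S_def using n by (intro divide_pos_pos Gamma_real_pos) auto
  have a_less: "a i < a i'" if "i < i'" "i' \<le> k" for i i'
    using that
  proof (induction i')
    case (Suc i')
    show ?case
    proof (cases "i = i'")
      case True
      then show ?thesis using a_mono[of i'] Suc.prems by simp
    next
      case False
      then have "a i < a i'" using Suc by simp
      also have "a i' < a (Suc i')" using a_mono[of i'] Suc.prems by simp
      finally show ?thesis .
    qed
  qed simp
  have a_neq: "a i \<noteq> a j" if "i \<le> k" "i \<noteq> j" for i
    using a_less[of i j] a_less[of j i] that j by (cases "i < j") auto
  have aj: "0 \<le> a j" "j > 0 \<Longrightarrow> 0 < a j" using a_less[of 0 j] a0 j by (cases "j = 0"; auto)+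
  obtain bh where bh: "\<And>i s. i \<le> k \<Longrightarrow> s \<ge> - a i \<Longrightarrow> \<bar>h i s\<bar> \<le> bh i"
  proof -
    have "\<exists>b. \<forall>s\<ge>- a i. \<bar>h i s\<bar> \<le> b" if "i \<le> k" for i
      using h_bdd[OF that] by (auto simp: bounded_iff)
    then show thesis using that by metis
  qed
  have bh0: "0 \<le> bh i" if "i \<le> k" for i using bh[OF that order_refl] by linarith
  obtain \<epsilon>0 where \<epsilon>0: "0 < \<epsilon>0" "continuous_on ({-\<epsilon>0<..<\<epsilon>0} \<inter> {- a j..}) (h j)"
    using h_cont[OF j] by blast
  \<comment> \<open>Half the distances keep every other singularity at least \<epsilon> away from
    the window, \<open>\<epsilon>0\<close> keeps the window in the region where \<open>h j\<close>
    is continuous, and 1 keeps it inside the interval used for the singular power. The inserted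
    numbers also make the set nonempty when k = 0.\<close>
  define \<epsilon> where "\<epsilon> = Min (insert \<epsilon>0 (insert 1 ((\<lambda>i. \<bar>a i - a j\<bar> / 2) ` ({..k} - {j}))))"
  have "0 < \<epsilon>"
    unfolding \<epsilon>_def using \<epsilon>0 a_neq by (subst Min_gr_iff) auto
  moreover have "\<epsilon> \<le> \<epsilon>0" "\<epsilon> \<le> 1"
    unfolding \<epsilon>_def by (intro Min_le; simp)+
  ultimately have \<epsilon>: "0 < \<epsilon>" "\<epsilon> \<le> \<epsilon>0" "\<epsilon> \<le> 1" by auto
  have \<epsilon>a: "2 * \<epsilon> \<le> \<bar>a i - a j\<bar>" if "i \<le> k" "i \<noteq> j" for i
  proof -
    have "\<epsilon> \<le> \<bar>a i - a j\<bar> / 2" unfolding \<epsilon>_def using that by (intro Min_le) auto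
    then show ?thesis by simp
  qed
  have far: "\<epsilon> \<le> \<bar>\<rho> - a i\<bar>" if "i \<le> k" "i \<noteq> j" "\<bar>\<rho> - a j\<bar> < \<epsilon>" for i \<rho>
    using \<epsilon>a[OF that(1,2)] that(3) by linarith
  \<comment> \<open>At index 0 the sphere has shrunk to a point, so the exponent is measured from n
    instead of 1.\<close>
  define e where "e = (\<lambda>i. if i = 0 then real n - \<alpha> 0 else 1 - \<alpha> i)"
  have e: "0 < e i" if "i \<le> k" for i using alpha0 alphai[of i] that by (auto simp: e_def)
  define T where "T = (\<lambda>i \<rho>. h i (\<rho> - a i) * \<bar>\<rho> - a i\<bar> powr (- e i))"
  have phi_sum: "\<phi> \<rho> = (\<Sum>i\<le>k. T i \<rho>)" if "\<rho> > 0" "\<forall>i\<in>{1..k}. \<rho> \<noteq> a i" for \<rho>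
  proof -
    have "(\<Sum>i\<le>k. T i \<rho>) = T 0 \<rho> + (\<Sum>i\<in>{1..k}. T i \<rho>)"
      by (simp add: atMost_atLeast0 sum.atLeast_Suc_atMost)
    also have "T 0 \<rho> = h 0 \<rho> / \<rho> powr (real n - \<alpha> 0)"
      using that by (simp add: T_def e_def a0 powr_minus_divide del: minus_diff_eq)
    also have "(\<Sum>i\<in>{1..k}. T i \<rho>) = (\<Sum>i=1..k. h i (\<rho> - a i) / \<bar>\<rho> - a i\<bar> powr (1 - \<alpha> i))"
      by (intro sum.cong refl) (simp add: T_def e_def powr_minus_divide del: minus_diff_eq)
    finally show ?thesis using phi_form[OF that] by simp
  qed
  \<comment> \<open>\<beta> is the midpoint between \<open>\<alpha> j\<close> and the critical
    order, n at the origin and 1 at a proper sphere. \<gamma> is the margin left: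
    \<open>\<bar>\<rho> - a j\<bar> powr (- \<beta>)\<close> times the polar weight of the remainder
    is of order \<gamma> - 1 near \<open>a j\<close>, hence integrable.\<close>
  define \<beta> where "\<beta> = (if j = 0 then (\<alpha> 0 + n) / 2 else (\<alpha> j + 1) / 2)"
  define \<gamma> where "\<gamma> = (if j = 0 then n - \<beta> else 1 - \<beta>)"
  have \<alpha>j: "0 < \<alpha> j" "\<alpha> j < \<beta>" and \<beta>: "0 < \<beta>" "\<beta> \<le> n" and \<gamma>: "0 < \<gamma>"
  proof -
    have "real n \<ge> 1" using n by simp
    have "0 < \<alpha> j \<and> \<alpha> j < \<beta> \<and> 0 < \<beta> \<and> \<beta> \<le> n \<and> 0 < \<gamma>"
    proof (cases "j = 0")
      case True
      then show ?thesis using alpha0 by (auto simp: \<beta>_def \<gamma>_def field_simps)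
    next
      case False
      then have "2 * \<beta> = \<alpha> j + 1" "\<gamma> = 1 - \<beta>" "0 < \<alpha> j" "\<alpha> j < 1"
        using alphai[of j] j by (auto simp: \<beta>_def \<gamma>_def)
      then show ?thesis using \<open>real n \<ge> 1\<close> by argo
    qed
    then show "0 < \<alpha> j" "\<alpha> j < \<beta>" "0 < \<beta>" "\<beta> \<le> n" "0 < \<gamma>" by auto
  qed
  have B0: "0 \<le> B" using K_bdd[of 0] by linarith
  \<comment> \<open>Boundedness serves for \<open>\<bar>s\<bar> \<le> 1\<close>, where the power is
    at least 1; beyond, \<beta> \<le> n weakens the decay of order n to order \<beta>.\<close>
  have K_beta: "\<bar>K s\<bar> \<le> max B C * \<bar>s\<bar> powr (- \<beta>)" if "s \<noteq> 0" for s
  proof (cases "\<bar>s\<bar> \<le> 1")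
    case True
    then have "1 \<le> \<bar>s\<bar> powr (- \<beta>)" using that \<beta> by (simp add: powr_minus_divide powr_le1)
    then have "B * 1 \<le> max B C * \<bar>s\<bar> powr (- \<beta>)" using B0 by (intro mult_mono) auto
    then show ?thesis using K_bdd[of s] by linarith
  next
    case False
    have "\<bar>K s\<bar> = \<bar>K \<bar>s\<bar>\<bar>" using K_even[of s] by (simp add: abs_if)
    also have "\<dots> \<le> C * \<bar>s\<bar> powr (- real n)" using that by (intro K_decay) simp
    also have "\<dots> \<le> max B C * \<bar>s\<bar> powr (- \<beta>)"
      using False \<beta> B0 by (intro mult_mono powr_mono) auto
    finally show ?thesis .
  qed
  \<comment> \<open>For j = 0 the polar weight combines with the singularity, (n - 1) + (\<alpha> 0
    - n) = \<alpha> 0 - 1, so nothing is left for \<open>w\<close>.\<close>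
  define w where "w = (\<lambda>\<rho>::real. if j = 0 then 1 else \<rho> ^ (n - 1))"
  \<comment> \<open>Restricting to positive radii keeps \<open>\<rho> - a j\<close> in the domain of
    \<open>h j\<close> and makes \<open>H\<close> one-sided at the origin.\<close>
  define U where "U = {a j - \<epsilon><..<a j + \<epsilon>} \<inter> {0<..}"
  have U[measurable]: "U \<in> sets borel" unfolding U_def by measurable
  define H where "H = (\<lambda>\<rho>. indicator U \<rho> * (w \<rho> * h j (\<rho> - a j)))"
  have w_cont: "continuous_on A w" for A
    unfolding w_def by (cases "j = 0") (auto intro!: continuous_intros)
  have H_meas[measurable]: "H \<in> borel_measurable borel"
  proof -
    have "continuous_on U (\<lambda>\<rho>. w \<rho> * h j (\<rho> - a j))"
    proof (intro continuous_on_mult w_cont continuous_on_compose2[OF \<epsilon>0(2)])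
      show "(\<lambda>\<rho>. \<rho> - a j) ` U \<subseteq> {- \<epsilon>0<..<\<epsilon>0} \<inter> {- a j..}" using \<epsilon>(2) by (auto simp: U_def)
    qed (intro continuous_intros)
    then have "(\<lambda>\<rho>. indicator U \<rho> *\<^sub>R (w \<rho> * h j (\<rho> - a j))) \<in> borel_measurable borel"
      by (rule borel_measurable_continuous_on_indicator[OF U])
    then show ?thesis by (simp add: H_def)
  qed
  define Q1 where "Q1 = (a j + 1) ^ (n - 1)"
  have Q1: "1 \<le> Q1" unfolding Q1_def using aj by (intro one_le_power) simp
  have U_pow: "\<rho> ^ (n - 1) \<le> Q1" "0 < \<rho>" if "\<rho> \<in> U" for \<rho>
    using that \<epsilon> unfolding Q1_def U_def by (auto intro!: power_mono)
  have H_bdd: "\<bar>H \<rho>\<bar> \<le> Q1 * bh j" for \<rho>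
  proof (cases "\<rho> \<in> U")
    case True
    have "\<bar>w \<rho>\<bar> \<le> Q1" using U_pow[OF True] Q1 by (auto simp: w_def)
    moreover have "\<bar>h j (\<rho> - a j)\<bar> \<le> bh j" using U_pow(2)[OF True] j by (intro bh) auto
    ultimately show ?thesis using True Q1 by (auto simp: H_def abs_mult intro!: mult_mono)
  next
    case False
    then show ?thesis using Q1 bh0[OF j] by (simp add: H_def)
  qed
  define \<psi> where "\<psi> = (\<lambda>\<rho>. indicator {0..} \<rho> * (\<rho> ^ (n - 1) * \<phi> \<rho>))"
  have [measurable]: "\<psi> \<in> borel_measurable borel" unfolding \<psi>_def by measurable
  have \<psi>_int: "integrable lborel \<psi>"
  proof -
    have "integrable lborel (\<lambda>\<rho>. indicator {0..} \<rho> * (S * \<rho> ^ (n - 1)) * \<phi> \<rho>)"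
      using phi_L1 unfolding S_def n_def by (subst (asm) radial_integral(1)) auto
    then have "integrable lborel (\<lambda>\<rho>. (1 / S) * (indicator {0..} \<rho> * (S * \<rho> ^ (n - 1)) * \<phi> \<rho>))"
      by (rule integrable_mult_right)
    then show ?thesis using S by (simp add: \<psi>_def mult.assoc)
  qed
  \<comment> \<open>Taken as a difference, so that measurability comes from \<phi> and from
    \<open>h j\<close> near 0; the other \<open>h i\<close> enter only through bounds.\<close>
  define R where "R = (\<lambda>\<rho>. \<psi> \<rho> - \<bar>\<rho> - a j\<bar> powr (\<alpha> j - 1) * H \<rho>)"
  have R_meas: "R \<in> borel_measurable borel" unfolding R_def by measurable
  define Q where "Q = (\<Sum>i\<in>{..k} - {j}. bh i * \<epsilon> powr (- e i))"
  have Q0: "0 \<le> Q" unfolding Q_def using bh0 by (intro sum_nonneg) auto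
  have R_near: "\<bar>R \<rho>\<bar> \<le> \<rho> ^ (n - 1) * Q" if \<rho>: "\<rho> \<in> U" "\<rho> \<noteq> a j" for \<rho>
  proof -
    have pos: "0 < \<rho>" and near: "\<bar>\<rho> - a j\<bar> < \<epsilon>" using \<rho> by (auto simp: U_def)
    have "\<forall>i\<in>{1..k}. \<rho> \<noteq> a i"
    proof
      fix i assume "i \<in> {1..k}"
      then show "\<rho> \<noteq> a i" using far[of i \<rho>] near \<epsilon>(1) \<rho>(2) by (cases "i = j") auto
    qed
    then have "\<psi> \<rho> = \<rho> ^ (n - 1) * (\<Sum>i\<le>k. T i \<rho>)"
      using pos phi_sum by (simp add: \<psi>_def)
    also have "(\<Sum>i\<le>k. T i \<rho>) = T j \<rho> + (\<Sum>i\<in>{..k} - {j}. T i \<rho>)"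
      using j by (intro sum.remove) auto
    finally have \<psi>eq: "\<psi> \<rho> = \<rho> ^ (n - 1) * T j \<rho> + \<rho> ^ (n - 1) * (\<Sum>i\<in>{..k} - {j}. T i \<rho>)"
      by (simp add: distrib_left)
    have "\<rho> ^ (n - 1) * T j \<rho> = \<bar>\<rho> - a j\<bar> powr (\<alpha> j - 1) * H \<rho>"
    proof (cases "j = 0")
      case True
      have "\<rho> ^ (n - 1) = \<rho> powr (real n - 1)"
        using pos n by (simp add: powr_realpow[symmetric] of_nat_diff)
      then have "\<rho> ^ (n - 1) * \<rho> powr (\<alpha> 0 - real n) = \<rho> powr (\<alpha> 0 - 1)"
        by (simp add: powr_add[symmetric])
      then show ?thesis using True pos \<rho> by (simp add: T_def e_def H_def w_def a0 mult.left_commute)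
    next
      case False
      then show ?thesis using \<rho> by (simp add: T_def e_def H_def w_def)
    qed
    then have "R \<rho> = \<rho> ^ (n - 1) * (\<Sum>i\<in>{..k} - {j}. T i \<rho>)" by (simp add: R_def \<psi>eq)
    then have "\<bar>R \<rho>\<bar> = \<rho> ^ (n - 1) * \<bar>\<Sum>i\<in>{..k} - {j}. T i \<rho>\<bar>" using pos by (simp add: abs_mult)
    also have "\<bar>\<Sum>i\<in>{..k} - {j}. T i \<rho>\<bar> \<le> Q"
      unfolding Q_def
    proof (rule order_trans[OF sum_abs], rule sum_mono)
      fix i assume i: "i \<in> {..k} - {j}"
      then have "\<epsilon> \<le> \<bar>\<rho> - a i\<bar>" using far near by auto
      then have "\<bar>\<rho> - a i\<bar> powr (- e i) \<le> \<epsilon> powr (- e i)"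
        using \<epsilon>(1) e[of i] i by (intro powr_mono2') auto
      moreover have "\<bar>h i (\<rho> - a i)\<bar> \<le> bh i" using i pos by (intro bh) auto
      ultimately show "\<bar>T i \<rho>\<bar> \<le> bh i * \<epsilon> powr (- e i)"
        unfolding T_def using bh0[of i] i by (auto simp: abs_mult intro!: mult_mono)
    qed
    finally show ?thesis using pos by (simp add: mult_left_mono)
  qed
  have R_int: "integrable lborel (\<lambda>\<rho>. \<bar>\<rho> - a j\<bar> powr (- \<beta>) * R \<rho>)"
  proof (rule Bochner_Integration.integrable_bound)
    \<comment> \<open>The first term serves the window \<open>U\<close>, the second the other
      positive radii, which are at least \<epsilon> away from \<open>a j\<close> and where
      \<open>R\<close> is \<psi>. At negative radii \<open>R\<close> vanishes.\<close>
    let ?d = "\<lambda>\<rho>. Q * Q1 * (indicator {-1..1} (\<rho> - a j) * \<bar>\<rho> - a j\<bar> powr (\<gamma> - 1)) + \<epsilon> powr (- \<beta>) * \<bar>\<psi> \<rho>\<bar>"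
    have "integrable lborel (\<lambda>\<rho>. indicator {-1..1} (\<rho> - a j) * \<bar>\<rho> - a j\<bar> powr (\<gamma> - 1))"
      using lborel_integrable_real_affine[OF integrable_abs_powr_near_0[OF \<gamma>], of 1 "- a j"] by simp
    then show "integrable lborel ?d"
      by (intro Bochner_Integration.integrable_add integrable_mult_right integrable_abs \<psi>_int)
    have dom: "\<bar>\<rho> - a j\<bar> powr (- \<beta>) * \<bar>R \<rho>\<bar> \<le> ?d \<rho>" if "\<rho> \<noteq> a j" "\<rho> \<noteq> 0" for \<rho>
    proof (cases "\<rho> \<in> U")
      case True
      have pos: "0 < \<rho>" by (rule U_pow(2)[OF True])
      have in1: "\<rho> - a j \<in> {-1..1}" using True \<epsilon>(3) by (auto simp: U_def)
      have "\<bar>\<rho> - a j\<bar> powr (- \<beta>) * \<rho> ^ (n - 1) \<le> Q1 * \<bar>\<rho> - a j\<bar> powr (\<gamma> - 1)"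
      proof (cases "j = 0")
        case True
        have "\<rho> ^ (n - 1) = \<rho> powr (real n - 1)"
          using pos n by (simp add: powr_realpow[symmetric] of_nat_diff)
        then have "\<bar>\<rho> - a j\<bar> powr (- \<beta>) * \<rho> ^ (n - 1) = 1 * \<bar>\<rho> - a j\<bar> powr (\<gamma> - 1)"
          using True pos by (simp add: a0 \<gamma>_def powr_add[symmetric] algebra_simps)
        also have "\<dots> \<le> Q1 * \<bar>\<rho> - a j\<bar> powr (\<gamma> - 1)" using Q1 by (intro mult_right_mono) auto
        finally show ?thesis .
      next
        case False
        then show ?thesis using U_pow(1)[OF True] by (simp add: \<gamma>_def mult.commute mult_right_mono)
      qed
      then have "\<bar>\<rho> - a j\<bar> powr (- \<beta>) * \<rho> ^ (n - 1) * Q \<le> Q1 * \<bar>\<rho> - a j\<bar> powr (\<gamma> - 1) * Q"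
        using Q0 by (rule mult_right_mono)
      moreover have "\<bar>\<rho> - a j\<bar> powr (- \<beta>) * \<bar>R \<rho>\<bar> \<le> \<bar>\<rho> - a j\<bar> powr (- \<beta>) * (\<rho> ^ (n - 1) * Q)"
        using R_near[OF True that(1)] by (rule mult_left_mono) simp
      moreover have "0 \<le> \<epsilon> powr (- \<beta>) * \<bar>\<psi> \<rho>\<bar>" by simp
      moreover have "?d \<rho> = Q1 * \<bar>\<rho> - a j\<bar> powr (\<gamma> - 1) * Q + \<epsilon> powr (- \<beta>) * \<bar>\<psi> \<rho>\<bar>"
        using in1 by (simp add: mult.commute mult.left_commute)
      ultimately show ?thesis by (simp only: mult.assoc)
    next
      case False
      then have R: "R \<rho> = \<psi> \<rho>" by (simp add: R_def H_def)
      have nn: "0 \<le> Q * Q1 * (indicator {-1..1} (\<rho> - a j) * \<bar>\<rho> - a j\<bar> powr (\<gamma> - 1))"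
        using Q0 Q1 by simp
      show ?thesis
      proof (cases "\<rho> > 0")
        case True
        then have "\<epsilon> \<le> \<bar>\<rho> - a j\<bar>" using False by (auto simp: U_def abs_if split: if_splits)
        then have "\<bar>\<rho> - a j\<bar> powr (- \<beta>) \<le> \<epsilon> powr (- \<beta>)" using \<epsilon>(1) \<beta> by (intro powr_mono2') auto
        then have "\<bar>\<rho> - a j\<bar> powr (- \<beta>) * \<bar>R \<rho>\<bar> \<le> \<epsilon> powr (- \<beta>) * \<bar>\<psi> \<rho>\<bar>"
          unfolding R by (rule mult_right_mono) simp
        then show ?thesis using nn by linarith
      next
        case False
        then have "\<psi> \<rho> = 0" using that by (simp add: \<psi>_def)
        then show ?thesis using nn R by simp
      qed
    qed
    show "AE \<rho> in lborel. norm (\<bar>\<rho> - a j\<bar> powr (- \<beta>) * R \<rho>) \<le> norm (?d \<rho>)"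
      using AE_lborel_singleton[of "a j"] AE_lborel_singleton[of "0::real"]
    proof eventually_elim
      case (elim \<rho>)
      have "norm (\<bar>\<rho> - a j\<bar> powr (- \<beta>) * R \<rho>) = \<bar>\<rho> - a j\<bar> powr (- \<beta>) * \<bar>R \<rho>\<bar>" by (simp add: abs_mult)
      also have "\<dots> \<le> ?d \<rho>" using elim by (intro dom) auto
      also have "\<dots> \<le> norm (?d \<rho>)" by (simp only: real_norm_def abs_ge_self)
      finally show ?case .
    qed
  qed (use R_meas in measurable)
  \<comment> \<open>For j = 0 a negative v corresponds to a negative radius, where \<open>H\<close>
    is 0.\<close>
  define L where "L = (\<lambda>v::real. if j = 0 then indicator {0<..} v * h 0 0 else a j ^ (n - 1) * h j 0)"
  have L_meas: "L \<in> borel_measurable borel" unfolding L_def by (cases "j = 0") auto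
  have lim: "((\<lambda>r. H (a j + v / r)) \<longlongrightarrow> L v) at_top" if "v \<noteq> 0" for v
  proof (cases "j = 0 \<and> v < 0")
    case True
    have "\<forall>\<^sub>F r in at_top. H (a j + v / r) = L v"
      using eventually_gt_at_top[of 0]
      by eventually_elim (use True in \<open>auto simp: H_def L_def U_def a0 indicator_def divide_neg_pos not_less less_imp_le\<close>)
    then show ?thesis by (rule tendsto_eventually)
  next
    case False
    have v0: "((\<lambda>r. v / r) \<longlongrightarrow> 0) at_top"
      by (rule tendsto_divide_0[OF tendsto_const]) (simp add: filterlim_at_top_imp_at_infinity filterlim_ident)
    then have va: "((\<lambda>r. a j + v / r) \<longlongrightarrow> a j) at_top"
      using tendsto_add[OF tendsto_const v0, of "a j"] by simp
    have "\<forall>\<^sub>F r in at_top. a j + v / r > 0"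
    proof (cases "j = 0")
      case True
      then have "v > 0" using False that by auto
      show ?thesis using eventually_gt_at_top[of 0] by eventually_elim (use True \<open>v > 0\<close> in \<open>simp add: a0\<close>)
    next
      case False
      then show ?thesis using order_tendstoD(1)[OF va] aj by simp
    qed
    moreover have "\<forall>\<^sub>F r in at_top. a j + v / r < a j + \<epsilon>"
      by (rule order_tendstoD(2)[OF va]) (use \<epsilon>(1) in simp)
    moreover have "\<forall>\<^sub>F r in at_top. a j + v / r > a j - \<epsilon>"
      by (rule order_tendstoD(1)[OF va]) (use \<epsilon>(1) in simp)
    ultimately have evU: "\<forall>\<^sub>F r in at_top. a j + v / r \<in> U"
      by eventually_elim (simp add: U_def)
    have "((\<lambda>r. h j (v / r)) \<longlongrightarrow> h j 0) at_top"
    proof (rule continuous_on_tendsto_compose[OF \<epsilon>0(2) v0])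
      show "\<forall>\<^sub>F r in at_top. v / r \<in> {- \<epsilon>0<..<\<epsilon>0} \<inter> {- a j..}"
        using evU by eventually_elim (use \<epsilon>(2) in \<open>auto simp: U_def\<close>)
    qed (use \<epsilon>0 aj in auto)
    moreover have "((\<lambda>r. w (a j + v / r)) \<longlongrightarrow> w (a j)) at_top"
      by (rule continuous_on_tendsto_compose[OF w_cont[of UNIV] va]) auto
    ultimately have "((\<lambda>r. w (a j + v / r) * h j (v / r)) \<longlongrightarrow> w (a j) * h j 0) at_top"
      by (intro tendsto_mult)
    moreover have "w (a j) * h j 0 = L v"
      using False that by (auto simp: w_def L_def)
    ultimately have "((\<lambda>r. w (a j + v / r) * h j (v / r)) \<longlongrightarrow> L v) at_top" by simp
    then show ?thesis
      by (rule Lim_transform_eventually) (use evU in \<open>eventually_elim, simp add: H_def\<close>)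
  qed
  have "((\<lambda>r. r powr \<alpha> j * (LINT \<rho>|lborel. K (r * (\<rho> - a j)) * (\<bar>\<rho> - a j\<bar> powr (\<alpha> j - 1) * H \<rho> + R \<rho>)))
     \<longlongrightarrow> (LINT v|lborel. K v * \<bar>v\<bar> powr (\<alpha> j - 1) * L v)) at_top"
    by (rule concentration_limit[OF K K_bdd K_beta \<alpha>j H_meas H_bdd R_meas R_int L_meas lim])
  then have "((\<lambda>r. r powr \<alpha> j * (LINT \<rho>|lborel. K (r * (\<rho> - a j)) * \<psi> \<rho>))
     \<longlongrightarrow> (LINT v|lborel. K v * \<bar>v\<bar> powr (\<alpha> j - 1) * L v)) at_top"
    by (simp add: R_def)
  then have lim': "((\<lambda>r. S * (r powr \<alpha> j * (LINT \<rho>|lborel. K (r * (\<rho> - a j)) * \<psi> \<rho>)))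
     \<longlongrightarrow> S * (LINT v|lborel. K v * \<bar>v\<bar> powr (\<alpha> j - 1) * L v)) at_top"
    by (intro tendsto_mult tendsto_const)
  have lhs: "(LINT l|lborel. K (r * (norm (l::'n) - a j)) * \<phi> (norm l)) = S * (LINT \<rho>|lborel. K (r * (\<rho> - a j)) * \<psi> \<rho>)" for r
  proof -
    have "(LINT l|lborel. K (r * (norm (l::'n) - a j)) * \<phi> (norm l)) =
       (LINT \<rho>|lborel. indicator {0..} \<rho> * (S * \<rho> ^ (n - 1)) * (K (r * (\<rho> - a j)) * \<phi> \<rho>))"
      unfolding S_def n_def by (rule radial_integral(2)) simp
    also have "\<dots> = (LINT \<rho>|lborel. S * (K (r * (\<rho> - a j)) * \<psi> \<rho>))"
      by (simp add: \<psi>_def ac_simps)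
    finally show ?thesis by simp
  qed
  \<comment> \<open>The half-line integral to which both the limit just found and the claimed one
    reduce.\<close>
  define I0 where "I0 = (LINT \<rho>|lborel. indicator {0..} \<rho> * (K \<rho> * \<bar>\<rho>\<bar> powr (\<alpha> j - 1)))"
  have rhs: "(LINT u|lborel. K (norm (u::'n)) * norm u powr (\<alpha> j - real n)) = S * I0"
  proof -
    have "(LINT u|lborel. K (norm (u::'n)) * norm u powr (\<alpha> j - real n)) =
       (LINT \<rho>|lborel. indicator {0..} \<rho> * (S * \<rho> ^ (n - 1)) * (K \<rho> * \<rho> powr (\<alpha> j - real n)))"
      unfolding S_def n_def by (rule radial_integral(2)) simp
    also have "\<dots> = (LINT \<rho>|lborel. S * (indicator {0..} \<rho> * (K \<rho> * \<bar>\<rho>\<bar> powr (\<alpha> j - 1))))"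
    proof (rule integral_cong_AE)
      show "AE \<rho> in lborel. indicator {0..} \<rho> * (S * \<rho> ^ (n - 1)) * (K \<rho> * \<rho> powr (\<alpha> j - real n)) = S * (indicator {0..} \<rho> * (K \<rho> * \<bar>\<rho>\<bar> powr (\<alpha> j - 1)))"
        using AE_lborel_singleton[of "0::real"]
      proof eventually_elim
        case (elim \<rho>)
        show ?case
        proof (cases "\<rho> > 0")
          case True
          have "\<rho> ^ (n - 1) = \<rho> powr (real n - 1)"
            using True n by (simp add: powr_realpow[symmetric] of_nat_diff)
          then have "\<rho> ^ (n - 1) * \<rho> powr (\<alpha> j - real n) = \<rho> powr (\<alpha> j - 1)"
            by (simp add: powr_add[symmetric])
          then show ?thesis using True by (simp add: mult.left_commute mult.assoc)
        qed (use elim in simp)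
      qed
    qed measurable
    finally show ?thesis by (simp add: I0_def)
  qed
  have "(LINT v|lborel. K v * \<bar>v\<bar> powr (\<alpha> j - 1) * L v) = (if j = 0 then 1 else 2 * a j ^ (n - 1)) * h j 0 * I0"
  proof (cases "j = 0")
    case True
    have "(LINT v|lborel. K v * \<bar>v\<bar> powr (\<alpha> j - 1) * L v) = (LINT v|lborel. h 0 0 * (indicator {0..} v * (K v * \<bar>v\<bar> powr (\<alpha> j - 1))))"
    proof (rule integral_cong_AE)
      show "AE v in lborel. K v * \<bar>v\<bar> powr (\<alpha> j - 1) * L v = h 0 0 * (indicator {0..} v * (K v * \<bar>v\<bar> powr (\<alpha> j - 1)))"
        using AE_lborel_singleton[of "0::real"] by eventually_elim (auto simp: L_def True indicator_def)
    qed (use L_meas in measurable)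
    then show ?thesis using True by (simp add: I0_def)
  next
    case False
    \<comment> \<open>Both sides of the sphere count here, and evenness of \<open>K\<close> doubles
      the half-line integral: the origin of the factor 2 in A.\<close>
    have iK: "integrable lborel (\<lambda>v. K v * \<bar>v\<bar> powr (\<alpha> j - 1))"
      by (rule integrable_abs_powr_decay[OF K K_bdd K_beta \<alpha>j])
    have "integrable lborel (\<lambda>v. indicator {0..} v *\<^sub>R (K v * \<bar>v\<bar> powr (\<alpha> j - 1)))"
      by (rule Bochner_Integration.integrable_bound[OF iK]) (auto simp: indicator_def)
    then have "has_bochner_integral lborel (\<lambda>v. indicator {0..} v *\<^sub>R (K v * \<bar>v\<bar> powr (\<alpha> j - 1))) I0"
      by (simp add: has_bochner_integral_iff I0_def)
    from has_bochner_integral_even_function[OF this] 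
    have "(LINT v|lborel. K v * \<bar>v\<bar> powr (\<alpha> j - 1)) = 2 * I0"
      by (simp add: K_even has_bochner_integral_iff)
    then show ?thesis using False by (simp add: L_def)
  qed
  then show ?thesis
    using lim' unfolding lhs rhs by (simp add: ac_simps)
qed

section \<open>Convergence of the finite-dimensional distributions\<close>

text \<open>This yields square integrability of the limit kernels. In polar coordinates the power
  becomes \<alpha> - 1, and decay of order n suffices at infinity because \<alpha> < n.\<close>

lemma integrable_radial_powr:
  fixes K :: "real \<Rightarrow> real"
  assumes K[measurable]: "K \<in> borel_measurable borel"
    and K_even: "\<And>s. K (- s) = K s" and B: "\<And>s. \<bar>K s\<bar> \<le> B"
    and C: "\<And>s. s > 0 \<Longrightarrow> \<bar>K s\<bar> \<le> C * s powr (- real DIM('n::euclidean_space))"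
    and \<alpha>: "0 < \<alpha>" "\<alpha> < real DIM('n)"
  shows "integrable lborel (\<lambda>u::'n. K (norm u) * norm u powr (\<alpha> - real DIM('n)))"
proof -
  let ?n = "DIM('n)"
  define S where "S = 2 * sqrt pi ^ ?n / Gamma (?n / 2)"
  have C': "\<bar>K s\<bar> \<le> C * \<bar>s\<bar> powr (- real ?n)" if "s \<noteq> 0" for s
    using C[of "\<bar>s\<bar>"] K_even[of s] that by (cases "s > 0") (auto simp: abs_if)
  have iK: "integrable lborel (\<lambda>v. K v * \<bar>v\<bar> powr (\<alpha> - 1))"
    by (rule integrable_abs_powr_decay[OF K B C' \<alpha>])
  have "integrable lborel (\<lambda>\<rho>. indicator {0..} \<rho> * (K \<rho> * \<bar>\<rho>\<bar> powr (\<alpha> - 1)))"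
    by (rule Bochner_Integration.integrable_bound[OF iK]) (auto simp: indicator_def)
  then have "integrable lborel (\<lambda>\<rho>. S * (indicator {0..} \<rho> * (K \<rho> * \<bar>\<rho>\<bar> powr (\<alpha> - 1))))"
    by (rule integrable_mult_right)
  moreover have eq: "AE \<rho> in lborel. S * (indicator {0..} \<rho> * (K \<rho> * \<bar>\<rho>\<bar> powr (\<alpha> - 1))) =
      indicator {0..} \<rho> * (S * \<rho> ^ (?n - 1)) * (K \<rho> * \<rho> powr (\<alpha> - real ?n))"
    using AE_lborel_singleton[of "0::real"]
  proof eventually_elim
    case (elim \<rho>)
    show ?case
    proof (cases "\<rho> > 0")
      case True
      have "\<rho> ^ (?n - 1) = \<rho> powr (real ?n - 1)"
        using True by (simp add: powr_realpow[symmetric] of_nat_diff Suc_leI)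
      then have "\<rho> ^ (?n - 1) * \<rho> powr (\<alpha> - real ?n) = \<rho> powr (\<alpha> - 1)"
        by (simp add: powr_add[symmetric])
      then show ?thesis using True by (simp add: mult.left_commute mult.assoc)
    qed (use elim in simp)
  qed
  ultimately have "integrable lborel (\<lambda>\<rho>. indicator {0..} \<rho> * (S * \<rho> ^ (?n - 1)) * (K \<rho> * \<rho> powr (\<alpha> - real ?n)))"
    by (subst integrable_cong_AE[OF _ _ eq, symmetric]) measurable
  then show ?thesis
    unfolding S_def by (subst radial_integral(1)) auto
qed

lemma square_integrable_lincomb:
  fixes f g :: "'a::euclidean_space \<Rightarrow> real"
  assumes "square_integrable f" "square_integrable g"
  shows "square_integrable (\<lambda>u. a * f u + b * g u)"
proof -
  have [measurable]: "f \<in> borel_measurable borel" "g \<in> borel_measurable borel"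
    and i: "integrable lborel (\<lambda>u. (f u)\<^sup>2)" "integrable lborel (\<lambda>u. (g u)\<^sup>2)"
    using assms by (auto simp: square_integrable_def)
  have "integrable lborel (\<lambda>u. (2 * a\<^sup>2) * (f u)\<^sup>2 + (2 * b\<^sup>2) * (g u)\<^sup>2)"
    by (intro Bochner_Integration.integrable_add integrable_mult_right i)
  then have "integrable lborel (\<lambda>u. (a * f u + b * g u)\<^sup>2)"
  proof (rule Bochner_Integration.integrable_bound)
    have "(x + y)\<^sup>2 \<le> 2 * x\<^sup>2 + 2 * y\<^sup>2" for x y :: real
      using zero_le_power2[of "x - y"] by (simp add: power2_diff power2_sum)
    from this[of "a * f _" "b * g _"]
    show "AE u in lborel. norm ((a * f u + b * g u)\<^sup>2) \<le> norm ((2 * a\<^sup>2) * (f u)\<^sup>2 + (2 * b\<^sup>2) * (g u)\<^sup>2)"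
      by (intro AE_I2) (simp add: power_mult_distrib mult.assoc)
  qed measurable
  then show ?thesis by (simp add: square_integrable_def)
qed

text \<open>The induction starts from the integral of the zero function, which vanishes almost
  surely because its variance is 0.\<close>

lemma white_noise_integral_sum:
  fixes f :: "'i \<Rightarrow> 'a::euclidean_space \<Rightarrow> real"
  assumes Z: "white_noise_integral N I" and "finite S" and f: "\<And>i. i \<in> S \<Longrightarrow> square_integrable (f i)"
  shows "square_integrable (\<lambda>u. \<Sum>i\<in>S. c i * f i u) \<and>
     (AE \<omega> in N. I (\<lambda>u. \<Sum>i\<in>S. c i * f i u) \<omega> = (\<Sum>i\<in>S. c i * I (f i) \<omega>))"
  using \<open>finite S\<close> f
proof (induction S rule: finite_induct)
  case empty
  have sq: "square_integrable (\<lambda>u::'a. 0)" by (simp add: square_integrable_def)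
  then have "centered_gaussian_rv N (I (\<lambda>u. 0)) (LINT u|(lborel::'a measure). 0\<^sup>2)"
    using Z unfolding white_noise_integral_def by blast
  then show ?case using sq by (simp add: centered_gaussian_rv_def)
next
  case (insert i S)
  then have IH: "square_integrable (\<lambda>u. \<Sum>i\<in>S. c i * f i u)"
    "AE \<omega> in N. I (\<lambda>u. \<Sum>i\<in>S. c i * f i u) \<omega> = (\<Sum>i\<in>S. c i * I (f i) \<omega>)"
    and fi: "square_integrable (f i)" by auto
  have eq: "(\<lambda>u. \<Sum>i\<in>insert i S. c i * f i u) = (\<lambda>u. c i * f i u + 1 * (\<Sum>i\<in>S. c i * f i u))"
    using insert by simp
  have "AE \<omega> in N. I (\<lambda>u. c i * f i u + 1 * (\<Sum>i\<in>S. c i * f i u)) \<omega> = c i * I (f i) \<omega> + 1 * I (\<lambda>u. \<Sum>i\<in>S. c i * f i u) \<omega>"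
    using Z fi IH(1) unfolding white_noise_integral_def by blast
  with IH(2) have "AE \<omega> in N. I (\<lambda>u. c i * f i u + 1 * (\<Sum>i\<in>S. c i * f i u)) \<omega> = (\<Sum>i\<in>insert i S. c i * I (f i) \<omega>)"
    by eventually_elim (use insert in simp)
  then show ?case
    unfolding eq using square_integrable_lincomb[OF fi IH(1)] by blast
qed

text \<open>The continuity theorem is sequential, so the limit is tested along sequences tending to
  infinity; an initial segment is dropped because the laws are controlled for positive r
  only.\<close>

lemma weak_conv_along_at_topI:
  fixes \<mu> :: "real \<Rightarrow> 'a::euclidean_space measure" and \<mu>0 :: "'a measure"
  assumes prob: "\<And>r. r > 0 \<Longrightarrow> prob_space (\<mu> r)" and sets: "\<And>r. r > 0 \<Longrightarrow> sets (\<mu> r) = sets borel"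
    and prob0: "prob_space \<mu>0" and sets0: "sets \<mu>0 = sets borel"
    and char: "\<And>u. ((\<lambda>r. LINT x|\<mu> r. cis (u \<bullet> x)) \<longlongrightarrow> (LINT x|\<mu>0. cis (u \<bullet> x))) at_top"
  shows "weak_conv_along \<mu> \<mu>0 at_top"
  unfolding weak_conv_along_def
proof (intro allI impI)
  fix f :: "'a \<Rightarrow> real" assume f: "continuous_on UNIV f" "bounded (range f)"
  show "((\<lambda>r. integral\<^sup>L (\<mu> r) f) \<longlongrightarrow> integral\<^sup>L \<mu>0 f) at_top"
  proof (rule tendsto_at_topI_sequentially)
    fix X :: "nat \<Rightarrow> real" assume X: "filterlim X at_top sequentially"
    then have "\<forall>\<^sub>F n in sequentially. X n > 0" by (simp add: filterlim_at_top_dense)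
    then obtain n0 where n0: "\<And>n. n \<ge> n0 \<Longrightarrow> X n > 0" by (auto simp: eventually_sequentially)
    have "(\<lambda>n. integral\<^sup>L (\<mu> (X (n + n0))) f) \<longlonglongrightarrow> integral\<^sup>L \<mu>0 f"
    proof (rule levy_continuity_euclidean[OF _ _ prob0 sets0 _ f])
      fix u
      show "(\<lambda>n. LINT x|\<mu> (X (n + n0)). cis (u \<bullet> x)) \<longlonglongrightarrow> (LINT x|\<mu>0. cis (u \<bullet> x))"
        using LIMSEQ_ignore_initial_segment[OF filterlim_compose[OF char X]] .
    qed (use n0 prob sets in auto)
    then show "(\<lambda>n. integral\<^sup>L (\<mu> (X n)) f) \<longlonglongrightarrow> integral\<^sup>L \<mu>0 f"
      by (rule LIMSEQ_offset)
  qed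
qed

lemma borel_measurable_vec_lambda:
  fixes f :: "'m::finite \<Rightarrow> 'w \<Rightarrow> real"
  assumes "\<And>i. f i \<in> borel_measurable M"
  shows "(\<lambda>\<omega>. (\<chi> i. f i \<omega>) :: real ^ 'm) \<in> borel_measurable M"
  unfolding borel_measurable_euclidean_space[of "\<lambda>\<omega>. (\<chi> i. f i \<omega>) :: real ^ 'm"]
  using assms by (auto simp: Basis_vec_def inner_axis)

theorem theorem1:
  fixes M :: "'w measure" and \<xi> :: "'n::euclidean_space \<Rightarrow> 'w \<Rightarrow> real"
    and k j :: nat and a \<alpha> :: "nat \<Rightarrow> real" and h :: "nat \<Rightarrow> real \<Rightarrow> real"
    and \<phi> :: "real \<Rightarrow> real"
    and f :: "real \<Rightarrow> 'n \<Rightarrow> real" and g :: "real \<Rightarrow> real"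
    and N :: "'v measure" and I :: "('n \<Rightarrow> real) \<Rightarrow> 'v \<Rightarrow> real"
  defines "n \<equiv> DIM('n)"
  assumes a0: "a 0 = 0" and a_mono: "\<And>i. i < k \<Longrightarrow> a i < a (Suc i)"
    and alpha0: "0 < \<alpha> 0" "\<alpha> 0 < real n"
    and alphai: "\<And>i. 1 \<le> i \<Longrightarrow> i \<le> k \<Longrightarrow> 0 < \<alpha> i \<and> \<alpha> i < 1"
    and h_nonneg: "\<And>i s. i \<le> k \<Longrightarrow> s \<ge> - a i \<Longrightarrow> h i s \<ge> 0"
    and h_bdd: "\<And>i. i \<le> k \<Longrightarrow> bounded (h i ` {- a i..})"
    and h_cont: "\<And>i. i \<le> k \<Longrightarrow> \<exists>\<epsilon>>0. continuous_on ({-\<epsilon><..<\<epsilon>} \<inter> {- a i..}) (h i)"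
    and h0: "\<And>i. i \<le> k \<Longrightarrow> h i 0 \<noteq> 0"
    and phi_form: "\<And>\<rho>. \<rho> > 0 \<Longrightarrow> (\<forall>i\<in>{1..k}. \<rho> \<noteq> a i) \<Longrightarrow>
        \<phi> \<rho> = h 0 \<rho> / \<rho> powr (real n - \<alpha> 0)
               + (\<Sum>i=1..k. h i (\<rho> - a i) / \<bar>\<rho> - a i\<bar> powr (1 - \<alpha> i))"
    and phi_L1: "integrable lborel (\<lambda>l::'n. \<phi> (norm l))"
    and phi_L1_radial: "set_integrable lborel {0..} (\<lambda>u. u ^ (n - 1) * \<phi> u)"
    and M: "prob_space M"
    and xi_meas: "(\<lambda>(x, \<omega>). \<xi> x \<omega>) \<in> borel_measurable (lborel \<Otimes>\<^sub>M M)"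
    and xi_gauss: "centered_gaussian_field M \<xi>"
    and xi_msc: "mean_square_continuous M \<xi>"
    and xi_cov: "\<And>x y. (LINT \<omega>|M. \<xi> x \<omega> * \<xi> y \<omega>) = iso_cov n \<phi> (dist x y)"
    and j: "j \<le> k"
    and f_radial: "\<And>r. r > 0 \<Longrightarrow> \<exists>F. \<forall>x. f r x = F (norm x)"
    and f_nonzero: "\<And>r. r > 0 \<Longrightarrow> emeasure lborel {x. f r x \<noteq> 0} > 0"
    and f_L1: "\<And>r. r > 0 \<Longrightarrow> integrable lborel (f r)"
    and f_L2: "\<And>r. r > 0 \<Longrightarrow> square_integrable (f r)"
    and f_fourier: "\<And>r l. r > 0 \<Longrightarrow>
        (LINT x|lborel. cis (l \<bullet> x) * complex_of_real (f r x)) / complex_of_real (r ^ n)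
          = complex_of_real (g (r * (norm l - a j)))"
    and g_even: "\<And>s. g (- s) = g s"
    and g_decay: "\<exists>s0 C. s0 \<ge> 0 \<and> C > 0 \<and> (\<forall>s. s \<ge> s0 \<and> s > 0 \<longrightarrow> (g s)\<^sup>2 \<le> C * s powr (- real n))"
    and Z: "white_noise_integral N I"
  shows "\<And>t :: 'm::finite \<Rightarrow> real. (\<forall>i. t i \<in> {0..1}) \<Longrightarrow>
    (let A = (if j = 0 then 1 else 2 * a j ^ (n - 1));
         X = (\<lambda>r s \<omega>. if s = 0 then 0 else
                1 / (sqrt (A * h j 0) * r powr (real n - \<alpha> j / 2)) *
                (LINT x|lborel. f (r * s powr (1 / real n)) x * \<xi> x \<omega>));
         Xlim = (\<lambda>s \<omega>. if s = 0 then 0 else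
                I (\<lambda>u. s * g (norm u * s powr (1 / real n)) / norm u powr ((real n - \<alpha> j) / 2)) \<omega>)
     in weak_conv_along (\<lambda>r. distr M borel (\<lambda>\<omega>. (\<chi> i. X r (t i) \<omega>) :: real ^ 'm))
          (distr N borel (\<lambda>\<omega>. (\<chi> i. Xlim (t i) \<omega>) :: real ^ 'm)) at_top)"
proof -
  fix t :: "'m::finite \<Rightarrow> real" assume t: "\<forall>i. t i \<in> {0..1}"
  interpret M: prob_space M by (rule M)
  interpret N: prob_space N using Z by (simp add: white_noise_integral_def)
  have n: "n \<ge> 1" unfolding n_def by (simp add: Suc_leI)
  \<comment> \<open>A unit vector lets radial statements be read along a ray.\<close>
  obtain e :: 'n where e: "norm e = 1" using norm_Basis SOME_Basis by blast

  \<comment> \<open>Integrability of \<open>\<phi> (norm l)\<close> gives measurability of \<phi> on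
    nonnegative arguments only. The even extension is measurable everywhere and changes neither the
    integrals over space nor \<open>iso_cov\<close>.\<close>
  define \<phi>' where "\<phi>' = (\<lambda>\<rho>. \<phi> \<bar>\<rho>\<bar>)"
  have \<phi>'_meas: "\<phi>' \<in> borel_measurable borel"
  proof -
    have "(\<lambda>l::'n. \<phi> (norm l)) \<in> borel_measurable borel" using phi_L1 by auto
    then have "(\<lambda>\<rho>. \<phi> (norm (\<rho> *\<^sub>R e))) \<in> borel_measurable borel"
      by (rule measurable_compose[rotated]) measurable
    then show ?thesis by (simp add: \<phi>'_def e)
  qed
  have \<phi>'_L1: "integrable lborel (\<lambda>l::'n. \<phi>' (norm l))" using phi_L1 by (simp add: \<phi>'_def)
  have "iso_cov n \<phi> r = iso_cov n \<phi>' r" for r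
    unfolding iso_cov_def by (rule arg_cong[where f="(*) _"], intro set_lebesgue_integral_cong) (auto simp: \<phi>'_def)
  then have cov': "(LINT \<omega>|M. \<xi> x \<omega> * \<xi> y \<omega>) = iso_cov DIM('n) \<phi>' (dist x y)" for x y
    using xi_cov by (simp add: n_def)
  have \<phi>'_form: "\<phi>' \<rho> = h 0 \<rho> / \<rho> powr (real DIM('n) - \<alpha> 0)
               + (\<Sum>i=1..k. h i (\<rho> - a i) / \<bar>\<rho> - a i\<bar> powr (1 - \<alpha> i))"
    if "\<rho> > 0" "\<forall>i\<in>{1..k}. \<rho> \<noteq> a i" for \<rho>
    using phi_form[OF that] that by (simp add: \<phi>'_def n_def)

  have a_pos: "0 < a i" if "0 < i" "i \<le> k" for i
    using that
  proof (induction i)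
    case (Suc i)
    then show ?case using a_mono[of i] a0 by (cases "i = 0") auto
  qed simp
  have aj: "0 \<le> a j" using a_pos[of j] a0 j by (cases "j = 0") auto
  have \<alpha>j: "0 < \<alpha> j" "\<alpha> j < real n"
  proof -
    have "real n \<ge> 1" using n by simp
    then have "0 < \<alpha> j \<and> \<alpha> j < real n"
    proof (cases "j = 0")
      case False
      then have "0 < \<alpha> j" "\<alpha> j < 1" using alphai[of j] j by auto
      then show ?thesis using \<open>real n \<ge> 1\<close> by linarith
    qed (use alpha0 in simp)
    then show "0 < \<alpha> j" "\<alpha> j < real n" by auto
  qed
  define A where "A = (if j = 0 then 1 else 2 * a j ^ (n - 1))"
  have A: "0 < A" using a_pos[of j] j by (auto simp: A_def)
  \<comment> \<open>As \<open>a j\<close> is nonnegative, 0 lies in the domain where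
    \<open>h j\<close> is nonnegative; being nonzero there, the value is positive and the
    normalisation makes sense.\<close>
  have hj: "0 < h j 0" using h_nonneg[OF j, of 0] h0[OF j] aj by force
  define q where "q = sqrt (A * h j 0)"
  have q: "0 < q" "q\<^sup>2 = A * h j 0" using A hj by (auto simp: q_def)

  \<comment> \<open>Measurability, boundedness and decay of \<open>g\<close>\<close>
  have f_ft: "(LINT x|lborel. cis (l \<bullet> x) * complex_of_real (f r x)) = complex_of_real (r ^ n * g (r * (norm l - a j)))"
    if "r > 0" for r l
    using f_fourier[OF that, of l] that by (simp add: field_simps)
  have f_meas: "f r \<in> borel_measurable borel" if "r > 0" for r
    using f_L1[OF that] by auto
  \<comment> \<open>At r = 1 the norms reach only arguments s \<ge> - a j. The absolute value and
    evenness express \<open>g\<close> everywhere through the transform of the integrable function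
    \<open>f 1\<close>, whence measurability and the bound \<open>Bg\<close>.\<close>
  have g_eq: "complex_of_real (g s) = (LINT x|lborel. cis (((\<bar>s\<bar> + a j) *\<^sub>R e) \<bullet> x) * complex_of_real (f 1 x))" for s
  proof -
    have "g \<bar>s\<bar> = g s" using g_even[of s] by (auto simp: abs_if)
    then show ?thesis
      using f_ft[of 1 "(\<bar>s\<bar> + a j) *\<^sub>R e"] aj by (simp add: e)
  qed
  have g_meas[measurable]: "g \<in> borel_measurable borel"
  proof -
    have [measurable]: "f 1 \<in> borel_measurable borel" by (rule f_meas) simp
    have "(\<lambda>s. Re (LINT x|lborel. cis (((\<bar>s\<bar> + a j) *\<^sub>R e) \<bullet> x) * complex_of_real (f 1 x))) \<in> borel_measurable borel"
      by measurable
    then show ?thesis by (simp only: g_eq[symmetric] Re_complex_of_real)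
  qed
  define Bg where "Bg = (LINT x|lborel. \<bar>f 1 x\<bar>)"
  have Bg: "\<bar>g s\<bar> \<le> Bg" for s
  proof -
    have "\<bar>g s\<bar> = norm (complex_of_real (g s))" by simp
    also have "\<dots> \<le> (LINT x|lborel. norm (cis (((\<bar>s\<bar> + a j) *\<^sub>R e) \<bullet> x) * complex_of_real (f 1 x)))"
      unfolding g_eq by (rule integral_norm_bound)
    also have "\<dots> = Bg" by (simp add: Bg_def norm_mult)
    finally show ?thesis .
  qed
  obtain D where D: "\<And>s. s > 0 \<Longrightarrow> \<bar>g s\<bar> \<le> D * s powr (- real n / 2)"
  proof -
    obtain s0 C where s0: "s0 \<ge> 0" "C > 0" "\<And>s. s \<ge> s0 \<Longrightarrow> s > 0 \<Longrightarrow> (g s)\<^sup>2 \<le> C * s powr (- real n)"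
      using g_decay by blast
    \<comment> \<open>The second entry covers 0 < s < s0, where
      \<open>\<bar>g s\<bar> \<le> Bg\<close> and \<open>((s0 + 1) / s) powr (n / 2)\<close> is at
      least 1. The decay thus holds for all positive s.\<close>
    define D where "D = max (sqrt C) (Bg * (s0 + 1) powr (real n / 2))"
    have Bg0: "0 \<le> Bg" using Bg[of 0] by linarith
    show thesis
    proof (rule that)
      fix s :: real assume s: "s > 0"
      show "\<bar>g s\<bar> \<le> D * s powr (- real n / 2)"
      proof (cases "s \<ge> s0")
        case True
        have "\<bar>g s\<bar> = sqrt ((g s)\<^sup>2)" by simp
        also have "\<dots> \<le> sqrt (C * s powr (- real n))" using s0(3)[OF True s] by (rule real_sqrt_le_mono)
        also have "\<dots> = sqrt C * s powr (- real n / 2)"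
          using s by (simp add: real_sqrt_mult powr_half_sqrt[symmetric] powr_powr)
        also have "\<dots> \<le> D * s powr (- real n / 2)" by (intro mult_right_mono) (auto simp: D_def)
        finally show ?thesis .
      next
        case False
        have "1 \<le> ((s0 + 1) / s) powr (real n / 2)"
          using False s by (intro ge_one_powr_ge_zero) auto
        also have "\<dots> = (s0 + 1) powr (real n / 2) * s powr (- real n / 2)"
          using s s0(1) by (simp add: powr_divide powr_minus_divide)
        finally have "Bg * 1 \<le> Bg * ((s0 + 1) powr (real n / 2) * s powr (- real n / 2))"
          using Bg0 by (rule mult_left_mono)
        also have "\<dots> \<le> D * s powr (- real n / 2)"
          unfolding mult.assoc[symmetric] by (intro mult_right_mono) (auto simp: D_def)
        finally show ?thesis using Bg[of s] by linarith
      qed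
    qed
  qed

  \<comment> \<open>The kernel of a linear combination\<close>
  define \<tau> where "\<tau> = (\<lambda>i. t i powr (1 / real n))"
  have t01: "0 \<le> t i" for i using t by simp
  \<comment> \<open>The transform of \<open>f (r * \<tau> i)\<close> carries
    \<open>(r * \<tau> i) ^ n\<close>; this identity makes it the source of the factor t in the
    limit process.\<close>
  have \<tau>n: "\<tau> i ^ n = t i" for i
    using t01[of i] n by (cases "t i = 0") (auto simp: \<tau>_def powr_powr powr_realpow[symmetric])
  \<comment> \<open>Up to the factor \<open>r powr (\<alpha> j / 2) / q\<close>, \<open>G c\<close>
    at the argument \<open>r * (norm l - a j)\<close> is the transform of the normalised
    combination. Its square \<open>K c\<close> also gives the squared kernel of the limit, so a
    single spectral limit connects the two variances.\<close>
  define G where "G = (\<lambda>(c::'m \<Rightarrow> real) s. \<Sum>i\<in>UNIV. c i * (t i * g (s * \<tau> i)))"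
  define K where "K = (\<lambda>c s. (G c s)\<^sup>2)"
  have K_meas: "K c \<in> borel_measurable borel" for c unfolding K_def G_def by measurable
  have K_even: "K c (- s) = K c s" for c s by (simp add: K_def G_def g_even)
  have K_bdd: "\<bar>K c s\<bar> \<le> (\<Sum>i\<in>UNIV. \<bar>c i\<bar> * (t i * Bg))\<^sup>2" for c s
  proof -
    have "\<bar>G c s\<bar> \<le> (\<Sum>i\<in>UNIV. \<bar>c i * (t i * g (s * \<tau> i))\<bar>)" unfolding G_def by (rule sum_abs)
    also have "\<dots> \<le> (\<Sum>i\<in>UNIV. \<bar>c i\<bar> * (t i * Bg))"
      using Bg t01 by (intro sum_mono) (auto simp: abs_mult intro!: mult_left_mono)
    finally show ?thesis unfolding K_def by (simp add: abs_le_square_iff[symmetric])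
  qed
  define E where "E = (\<lambda>c. \<Sum>i\<in>UNIV. \<bar>c i\<bar> * (t i * (D * \<tau> i powr (- real n / 2))))"
  have K_decay: "\<bar>K c s\<bar> \<le> (E c)\<^sup>2 * s powr (- real n)" if s: "s > 0" for c s
  proof -
    have "\<bar>G c s\<bar> \<le> (\<Sum>i\<in>UNIV. \<bar>c i * (t i * g (s * \<tau> i))\<bar>)" unfolding G_def by (rule sum_abs)
    also have "\<dots> \<le> (\<Sum>i\<in>UNIV. \<bar>c i\<bar> * (t i * (D * \<tau> i powr (- real n / 2))) * s powr (- real n / 2))"
    proof (rule sum_mono)
      fix i
      show "\<bar>c i * (t i * g (s * \<tau> i))\<bar> \<le> \<bar>c i\<bar> * (t i * (D * \<tau> i powr (- real n / 2))) * s powr (- real n / 2)"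
      proof (cases "t i = 0")
        case False
        then have "t i > 0" using t01[of i] by simp
        then have "\<tau> i > 0" by (simp add: \<tau>_def)
        then have "\<bar>g (s * \<tau> i)\<bar> \<le> D * (s * \<tau> i) powr (- real n / 2)" using s by (intro D) simp
        also have "\<dots> = D * \<tau> i powr (- real n / 2) * s powr (- real n / 2)"
          using s \<open>\<tau> i > 0\<close> by (simp add: powr_mult)
        finally have "\<bar>c i\<bar> * (t i * \<bar>g (s * \<tau> i)\<bar>) \<le> \<bar>c i\<bar> * (t i * (D * \<tau> i powr (- real n / 2) * s powr (- real n / 2)))"
          using \<open>t i > 0\<close> by (intro mult_left_mono) auto
        then show ?thesis using \<open>t i > 0\<close> by (simp add: abs_mult mult.assoc)
      qed simp
    qed
    also have "\<dots> = E c * s powr (- real n / 2)" by (simp add: E_def sum_distrib_right)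
    finally have "\<bar>G c s\<bar>\<^sup>2 \<le> (E c * s powr (- real n / 2))\<^sup>2" by (intro power_mono) auto
    also have "\<dots> = (E c)\<^sup>2 * s powr (- real n)"
      using s by (simp add: power_mult_distrib power2_eq_square powr_add[symmetric])
    finally show ?thesis by (simp add: K_def)
  qed

  define V where "V = (\<lambda>c. LINT u|lborel. K c (norm (u::'n)) * norm u powr (\<alpha> j - real n))"
  have K_lim: "((\<lambda>r. r powr \<alpha> j * (LINT l|lborel. K c (r * (norm (l::'n) - a j)) * \<phi>' (norm l))) \<longlongrightarrow> A * h j 0 * V c) at_top" for c
    unfolding V_def A_def n_def
    by (rule spectral_scaling_limit[where 'n='n, OF a0 a_mono alpha0[unfolded n_def] alphai h_bdd h_cont
          \<phi>'_form \<phi>'_meas \<phi>'_L1 j K_meas K_even K_bdd K_decay[unfolded n_def]])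

  \<comment> \<open>The two processes and the limit kernels\<close>
  define X where "X = (\<lambda>r s \<omega>. if s = 0 then 0 else
                1 / (sqrt (A * h j 0) * r powr (real n - \<alpha> j / 2)) *
                (LINT x|lborel. f (r * s powr (1 / real n)) x * \<xi> x \<omega>))"
  define Xlim where "Xlim = (\<lambda>s \<omega>. if s = 0 then 0 else
                I (\<lambda>u. s * g (norm u * s powr (1 / real n)) / norm u powr ((real n - \<alpha> j) / 2)) \<omega>)"
  define Y where "Y = (\<lambda>r \<omega>. (\<chi> i. X r (t i) \<omega>) :: real ^ 'm)"
  define Ylim where "Ylim = (\<lambda>\<omega>. (\<chi> i. Xlim (t i) \<omega>) :: real ^ 'm)"
  \<comment> \<open>At time 0 both processes are 0 by definition, while the scale of
    \<open>f\<close> would be 0, where the hypotheses say nothing; sums are therefore restricted to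
    \<open>T\<close>.\<close>
  define T where "T = {i. t i \<noteq> 0}"
  have \<tau>_pos: "0 < \<tau> i" if "i \<in> T" for i using that t01[of i] by (simp add: T_def \<tau>_def)
  note field = gaussian_field_integral[OF M xi_meas xi_gauss xi_msc cov' \<phi>'_meas \<phi>'_L1]

  have Y_meas: "Y r \<in> borel_measurable M" if "r > 0" for r
    unfolding Y_def
  proof (rule borel_measurable_vec_lambda)
    fix i
    show "X r (t i) \<in> borel_measurable M"
    proof (cases "t i = 0")
      case True
      then show ?thesis by (simp add: X_def)
    next
      case False
      then have "0 < r * \<tau> i" using \<tau>_pos[of i] that by (simp add: T_def)
      from field(2)[OF f_L1[OF this]] show ?thesis using False by (simp add: X_def \<tau>_def)
    qed
  qed
  define \<gamma> where "\<gamma> = (\<lambda>i u::'n. t i * g (norm u * \<tau> i) / norm u powr ((real n - \<alpha> j) / 2))"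
  have \<gamma>_sum: "(\<Sum>i\<in>UNIV. c i * \<gamma> i u) = G c (norm u) / norm u powr ((real n - \<alpha> j) / 2)" for c u
    by (simp add: \<gamma>_def G_def sum_divide_distrib)
  have \<gamma>_sq: "(\<Sum>i\<in>UNIV. c i * \<gamma> i u)\<^sup>2 = K c (norm u) * norm u powr (\<alpha> j - real n)" for c u
  proof -
    have "(norm u powr ((real n - \<alpha> j) / 2))\<^sup>2 = norm u powr (real n - \<alpha> j)"
      by (simp add: power2_eq_square powr_add[symmetric])
    then show ?thesis
      unfolding \<gamma>_sum K_def power_divide using powr_minus_divide[of "norm u" "real n - \<alpha> j"] by simp
  qed
  have \<gamma>_L2: "square_integrable (\<gamma> i)" for i
  proof -
    \<comment> \<open>A coefficient vector concentrated at i reduces a single kernel to the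
      estimates already proved for \<open>K\<close>.\<close>
    have "integrable lborel (\<lambda>u::'n. K (\<lambda>l. if l = i then 1 else 0) (norm u) * norm u powr (\<alpha> j - real n))"
      unfolding n_def
      by (rule integrable_radial_powr[OF K_meas K_even K_bdd K_decay[unfolded n_def] \<alpha>j[unfolded n_def]])
    then have "integrable lborel (\<lambda>u. (\<gamma> i u)\<^sup>2)"
      unfolding \<gamma>_sq[symmetric] by (simp add: if_distrib[where f="\<lambda>x. x * _"] cong: if_cong)
    moreover have "\<gamma> i \<in> borel_measurable borel" unfolding \<gamma>_def by measurable
    ultimately show ?thesis by (simp add: square_integrable_def)
  qed
  have Xlim_eq: "Xlim (t i) = (if t i = 0 then (\<lambda>_. 0) else I (\<gamma> i))" for i
    by (auto simp: Xlim_def \<gamma>_def \<tau>_def)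
  have I_gauss: "centered_gaussian_rv N (I f) (LINT u|lborel. (f u)\<^sup>2)" if "square_integrable f" for f
    using Z that by (simp add: white_noise_integral_def)
  have Ylim_meas: "Ylim \<in> borel_measurable N"
    unfolding Ylim_def
    by (rule borel_measurable_vec_lambda)
       (use I_gauss[OF \<gamma>_L2] in \<open>auto simp: Xlim_eq centered_gaussian_rv_def\<close>)

  \<comment> \<open>Characteristic functions of both sides\<close>
  have char_Y: "(LINT \<omega>|M. cis (c \<bullet> Y r \<omega>)) =
      complex_of_real (exp (- (r powr \<alpha> j * (LINT l|lborel. K (($) c) (r * (norm (l::'n) - a j)) * \<phi>' (norm l)) / (A * h j 0)) / 2))"
    if r: "r > 0" for r and c :: "real ^ 'm"
  proof -
    define b where "b = (\<lambda>i. c $ i / (q * r powr (real n - \<alpha> j / 2)))"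
    define F where "F = (\<lambda>x. \<Sum>i\<in>T. b i * f (r * \<tau> i) x)"
    have r\<tau>: "0 < r * \<tau> i" if "i \<in> T" for i using r \<tau>_pos[OF that] by simp
    have fT: "finite T" by simp
    have F_int: "integrable lborel F"
      unfolding F_def by (intro Bochner_Integration.integrable_sum integrable_mult_right f_L1 r\<tau>)
    \<comment> \<open>Path integrals may be added only where all of them exist, which is almost
      surely the case for finitely many indices.\<close>
    have "AE \<omega> in M. \<forall>i\<in>T. integrable lborel (\<lambda>x. f (r * \<tau> i) x * \<xi> x \<omega>)"
      using field(1)[OF f_L1[OF r\<tau>]] by (intro AE_finite_allI[OF fT])
    then have eq: "AE \<omega> in M. c \<bullet> Y r \<omega> = (LINT x|lborel. F x * \<xi> x \<omega>)"
    proof eventually_elim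
      case (elim \<omega>)
      have "c \<bullet> Y r \<omega> = (\<Sum>i\<in>UNIV. c $ i * X r (t i) \<omega>)"
        by (simp add: Y_def inner_vec_def)
      also have "\<dots> = (\<Sum>i\<in>T. c $ i * X r (t i) \<omega>)"
        by (rule sum.mono_neutral_right) (auto simp: T_def X_def)
      also have "\<dots> = (\<Sum>i\<in>T. b i * (LINT x|lborel. f (r * \<tau> i) x * \<xi> x \<omega>))"
        by (rule sum.cong) (auto simp: T_def X_def b_def q_def \<tau>_def)
      also have "\<dots> = (LINT x|lborel. (\<Sum>i\<in>T. b i * (f (r * \<tau> i) x * \<xi> x \<omega>)))"
        using elim by (subst Bochner_Integration.integral_sum) auto
      also have "\<dots> = (LINT x|lborel. F x * \<xi> x \<omega>)"
        by (simp add: F_def sum_distrib_right mult.assoc)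
      finally show ?case .
    qed
    \<comment> \<open>Of the factor \<open>r ^ n\<close> in the transform the normalisation leaves
      \<open>r powr (\<alpha> j / 2)\<close>, whose square is the factor in
      \<open>K_lim\<close>.\<close>
    have rp: "r ^ n = r powr (real n - \<alpha> j / 2) * r powr (\<alpha> j / 2)"
      using r by (simp add: powr_add[symmetric] powr_realpow)
    have FT: "(LINT x|lborel. cis (l \<bullet> x) * complex_of_real (F x)) =
        complex_of_real (r powr (\<alpha> j / 2) / q * G (($) c) (r * (norm l - a j)))" for l
    proof -
      have int: "integrable lborel (\<lambda>x. cis (l \<bullet> x) * complex_of_real (f (r * \<tau> i) x))" if "i \<in> T" for i
        by (rule Bochner_Integration.integrable_bound[OF f_L1[OF r\<tau>[OF that]]])
           (use f_meas[OF r\<tau>[OF that]] in \<open>auto simp: norm_mult\<close>)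
      have "(LINT x|lborel. cis (l \<bullet> x) * complex_of_real (F x)) =
        (LINT x|lborel. (\<Sum>i\<in>T. complex_of_real (b i) * (cis (l \<bullet> x) * complex_of_real (f (r * \<tau> i) x))))"
        by (simp add: F_def sum_distrib_left mult.left_commute)
      also have "\<dots> = (\<Sum>i\<in>T. complex_of_real (b i) * (LINT x|lborel. cis (l \<bullet> x) * complex_of_real (f (r * \<tau> i) x)))"
        using int by (subst Bochner_Integration.integral_sum) auto
      also have "\<dots> = (\<Sum>i\<in>T. complex_of_real (b i * ((r * \<tau> i) ^ n * g (r * \<tau> i * (norm l - a j)))))"
        using r\<tau> by (intro sum.cong refl) (simp add: f_ft)
      also have "\<dots> = complex_of_real (\<Sum>i\<in>T. b i * ((r * \<tau> i) ^ n * g (r * \<tau> i * (norm l - a j))))"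
        by simp
      also have "(\<Sum>i\<in>T. b i * ((r * \<tau> i) ^ n * g (r * \<tau> i * (norm l - a j)))) =
         (\<Sum>i\<in>T. r powr (\<alpha> j / 2) / q * (c $ i * (t i * g (r * (norm l - a j) * \<tau> i))))"
      proof (rule sum.cong[OF refl])
        fix i
        have "r * \<tau> i * (norm l - a j) = r * (norm l - a j) * \<tau> i" by simp
        then show "b i * ((r * \<tau> i) ^ n * g (r * \<tau> i * (norm l - a j))) = r powr (\<alpha> j / 2) / q * (c $ i * (t i * g (r * (norm l - a j) * \<tau> i)))"
          using r q(1) by (simp only: power_mult_distrib \<tau>n rp b_def) simp
      qed
      also have "\<dots> = (\<Sum>i\<in>UNIV. r powr (\<alpha> j / 2) / q * (c $ i * (t i * g (r * (norm l - a j) * \<tau> i))))"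
        by (rule sum.mono_neutral_left) (auto simp: T_def)
      finally show ?thesis by (simp add: G_def sum_distrib_left)
    qed
    have "(LINT \<omega>|M. cis (c \<bullet> Y r \<omega>)) = (LINT \<omega>|M. cis (LINT x|lborel. F x * \<xi> x \<omega>))"
    proof (rule integral_cong_AE)
      show "AE \<omega> in M. cis (c \<bullet> Y r \<omega>) = cis (LINT x|lborel. F x * \<xi> x \<omega>)"
        using eq by eventually_elim simp
      show "(\<lambda>\<omega>. cis (c \<bullet> Y r \<omega>)) \<in> borel_measurable M" using Y_meas[OF r] by measurable
      show "(\<lambda>\<omega>. cis (LINT x|lborel. F x * \<xi> x \<omega>)) \<in> borel_measurable M" using field(2)[OF F_int] by measurable
    qed
    also have "\<dots> = complex_of_real (exp (- (LINT l|lborel. (cmod (LINT x|lborel. cis (l \<bullet> x) * complex_of_real (F x)))\<^sup>2 * \<phi>' (norm l)) / 2))"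
      by (rule field(3)[OF F_int])
    also have "(LINT l|lborel. (cmod (LINT x|lborel. cis (l \<bullet> x) * complex_of_real (F x)))\<^sup>2 * \<phi>' (norm l)) =
       (LINT l|lborel. (r powr \<alpha> j / (A * h j 0)) * (K (($) c) (r * (norm (l::'n) - a j)) * \<phi>' (norm l)))"
    proof (rule Bochner_Integration.integral_cong[OF refl])
      fix l :: 'n
      have "(r powr (\<alpha> j / 2))\<^sup>2 = r powr \<alpha> j" by (simp add: power2_eq_square powr_add[symmetric])
      then show "(cmod (LINT x|lborel. cis (l \<bullet> x) * complex_of_real (F x)))\<^sup>2 * \<phi>' (norm l) =
        (r powr \<alpha> j / (A * h j 0)) * (K (($) c) (r * (norm l - a j)) * \<phi>' (norm l))"
        unfolding FT norm_of_real power2_abs by (simp add: power_mult_distrib power_divide q(2) K_def)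
    qed
    also have "\<dots> = r powr \<alpha> j * (LINT l|lborel. K (($) c) (r * (norm (l::'n) - a j)) * \<phi>' (norm l)) / (A * h j 0)"
      by simp
    finally show ?thesis .
  qed
  have char_Ylim: "(LINT \<omega>|N. cis (c \<bullet> Ylim \<omega>)) = complex_of_real (exp (- V (($) c) / 2))" for c :: "real ^ 'm"
  proof -
    note sum = white_noise_integral_sum[OF Z, of T \<gamma> "($) c", OF _ \<gamma>_L2]
    have "\<gamma> i = (\<lambda>u. 0)" if "i \<notin> T" for i using that by (auto simp: \<gamma>_def T_def)
    then have TU: "(\<Sum>i\<in>T. c $ i * \<gamma> i u) = (\<Sum>i\<in>UNIV. c $ i * \<gamma> i u)" for u
      by (intro sum.mono_neutral_left) auto
    have "AE \<omega> in N. c \<bullet> Ylim \<omega> = I (\<lambda>u. \<Sum>i\<in>T. c $ i * \<gamma> i u) \<omega>"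
    proof -
      have "c \<bullet> Ylim \<omega> = (\<Sum>i\<in>T. c $ i * I (\<gamma> i) \<omega>)" for \<omega>
      proof -
        have "c \<bullet> Ylim \<omega> = (\<Sum>i\<in>UNIV. c $ i * Xlim (t i) \<omega>)"
          by (simp add: Ylim_def inner_vec_def)
        also have "\<dots> = (\<Sum>i\<in>T. c $ i * Xlim (t i) \<omega>)"
          by (rule sum.mono_neutral_right) (auto simp: T_def Xlim_def)
        also have "\<dots> = (\<Sum>i\<in>T. c $ i * I (\<gamma> i) \<omega>)"
          by (rule sum.cong) (auto simp: T_def Xlim_eq)
        finally show ?thesis .
      qed
      then show ?thesis using sum by (auto elim!: eventually_mono)
    qed
    \<comment> \<open>By \<open>\<gamma>_sq\<close> the variance of the white noise integral is
      exactly the limit of the variances of the field functionals.\<close>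
    moreover have cg: "centered_gaussian_rv N (I (\<lambda>u. \<Sum>i\<in>T. c $ i * \<gamma> i u)) (V (($) c))"
    proof -
      have "(LINT u|lborel. (\<Sum>i\<in>T. c $ i * \<gamma> i u)\<^sup>2) = V (($) c)"
        unfolding TU \<gamma>_sq V_def ..
      then show ?thesis using I_gauss[of "\<lambda>u. \<Sum>i\<in>T. c $ i * \<gamma> i u"] sum by auto
    qed
    ultimately have "(LINT \<omega>|N. cis (c \<bullet> Ylim \<omega>)) = (LINT \<omega>|N. cis (I (\<lambda>u. \<Sum>i\<in>T. c $ i * \<gamma> i u) \<omega>))"
      using Ylim_meas by (intro integral_cong_AE) (auto simp: centered_gaussian_rv_def elim!: eventually_mono)
    then show ?thesis using centered_gaussian_rv_char[OF N.prob_space_axioms cg] by simp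
  qed

  \<comment> \<open>Convergence of the laws\<close>
  have "weak_conv_along (\<lambda>r. distr M borel (Y r)) (distr N borel Ylim) at_top"
  proof (rule weak_conv_along_at_topI)
    show "prob_space (distr M borel (Y r))" if "r > 0" for r
      by (rule M.prob_space_distr[OF Y_meas[OF that]])
    show "prob_space (distr N borel Ylim)"
      by (rule N.prob_space_distr[OF Ylim_meas])
    fix c :: "real ^ 'm"
    have "((\<lambda>r. r powr \<alpha> j * (LINT l|lborel. K (($) c) (r * (norm (l::'n) - a j)) * \<phi>' (norm l)) / (A * h j 0))
        \<longlongrightarrow> A * h j 0 * V (($) c) / (A * h j 0)) at_top"
      using A hj by (intro tendsto_divide K_lim tendsto_const) auto
    also have "A * h j 0 * V (($) c) / (A * h j 0) = V (($) c)" using A hj by simp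
    finally have "((\<lambda>r. complex_of_real (exp (- (r powr \<alpha> j * (LINT l|lborel. K (($) c) (r * (norm (l::'n) - a j)) * \<phi>' (norm l)) / (A * h j 0)) / 2)))
      \<longlongrightarrow> complex_of_real (exp (- V (($) c) / 2))) at_top"
      by (intro tendsto_intros) auto
    moreover have "\<forall>\<^sub>F r in at_top. complex_of_real (exp (- (r powr \<alpha> j * (LINT l|lborel. K (($) c) (r * (norm (l::'n) - a j)) * \<phi>' (norm l)) / (A * h j 0)) / 2))
       = (LINT x|distr M borel (Y r). cis (c \<bullet> x))"
      using eventually_gt_at_top[of 0]
    proof eventually_elim
      case (elim r)
      then show ?case using char_Y[OF elim, of c] Y_meas[OF elim] by (subst integral_distr) auto
    qed
    ultimately have "((\<lambda>r. LINT x|distr M borel (Y r). cis (c \<bullet> x)) \<longlongrightarrow> complex_of_real (exp (- V (($) c) / 2))) at_top"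
      by (rule Lim_transform_eventually)
    also have "complex_of_real (exp (- V (($) c) / 2)) = (LINT x|distr N borel Ylim. cis (c \<bullet> x))"
      using Ylim_meas by (subst integral_distr) (auto simp: char_Ylim)
    finally show "((\<lambda>r. LINT x|distr M borel (Y r). cis (c \<bullet> x)) \<longlongrightarrow> (LINT x|distr N borel Ylim. cis (c \<bullet> x))) at_top" .
  qed simp_all
  then show "(let A = (if j = 0 then 1 else 2 * a j ^ (n - 1));
         X = (\<lambda>r s \<omega>. if s = 0 then 0 else
                1 / (sqrt (A * h j 0) * r powr (real n - \<alpha> j / 2)) *
                (LINT x|lborel. f (r * s powr (1 / real n)) x * \<xi> x \<omega>));
         Xlim = (\<lambda>s \<omega>. if s = 0 then 0 else
                I (\<lambda>u. s * g (norm u * s powr (1 / real n)) / norm u powr ((real n - \<alpha> j) / 2)) \<omega>)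
     in weak_conv_along (\<lambda>r. distr M borel (\<lambda>\<omega>. (\<chi> i. X r (t i) \<omega>) :: real ^ 'm))
          (distr N borel (\<lambda>\<omega>. (\<chi> i. Xlim (t i) \<omega>) :: real ^ 'm)) at_top)"
    unfolding Let_def Y_def Ylim_def X_def Xlim_def A_def .
qed

end
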